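(* Let $f(x)=g(x)+h(x)$ with $g(x)=\mathbb{E}_{z\sim\mathcal{P}}[g(x,z)]$ satisfy the assumptions in the context, with constants $\mu,L,\bar\ell$, and let $f^*=\min f$. Fix $\delta>0$, integers $T,m\in\mathbb{N}$ and an increasing sequence of penalties $0\le\lambda_0\le\dots\le\lambda_T$ (with $\lambda_{-1}:=0$). Then with probability at least $1-(T+3)\exp\left(-\frac{m}{18}\right)$, the point $x_{T+1}=\mathtt{BoostERMC}(\delta,T,m)$ (defined in the context) satisfies $$f(x_{T+1})-f^*\le\left(1+\sum_{i=0}^{T}\frac{\lambda_i}{\mu+\lambda_{i-1}}\right)\delta .$$
   Context: Setting. $(\Omega,\mathcal{F},\mathcal{P})$ is a probability space and $f$ is closed. Assumptions: (1) $g\colon\mathbb{R}^d\times\Omega\to\mathbb{R}$ is measurable; (2) $h\colon\mathbb{R}^d\to\mathbb{R}\cup\{+\infty\}$ is convex and there is $\mu>0$ such that $x\mapsto g(x,z)+h(x)$ is $\mu$-strongly convex (i.e. convex after subtracting $\frac\mu2\|\cdot\|^2$) for a.e. $z\sim\mathcal{P}$; (3) there are a measurable $\ell\colon\Omega\to\mathbb{R}$ and a real $\bar\ell>0$ with $\sqrt{\mathbb{E}_z\ell(z)^2}\le\bar\ell$ and $|g(x,z)-g(y,z)|\le\ell(z)\|x-y\|$ for all $x,y\in U$, $z\in\Omega$, where $U$ is some open neighborhood of $\operatorname{dom}h$; (4) the function $g\colon\mathbb{R}^d\to\mathbb{R}$ (the expectation) is $L$-smooth (differentiable with $L$-Lipschitz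 gradient). The gradient estimator for $g$ is $\nabla g(x,z)$ (gradient in $x$), whose variance is bounded by $4\bar\ell^2$. $\mathtt{ERM}(n,\lambda,x)$: draw $n$ i.i.d. samples $z_1,\dots,z_n\sim\mathcal{P}$ ($n$ rounded up to an integer) and return the minimizer of $y\mapsto\frac1n\sum_{i=1}^ng(y,z_i)+h(y)+\frac\lambda2\|y-x\|^2$. $\mathtt{ERM\text{-}R}(n,m,\lambda,x)$: call $\mathtt{ERM}(n,\lambda,x)$ independently $m$ times to get $y_1,\dots,y_m$; for each $i$ let $r_i$ be the smallest $r\ge0$ such that more than $m/2$ of the points $y_k$ satisfy $\|y_k-y_i\|\le r$; return $y_{i^*}$ where $i^*$ minimizes $r_i$. $\mathtt{Extract}(\{y_i\}_{i=1}^m,\rho)$ for a pseudometric $\rho$: for each $i$ let $r_i$ be the smallest $r\ge0$ such that more than $m/2$ of the points $y_k$ satisfy $\rho(y_i,y_k)\le r$; let $\hat r$ be the median of $r_1,\dots,r_m$, meaning the $\lceil m/2\rceil$-th entry in the list sorted in increasing order; return $\{i:r_i\le\hat r\}$. $\mathtt{BoostERMC}(\delta,T,m)$: set $\lambda_{-1}=0$, $x_{-1}=0$. For $j=0,\dots,T$ set $x_j=\mathtt{ERM\text{-}R}\left(\frac{54\bar\ell^2}{(\mu+\lambda_{j-1})\delta},m,\lambda_{j-1},x_{j-1}\right)$. Then apply the following robust gap estimation step to $f^T(x)=f(x)+\frac{\lambda_T}{2}\|x-x_T\|^2$, with smooth part $g(x)+\frac{\lambda_T}2\|x-x_T\|^2$.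 Put $\mu'=\mu+\lambda_T$, $L'=L+\lambda_T$, $\kappa'=L'/\mu'$, $\sigma^2=4\bar\ell^2$, $\epsilon'=\frac{\delta(\mu+\lambda_T)}{222(L+\lambda_T)}$, $G(x,z)=\nabla g(x,z)+\lambda_T(x-x_T)$. (1) Generate $u_1,\dots,u_m$ by $m$ independent calls to $\mathtt{ERM}\left(\frac{6\bar\ell^2}{(\mu+\lambda_T)\epsilon'},\lambda_T,x_T\right)$. (2) $\mathcal{I}_1=\mathtt{Extract}(\{u_i\},\rho_1)$ with $\rho_1(x,x')=\|x-x'\|$. (3) Fix an arbitrary $i\in\mathcal{I}_1$ and set $\hat x=u_i$. Independently for $k=1,\dots,m$ let $v_k$ be the average of $G(\hat x,z)$ over $\left\lceil\frac{3\sigma^2}{\kappa'^2\mu'\epsilon'}\right\rceil$ fresh i.i.d. samples $z\sim\mathcal{P}$; let $v=v_{k^*}$, where $k^*$ minimizes the smallest radius $r_k\ge0$ such that more than $m/2$ of the points $v_l$ satisfy $\|v_k-v_l\|\le r_k$. (4) $\mathcal{I}_2=\mathtt{Extract}(\{u_i\},\rho_2)$ with $\rho_2(x,x')=|h(x)-h(x')+\langle v,x-x'\rangle|$ on $\operatorname{dom}h$. Return $x_{T+1}=u_i$ for an arbitrary $i\in\mathcal{I}_1\cap\mathcal{I}_2$.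
   Formalization: The formal theorem adds the assumption μ ≤ L (condition number at least 1), without which the claim fails; the bound is asserted for every point the algorithm can return, and is void if I₁∩I₂ is empty, which can only happen for even m. *)

theory Defs
  imports "HOL-Probability.Probability"
begin

section \<open>Convex analysis\<close>

definition edom :: "('a \<Rightarrow> ereal) \<Rightarrow> 'a set" where
  "edom \<phi> = {x. \<phi> x < \<infinity>}"

text \<open>Convexity of functions into the reals extended by \<open>+\<infinity>\<close>; only meaningful if \<open>-\<infinity>\<close> is
  not a value.  Since \<open>0 * \<infinity> = 0\<close>, the endpoints \<open>t = 0, 1\<close> impose no condition.\<close>

definition ext_convex :: "('a::real_vector \<Rightarrow> ereal) \<Rightarrow> bool" where
  "ext_convex \<phi> \<longleftrightarrow>
     (\<forall>x y. \<forall>t\<in>{0..1}. \<phi> ((1 - t) *\<^sub>R x + t *\<^sub>R y) \<le> ereal (1 - t) * \<phi> x + ereal t * \<phi> y)"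

definition strongly_convex :: "real \<Rightarrow> ('a::real_normed_vector \<Rightarrow> ereal) \<Rightarrow> bool" where
  "strongly_convex \<mu> \<phi> \<longleftrightarrow> ext_convex (\<lambda>x. \<phi> x - ereal (\<mu> / 2 * (norm x)\<^sup>2))"

definition closed_function :: "('a::topological_space \<Rightarrow> ereal) \<Rightarrow> bool" where
  "closed_function \<phi> \<longleftrightarrow> closed {(x, t::real). \<phi> x \<le> ereal t}"

definition gradient :: "('a::real_inner \<Rightarrow> real) \<Rightarrow> 'a \<Rightarrow> 'a" where
  "gradient \<phi> x = (THE D. GDERIV \<phi> x :> D)"

definition L_smooth :: "real \<Rightarrow> ('a::euclidean_space \<Rightarrow> real) \<Rightarrow> bool" where
  "L_smooth L \<phi> \<longleftrightarrow> (\<forall>x. \<phi> differentiable (at x)) \<and> L-lipschitz_on UNIV (gradient \<phi>)"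

section \<open>The stochastic composite objective\<close>

definition expected_loss :: "'z measure \<Rightarrow> ('a \<Rightarrow> 'z \<Rightarrow> real) \<Rightarrow> 'a \<Rightarrow> real" where
  "expected_loss P g x = (LINT z|P. g x z)"

definition composite :: "'z measure \<Rightarrow> ('a \<Rightarrow> 'z \<Rightarrow> real) \<Rightarrow> ('a \<Rightarrow> ereal) \<Rightarrow> 'a \<Rightarrow> ereal" where
  "composite P g h x = ereal (expected_loss P g x) + h x"

section \<open>Robust selection\<close>

text \<open>Families of \<open>m\<close> points are functions restricted to the indices \<open>0, \<dots>, m - 1\<close>.\<close>

definition majority_radius :: "('a \<Rightarrow> 'a \<Rightarrow> real) \<Rightarrow> nat \<Rightarrow> (nat \<Rightarrow> 'a) \<Rightarrow> nat \<Rightarrow> real" where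
  "majority_radius \<rho> m y i =
     (LEAST r. 0 \<le> r \<and> real (card {k. k < m \<and> \<rho> (y i) (y k) \<le> r}) > real m / 2)"

definition most_central :: "('a \<Rightarrow> 'a \<Rightarrow> real) \<Rightarrow> nat \<Rightarrow> (nat \<Rightarrow> 'a) \<Rightarrow> nat \<Rightarrow> bool" where
  "most_central \<rho> m y i \<longleftrightarrow> is_arg_min (majority_radius \<rho> m y) (\<lambda>k. k < m) i"

text \<open>The median is the \<open>\<lceil>m / 2\<rceil>\<close>-th smallest radius, counted from 1.\<close>

definition Extract :: "('a \<Rightarrow> 'a \<Rightarrow> real) \<Rightarrow> nat \<Rightarrow> (nat \<Rightarrow> 'a) \<Rightarrow> nat set" where
  "Extract \<rho> m y =
     {i. i < m \<and> majority_radius \<rho> m y i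
                  \<le> sort (map (majority_radius \<rho> m y) [0..<m]) ! (nat \<lceil>real m / 2\<rceil> - 1)}"

section \<open>Regularized empirical risk minimization\<close>

definition erm_objective ::
  "('a::real_normed_vector \<Rightarrow> 'z \<Rightarrow> real) \<Rightarrow> ('a \<Rightarrow> ereal) \<Rightarrow> nat \<Rightarrow> real \<Rightarrow> 'a \<Rightarrow> (nat \<Rightarrow> 'z) \<Rightarrow> 'a \<Rightarrow> ereal"
where
  "erm_objective g h n pen x z y =
     ereal ((\<Sum>i<n. g y (z i)) / real n) + h y + ereal (pen / 2 * (norm (y - x))\<^sup>2)"

text \<open>The argument \<open>z\<close> is the stream of samples; only the first \<open>\<lceil>n\<rceil>\<close> are used.  The minimizer is
  arbitrary where it fails to exist or to be unique.\<close>

definition ERM ::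
  "('a::real_normed_vector \<Rightarrow> 'z \<Rightarrow> real) \<Rightarrow> ('a \<Rightarrow> ereal) \<Rightarrow> real \<Rightarrow> real \<Rightarrow> 'a \<Rightarrow> (nat \<Rightarrow> 'z) \<Rightarrow> 'a"
where
  "ERM g h n pen x z = (ARG_MIN (erm_objective g h (nat \<lceil>n\<rceil>) pen x z) y. True)"

section \<open>The BoostERMC procedure\<close>

text \<open>
  All randomness is a family \<open>w\<close> of i.i.d. samples from \<open>P\<close>: \<open>w (s, k, i)\<close> is the \<open>i\<close>-th sample
  used by the \<open>k\<close>-th repetition in stage \<open>s\<close>.  Stages \<open>0, \<dots>, T\<close> are the calls of ERM-R, stage
  \<open>T + 1\<close> generates the points \<open>u\<^sub>k\<close>, and stage \<open>T + 2\<close> the gradient estimates \<open>v\<^sub>k\<close>.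

  The index chosen at the end of stage \<open>s\<close> is \<open>c s w\<close>: for \<open>s \<le> T\<close> the index returned
  by ERM-R, for \<open>s = T + 1\<close> the index of the gradient base point, for \<open>s = T + 2\<close> the index of the
  selected gradient estimate.  Ties and arbitrary choices are thus left to \<open>c\<close>, which is
  constrained by \<open>nonanticipating\<close> and \<open>valid_choices\<close> below.
\<close>

type_synonym 'z samples = "nat \<times> nat \<times> nat \<Rightarrow> 'z"

type_synonym 'z choices = "nat \<Rightarrow> 'z samples \<Rightarrow> nat"

definition sample_space :: "'z measure \<Rightarrow> 'z samples measure" where
  "sample_space P = PiM UNIV (\<lambda>_. P)"

text \<open>The sequence of penalties shifted by one: \<open>\<lambda>\<^sub>j\<^sub>-\<^sub>1\<close> with \<open>\<lambda>\<^sub>-\<^sub>1 = 0\<close>.\<close>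

definition prev_pen :: "(nat \<Rightarrow> real) \<Rightarrow> nat \<Rightarrow> real" where
  "prev_pen lam j = (case j of 0 \<Rightarrow> 0 | Suc i \<Rightarrow> lam i)"

definition stage_erm ::
  "('a::euclidean_space \<Rightarrow> 'z \<Rightarrow> real) \<Rightarrow> ('a \<Rightarrow> ereal) \<Rightarrow> real \<Rightarrow> real \<Rightarrow> real \<Rightarrow> (nat \<Rightarrow> real)
    \<Rightarrow> nat \<Rightarrow> 'a \<Rightarrow> (nat \<Rightarrow> 'z) \<Rightarrow> 'a"
where
  "stage_erm g h lbar \<mu> \<delta> lam j x z =
     ERM g h (54 * lbar\<^sup>2 / ((\<mu> + prev_pen lam j) * \<delta>)) (prev_pen lam j) x z"

text \<open>Indices are shifted by one: \<open>boost_x \<dots> j\<close> is the iterate \<open>x\<^sub>j\<^sub>-\<^sub>1\<close>, the center of stage \<open>j\<close>.\<close>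

primrec boost_x ::
  "('a::euclidean_space \<Rightarrow> 'z \<Rightarrow> real) \<Rightarrow> ('a \<Rightarrow> ereal) \<Rightarrow> real \<Rightarrow> real \<Rightarrow> real \<Rightarrow> (nat \<Rightarrow> real)
    \<Rightarrow> 'z choices \<Rightarrow> 'z samples \<Rightarrow> nat \<Rightarrow> 'a"
where
  "boost_x g h lbar \<mu> \<delta> lam c w 0 = 0"
| "boost_x g h lbar \<mu> \<delta> lam c w (Suc j) =
     stage_erm g h lbar \<mu> \<delta> lam j (boost_x g h lbar \<mu> \<delta> lam c w j) (\<lambda>i. w (j, c j w, i))"

definition boost_y ::
  "('a::euclidean_space \<Rightarrow> 'z \<Rightarrow> real) \<Rightarrow> ('a \<Rightarrow> ereal) \<Rightarrow> real \<Rightarrow> real \<Rightarrow> real \<Rightarrow> (nat \<Rightarrow> real)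
    \<Rightarrow> 'z choices \<Rightarrow> 'z samples \<Rightarrow> nat \<Rightarrow> nat \<Rightarrow> 'a"
where
  "boost_y g h lbar \<mu> \<delta> lam c w j k =
     stage_erm g h lbar \<mu> \<delta> lam j (boost_x g h lbar \<mu> \<delta> lam c w j) (\<lambda>i. w (j, k, i))"

definition gap_eps :: "real \<Rightarrow> real \<Rightarrow> real \<Rightarrow> real \<Rightarrow> real" where
  "gap_eps \<mu> L \<delta> lamT = \<delta> * (\<mu> + lamT) / (222 * (L + lamT))"

definition boost_u ::
  "('a::euclidean_space \<Rightarrow> 'z \<Rightarrow> real) \<Rightarrow> ('a \<Rightarrow> ereal) \<Rightarrow> real \<Rightarrow> real \<Rightarrow> real \<Rightarrow> real \<Rightarrow> (nat \<Rightarrow> real)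
    \<Rightarrow> nat \<Rightarrow> 'z choices \<Rightarrow> 'z samples \<Rightarrow> nat \<Rightarrow> 'a"
where
  "boost_u g h lbar \<mu> L \<delta> lam T c w k =
     ERM g h (6 * lbar\<^sup>2 / ((\<mu> + lam T) * gap_eps \<mu> L \<delta> (lam T))) (lam T)
       (boost_x g h lbar \<mu> \<delta> lam c w (Suc T)) (\<lambda>i. w (T + 1, k, i))"

definition boost_I1 ::
  "('a::euclidean_space \<Rightarrow> 'z \<Rightarrow> real) \<Rightarrow> ('a \<Rightarrow> ereal) \<Rightarrow> real \<Rightarrow> real \<Rightarrow> real \<Rightarrow> real \<Rightarrow> (nat \<Rightarrow> real)
    \<Rightarrow> nat \<Rightarrow> nat \<Rightarrow> 'z choices \<Rightarrow> 'z samples \<Rightarrow> nat set"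
where
  "boost_I1 g h lbar \<mu> L \<delta> lam T m c w =
     Extract (\<lambda>x x'. norm (x - x')) m (boost_u g h lbar \<mu> L \<delta> lam T c w)"

text \<open>The average, at the base point \<open>xh\<close>, of gradients of the regularized smooth part centered
  at \<open>xT\<close>; \<open>4 * lbar\<^sup>2\<close> is the variance bound \<open>\<sigma>\<^sup>2\<close>.\<close>

definition gradient_estimate ::
  "('a::euclidean_space \<Rightarrow> 'z \<Rightarrow> real) \<Rightarrow> real \<Rightarrow> real \<Rightarrow> real \<Rightarrow> real \<Rightarrow> real \<Rightarrow> 'a \<Rightarrow> 'a \<Rightarrow> (nat \<Rightarrow> 'z) \<Rightarrow> 'a"
where
  "gradient_estimate g lbar \<mu> L \<delta> lamT xT xh z =
     (let \<mu>' = \<mu> + lamT; L' = L + lamT; \<kappa>' = L' / \<mu>'; var = 4 * lbar\<^sup>2;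
          n = nat \<lceil>3 * var / (\<kappa>'\<^sup>2 * \<mu>' * gap_eps \<mu> L \<delta> lamT)\<rceil>
      in (1 / real n) *\<^sub>R (\<Sum>i<n. gradient (\<lambda>x. g x (z i)) xh + lamT *\<^sub>R (xh - xT)))"

definition boost_v ::
  "('a::euclidean_space \<Rightarrow> 'z \<Rightarrow> real) \<Rightarrow> ('a \<Rightarrow> ereal) \<Rightarrow> real \<Rightarrow> real \<Rightarrow> real \<Rightarrow> real \<Rightarrow> (nat \<Rightarrow> real)
    \<Rightarrow> nat \<Rightarrow> 'z choices \<Rightarrow> 'z samples \<Rightarrow> nat \<Rightarrow> 'a"
where
  "boost_v g h lbar \<mu> L \<delta> lam T c w k =
     gradient_estimate g lbar \<mu> L \<delta> (lam T) (boost_x g h lbar \<mu> \<delta> lam c w (Suc T))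
       (boost_u g h lbar \<mu> L \<delta> lam T c w (c (T + 1) w)) (\<lambda>i. w (T + 2, k, i))"

text \<open>A pseudometric on \<open>edom h\<close>; outside the values of \<open>real_of_ereal\<close> are irrelevant.\<close>

definition gap_pseudometric :: "('a::real_inner \<Rightarrow> ereal) \<Rightarrow> 'a \<Rightarrow> 'a \<Rightarrow> 'a \<Rightarrow> real" where
  "gap_pseudometric h v x x' = \<bar>real_of_ereal (h x) - real_of_ereal (h x') + v \<bullet> (x - x')\<bar>"

definition boost_I2 ::
  "('a::euclidean_space \<Rightarrow> 'z \<Rightarrow> real) \<Rightarrow> ('a \<Rightarrow> ereal) \<Rightarrow> real \<Rightarrow> real \<Rightarrow> real \<Rightarrow> real \<Rightarrow> (nat \<Rightarrow> real)
    \<Rightarrow> nat \<Rightarrow> nat \<Rightarrow> 'z choices \<Rightarrow> 'z samples \<Rightarrow> nat set"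
where
  "boost_I2 g h lbar \<mu> L \<delta> lam T m c w =
     Extract (gap_pseudometric h (boost_v g h lbar \<mu> L \<delta> lam T c w (c (T + 2) w))) m
       (boost_u g h lbar \<mu> L \<delta> lam T c w)"

text \<open>The points \<open>x\<^sub>T\<^sub>+\<^sub>1\<close> that may be returned.  The set is nonempty whenever \<open>m\<close> is odd (see
  \<open>Extract_inter_nonempty\<close>); for even \<open>m\<close> the two index sets can be disjoint.\<close>

definition BoostERMC ::
  "('a::euclidean_space \<Rightarrow> 'z \<Rightarrow> real) \<Rightarrow> ('a \<Rightarrow> ereal) \<Rightarrow> real \<Rightarrow> real \<Rightarrow> real \<Rightarrow> real \<Rightarrow> (nat \<Rightarrow> real)
    \<Rightarrow> nat \<Rightarrow> nat \<Rightarrow> 'z choices \<Rightarrow> 'z samples \<Rightarrow> 'a set"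
where
  "BoostERMC g h lbar \<mu> L \<delta> lam T m c w =
     boost_u g h lbar \<mu> L \<delta> lam T c w `
       (boost_I1 g h lbar \<mu> L \<delta> lam T m c w \<inter> boost_I2 g h lbar \<mu> L \<delta> lam T m c w)"

text \<open>A choice made at the end of stage \<open>s\<close> may depend on all samples drawn so far but on none
  drawn later: otherwise the later samples would not be fresh.\<close>

definition nonanticipating :: "'z measure \<Rightarrow> nat \<Rightarrow> 'z choices \<Rightarrow> bool" where
  "nonanticipating P T c \<longleftrightarrow>
     (\<forall>s\<le>T + 2. c s \<in> measurable (sample_space P) (count_space UNIV) \<and>
        (\<forall>w\<in>space (sample_space P). \<forall>w'\<in>space (sample_space P).
           (\<forall>j\<le>s. \<forall>k i. w (j, k, i) = w' (j, k, i)) \<longrightarrow> c s w = c s w'))"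

text \<open>Validity is only required almost surely, because the minimizers computed by ERM are
  well-defined only almost surely.\<close>

definition valid_choices ::
  "'z measure \<Rightarrow> ('a::euclidean_space \<Rightarrow> 'z \<Rightarrow> real) \<Rightarrow> ('a \<Rightarrow> ereal) \<Rightarrow> real \<Rightarrow> real \<Rightarrow> real \<Rightarrow> real
    \<Rightarrow> (nat \<Rightarrow> real) \<Rightarrow> nat \<Rightarrow> nat \<Rightarrow> 'z choices \<Rightarrow> bool"
where
  "valid_choices P g h lbar \<mu> L \<delta> lam T m c \<longleftrightarrow>
     (AE w in sample_space P.
        (\<forall>j\<le>T. most_central (\<lambda>x x'. norm (x - x')) m (boost_y g h lbar \<mu> \<delta> lam c w j) (c j w)) \<and>
        c (T + 1) w \<in> boost_I1 g h lbar \<mu> L \<delta> lam T m c w \<and>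
        most_central (\<lambda>x x'. norm (x - x')) m (boost_v g h lbar \<mu> L \<delta> lam T c w) (c (T + 2) w))"

section \<open>The index sets intersect for odd \<open>m\<close>\<close>

lemma card_Extract:
  assumes "0 < m"
  shows "nat \<lceil>real m / 2\<rceil> \<le> card (Extract \<rho> m y)"
proof -
  define R where "R = majority_radius \<rho> m y"
  define xs where "xs = map R [0..<m]"
  define p where "p = nat \<lceil>real m / 2\<rceil>"
  have pm: "p \<le> m" "0 < p" using assms unfolding p_def by linarith+
  have "p = card {..<p}" by simp
  also have "\<dots> \<le> card {i. i < length (sort xs) \<and> sort xs ! i \<le> sort xs ! (p - 1)}"
    using pm by (intro card_mono) (auto simp: xs_def intro!: sorted_nth_mono)
  also have "\<dots> = length (filter (\<lambda>t. t \<le> sort xs ! (p - 1)) (sort xs))"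
    by (rule length_filter_conv_card[symmetric])
  also have "\<dots> = length (filter (\<lambda>t. t \<le> sort xs ! (p - 1)) xs)"
    by (metis mset_filter mset_sort size_mset)
  also have "\<dots> = card {i. i < length xs \<and> xs ! i \<le> sort xs ! (p - 1)}"
    by (rule length_filter_conv_card)
  also have "{i. i < length xs \<and> xs ! i \<le> sort xs ! (p - 1)} = Extract \<rho> m y"
    by (auto simp: Extract_def xs_def R_def p_def)
  finally show ?thesis by (simp add: p_def)
qed

lemma Extract_inter_nonempty:
  assumes "odd m"
  shows "Extract \<rho> m y \<inter> Extract \<rho>' m y' \<noteq> {}"
proof
  assume *: "Extract \<rho> m y \<inter> Extract \<rho>' m y' = {}"
  have sub: "Extract \<rho> m y \<subseteq> {..<m}" "Extract \<rho>' m y' \<subseteq> {..<m}"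
    by (auto simp: Extract_def)
  have "card (Extract \<rho> m y) + card (Extract \<rho>' m y') = card (Extract \<rho> m y \<union> Extract \<rho>' m y')"
    using sub * by (intro card_Un_disjoint[symmetric]) (auto intro: finite_subset)
  also have "\<dots> \<le> card {..<m}" using sub by (intro card_mono) auto
  finally have "card (Extract \<rho> m y) + card (Extract \<rho>' m y') \<le> m" by simp
  with card_Extract[OF odd_pos[OF assms], of \<rho> y] card_Extract[OF odd_pos[OF assms], of \<rho>' y']
  have "2 * nat \<lceil>real m / 2\<rceil> \<le> m" by linarith
  moreover have "real m / 2 \<le> real (nat \<lceil>real m / 2\<rceil>)" by linarith
  ultimately have "2 * nat \<lceil>real m / 2\<rceil> = m" by linarith
  then show False using assms by (metis dvd_triv_left)
qed

end

theory Submission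
  imports Defs
begin

text \<open>
  Stability of strongly convex minimization bounds the expected suboptimality of one regularized ERM
  call with \<open>n\<close> samples by \<open>2 lbar\<^sup>2 / (n (\<mu> + p))\<close>, so by Markov's inequality a call succeeds with
  probability at least \<open>2 / 3\<close>, for any fixed center.  The samples of a stage are independent of its center, so
  by Hoeffding's inequality a majority of the \<open>m\<close> calls of a stage succeeds except with probability
  \<open>exp (- m / 18)\<close>; the same holds for the gradient estimates, by Chebyshev's inequality.

  If all stages succeed, then the majority rule puts \<open>x\<^sub>j\<close> within squared distance \<open>2 \<delta> / (\<mu> + \<lambda>\<^sub>j\<^sub>-\<^sub>1)\<close> of the
  minimizer \<open>p\<^sub>j\<^sub>-\<^sub>1\<close> of the objective regularized around \<open>x\<^sub>j\<^sub>-\<^sub>1\<close>.  Comparing the objective regularized around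
  \<open>x\<^sub>j\<close> at its minimizer \<open>p\<^sub>j\<close> and at \<open>p\<^sub>j\<^sub>-\<^sub>1\<close> gives \<open>f p\<^sub>j \<le> f p\<^sub>j\<^sub>-\<^sub>1 + \<lambda>\<^sub>j \<delta> / (\<mu> + \<lambda>\<^sub>j\<^sub>-\<^sub>1)\<close>, which telescopes.
  For the last step, the unknown gap of a point \<open>u\<close> equals \<open>h u - h p + \<langle>v, u - p\<rangle>\<close>, a quantity whose differences
  are measured by the second pseudometric, up to errors of order \<open>\<kappa>' \<epsilon>'\<close>.
\<close>

section \<open>Strongly convex functions on a convex domain\<close>

text \<open>Measurability shapes the probabilistic half: \<open>ERM\<close> is an arbitrary choice
  of minimizer, and of the choices in \<open>c\<close> little more is known than measurability. The
  minimizers are therefore rebuilt by an explicit limit formula (\<open>yhat\<close>,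
  \<open>prox\<close>), failure is a measurable set \<open>fail\<close> of pairs of a center and
  samples, and the agreement with the algorithm is established on good samples, hence almost surely.
  Conditioning on earlier stages is replaced by resampling (\<open>merge_on\<close>). Constants: a
  success probability of 2/3 where 1/2 is needed leaves a deviation of 1/6, and 2 / 36 = 1/18. The
  54 in the sample size is 6 times 9: the 6 is 3 from Markov's inequality times the 2 of the
  expected suboptimality, and 9 is the square of the factor 3 that the majority rule costs in
  distance. The last step costs 99 \<kappa>' \<epsilon>', while \<delta> = 222 \<kappa>'
  \<epsilon>'. The T + 3 failure events belong to the T + 1 calls of ERM-R, the points u and the
  gradient estimates.\<close>

definition sconv :: "real \<Rightarrow> 'a::real_normed_vector set \<Rightarrow> ('a \<Rightarrow> real) \<Rightarrow> bool" where
  "sconv \<mu> C \<phi> \<longleftrightarrow> (\<forall>x\<in>C. \<forall>y\<in>C. \<forall>t\<in>{0..1}.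
     \<phi> ((1 - t) *\<^sub>R x + t *\<^sub>R y) \<le> (1 - t) * \<phi> x + t * \<phi> y - \<mu> / 2 * t * (1 - t) * (norm (x - y))\<^sup>2)"

text \<open>The epigraph of the function that is \<open>\<phi>\<close> on \<open>C\<close> and
  infinite elsewhere. Its closedness expresses lower semicontinuity of that extended function while
  \<open>\<phi>\<close> stays real-valued.\<close>

definition epi_on :: "'a set \<Rightarrow> ('a \<Rightarrow> real) \<Rightarrow> ('a \<times> real) set" where
  "epi_on C \<phi> = {(x, t). x \<in> C \<and> \<phi> x \<le> t}"

lemma norm_sq_convex_combination:
  fixes x y :: "'a::real_inner"
  shows "(norm ((1 - t) *\<^sub>R x + t *\<^sub>R y))\<^sup>2
    = (1 - t) * (norm x)\<^sup>2 + t * (norm y)\<^sup>2 - t * (1 - t) * (norm (x - y))\<^sup>2"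
  unfolding power2_norm_eq_inner inner_add_left inner_add_right inner_diff_left inner_diff_right
    inner_scaleR_left inner_scaleR_right inner_commute[of y x] by algebra

lemma sconv_add:
  assumes "sconv \<mu> C \<phi>" "sconv \<nu> C \<psi>"
  shows "sconv (\<mu> + \<nu>) C (\<lambda>x. \<phi> x + \<psi> x)"
  unfolding sconv_def
proof (intro ballI)
  fix x y and t :: real assume *: "x \<in> C" "y \<in> C" "t \<in> {0..1}"
  let ?z = "(1 - t) *\<^sub>R x + t *\<^sub>R y"
  have "\<phi> ?z + \<psi> ?z \<le> ((1 - t) * \<phi> x + t * \<phi> y - \<mu> / 2 * t * (1 - t) * (norm (x - y))\<^sup>2)
      + ((1 - t) * \<psi> x + t * \<psi> y - \<nu> / 2 * t * (1 - t) * (norm (x - y))\<^sup>2)"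
    using assms * unfolding sconv_def by (intro add_mono) auto
  also have "\<dots> = (1 - t) * (\<phi> x + \<psi> x) + t * (\<phi> y + \<psi> y) - (\<mu> + \<nu>) / 2 * t * (1 - t) * (norm (x - y))\<^sup>2"
    by algebra
  finally show "\<phi> ?z + \<psi> ?z \<le> \<dots>" .
qed

lemma sconv_quadratic:
  fixes C :: "'a::real_inner set"
  shows "sconv p C (\<lambda>y. p / 2 * (norm (y - x))\<^sup>2)"
  unfolding sconv_def
proof (intro ballI)
  fix y z and t :: real
  have "(1 - t) *\<^sub>R y + t *\<^sub>R z - x = (1 - t) *\<^sub>R (y - x) + t *\<^sub>R (z - x)"
    by (simp add: algebra_simps)
  then have "(norm ((1 - t) *\<^sub>R y + t *\<^sub>R z - x))\<^sup>2
    = (1 - t) * (norm (y - x))\<^sup>2 + t * (norm (z - x))\<^sup>2 - t * (1 - t) * (norm (y - z))\<^sup>2"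
    using norm_sq_convex_combination[of t "y - x" "z - x"] by simp
  then have "p / 2 * (norm ((1 - t) *\<^sub>R y + t *\<^sub>R z - x))\<^sup>2
    = p / 2 * ((1 - t) * (norm (y - x))\<^sup>2 + t * (norm (z - x))\<^sup>2 - t * (1 - t) * (norm (y - z))\<^sup>2)"
    by (rule arg_cong)
  also have "\<dots> = (1 - t) * (p / 2 * (norm (y - x))\<^sup>2) + t * (p / 2 * (norm (z - x))\<^sup>2)
      - p / 2 * t * (1 - t) * (norm (y - z))\<^sup>2"
    by (simp add: algebra_simps diff_divide_distrib add_divide_distrib)
  finally show "p / 2 * (norm ((1 - t) *\<^sub>R y + t *\<^sub>R z - x))\<^sup>2
    \<le> (1 - t) * (p / 2 * (norm (y - x))\<^sup>2) + t * (p / 2 * (norm (z - x))\<^sup>2)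
      - p / 2 * t * (1 - t) * (norm (y - z))\<^sup>2"
    by (rule eq_refl)
qed

text \<open>Comparing \<open>y\<close> with the points of the segment towards \<open>x\<close> and
  dividing by \<open>t\<close> gives the claim with an extra factor \<open>1 - t\<close>, which
  disappears as \<open>t\<close> tends to 0.\<close>

lemma sconv_growth:
  assumes "sconv \<mu> C \<phi>" "convex C" "y \<in> C" "x \<in> C" "\<And>x. x \<in> C \<Longrightarrow> \<phi> y \<le> \<phi> x"
  shows "\<phi> y + \<mu> / 2 * (norm (x - y))\<^sup>2 \<le> \<phi> x"
proof -
  have *: "\<mu> / 2 * (1 - t) * (norm (x - y))\<^sup>2 \<le> \<phi> x - \<phi> y" if "0 < t" "t < 1" for t :: real
  proof -
    have "\<phi> y \<le> \<phi> ((1 - t) *\<^sub>R y + t *\<^sub>R x)"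
      using assms that by (intro assms(5) convexD) auto
    also have "\<dots> \<le> (1 - t) * \<phi> y + t * \<phi> x - \<mu> / 2 * t * (1 - t) * (norm (y - x))\<^sup>2"
      using assms(1,3,4) that unfolding sconv_def by auto
    finally have "t * (\<mu> / 2 * (1 - t) * (norm (x - y))\<^sup>2) \<le> t * (\<phi> x - \<phi> y)"
      by (simp add: algebra_simps norm_minus_commute)
    then show ?thesis using that by simp
  qed
  have "((\<lambda>t. \<mu> / 2 * (1 - t) * (norm (x - y))\<^sup>2) \<longlongrightarrow> \<mu> / 2 * (1 - 0) * (norm (x - y))\<^sup>2) (at_right (0::real))"
    by (intro tendsto_intros)
  then have "\<mu> / 2 * (1 - 0) * (norm (x - y))\<^sup>2 \<le> \<phi> x - \<phi> y"
    using * by (intro tendsto_upperbound[where F = "at_right (0::real)"])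
      (auto simp: eventually_at_right_field intro!: exI[of _ 1])
  then show ?thesis by simp
qed

text \<open>Sublevel sets are slices of the closed epigraph, hence closed; on the compact ball the
  finite intersection property yields a point lying in all of them.\<close>

lemma attains_min_on_cball:
  fixes C :: "'a::euclidean_space set"
  assumes cl: "closed (epi_on C \<phi>)" and x0: "x0 \<in> C \<inter> cball a R"
  shows "\<exists>y\<in>C \<inter> cball a R. \<forall>x\<in>C \<inter> cball a R. \<phi> y \<le> \<phi> x"
proof -
  let ?K = "C \<inter> cball a R"
  define S where "S x = cball a R \<inter> {y. y \<in> C \<and> \<phi> y \<le> \<phi> x}" for x
  have "closed {y. y \<in> C \<and> \<phi> y \<le> t}" for t
  proof -
    have "{y. y \<in> C \<and> \<phi> y \<le> t} = (\<lambda>y. (y, t)) -` epi_on C \<phi>" by (auto simp: epi_on_def)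
    then show ?thesis using cl by (simp add: closed_vimage continuous_on_Pair)
  qed
  then have clS: "closed (S x)" for x unfolding S_def by (intro closed_Int) auto
  have "cball a R \<inter> (\<Inter>x\<in>?K. S x) \<noteq> {}"
  proof (rule compact_imp_fip_image)
    show "compact (cball a R)" by simp
    show "closed (S x)" for x by (rule clS)
    fix I assume I: "finite I" "I \<subseteq> ?K"
    show "cball a R \<inter> (\<Inter>x\<in>I. S x) \<noteq> {}"
    proof (cases "I = {}")
      case True then show ?thesis using x0 by blast
    next
      case False
      then obtain i where "i \<in> I" "\<forall>x\<in>I. \<phi> i \<le> \<phi> x"
        using ex_is_arg_min_if_finite[OF I(1), of \<phi>] by (auto simp: is_arg_min_linorder)
      then have "i \<in> cball a R \<inter> (\<Inter>x\<in>I. S x)" using I by (auto simp: S_def)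
      then show ?thesis by blast
    qed
  qed
  then obtain y where "y \<in> (\<Inter>x\<in>?K. S x)" by blast
  then have "\<forall>x\<in>?K. y \<in> S x" by blast
  then have "y \<in> ?K" "\<forall>x\<in>?K. \<phi> y \<le> \<phi> x" using x0 unfolding S_def by blast+
  then show ?thesis by blast
qed

text \<open>Strong convexity gives coercivity: a lower bound on the unit ball around
  \<open>x0\<close> forces values above \<open>\<phi> x0\<close> outside a larger ball, so the
  minimum over that ball is global.\<close>

lemma sconv_attains_min:
  fixes C :: "'a::euclidean_space set"
  assumes sc: "sconv \<mu> C \<phi>" and mu: "0 < \<mu>" and C: "convex C" "C \<noteq> {}" and cl: "closed (epi_on C \<phi>)"
  shows "\<exists>y\<in>C. \<forall>x\<in>C. \<phi> y \<le> \<phi> x"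
proof -
  obtain x0 where x0: "x0 \<in> C" using C by auto
  obtain y1 where y1: "\<forall>x\<in>C \<inter> cball x0 1. \<phi> y1 \<le> \<phi> x"
    using attains_min_on_cball[OF cl, of x0 x0 1] x0 by auto
  \<comment> \<open>Chosen so that \<open>\<mu> / 2 * (d - 1)\<close> exceeds
    \<open>\<phi> x0 - \<phi> y1\<close> as soon as \<open>d > R\<close>.\<close>
  define R where "R = 1 + 2 * (\<phi> x0 - \<phi> y1) / \<mu>"
  have R1: "R \<ge> 1" using y1 x0 mu by (auto simp: R_def)
  obtain y where y: "y \<in> C \<inter> cball x0 R" "\<forall>x\<in>C \<inter> cball x0 R. \<phi> y \<le> \<phi> x"
    using attains_min_on_cball[OF cl, of x0 x0 R] x0 R1 by auto
  have "\<phi> y \<le> \<phi> x" if x: "x \<in> C" for x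
  proof (cases "dist x0 x \<le> R")
    case True then show ?thesis using y x by auto
  next
    case False
    define d where "d = norm (x0 - x)"
    \<comment> \<open>This weight puts the convex combination at distance exactly 1 from
      \<open>x0\<close>, where \<open>\<phi> y1\<close> is a lower bound.\<close>
    define t where "t = 1 / d"
    have d: "d > R" "d > 1" using False R1 by (auto simp: d_def dist_norm)
    have t: "0 < t" "t < 1" "t * d = 1" using d by (auto simp: t_def)
    let ?z = "(1 - t) *\<^sub>R x0 + t *\<^sub>R x"
    have "norm (x0 - ?z) = norm (t *\<^sub>R (x0 - x))" by (simp add: algebra_simps)
    also have "\<dots> = 1" using t by (simp add: d_def)
    finally have "?z \<in> cball x0 1" by (simp add: dist_norm)
    moreover have "?z \<in> C" using C x x0 t by (intro convexD) auto
    ultimately have "\<phi> y1 \<le> \<phi> ?z" using y1 by auto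
    also have "\<dots> \<le> (1 - t) * \<phi> x0 + t * \<phi> x - \<mu> / 2 * t * (1 - t) * d\<^sup>2"
      using sc x x0 t unfolding sconv_def d_def by auto
    also have "\<mu> / 2 * t * (1 - t) * d\<^sup>2 = \<mu> / 2 * (d - 1)"
      using t d by (simp add: t_def field_simps power2_eq_square)
    finally have *: "\<phi> y1 \<le> (1 - t) * \<phi> x0 + t * \<phi> x - \<mu> / 2 * (d - 1)" .
    have "\<phi> x0 - \<phi> y1 = \<mu> / 2 * (R - 1)" using mu by (simp add: R_def)
    also have "\<dots> < \<mu> / 2 * (d - 1)" using d mu by simp
    finally have "\<phi> x0 - \<phi> y1 < \<mu> / 2 * (d - 1)" .
    moreover have "(1 - t) * \<phi> x0 + t * \<phi> x = \<phi> x0 - t * \<phi> x0 + t * \<phi> x" by algebra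
    ultimately have "t * \<phi> x0 < t * \<phi> x" using * by linarith
    then have "\<phi> x0 < \<phi> x" using t by simp
    moreover have "\<phi> y \<le> \<phi> x0" using y x0 R1 by auto
    ultimately show ?thesis by simp
  qed
  then show ?thesis using y by blast
qed

text \<open>The new epigraph is the preimage of the old one under the shear that lowers the height
  at \<open>x\<close> by \<open>q x\<close>.\<close>

lemma closed_epi_add_continuous:
  fixes C :: "'a::metric_space set"
  assumes cl: "closed (epi_on C \<phi>)" and q: "continuous_on D q" and D: "closed D" "C \<subseteq> D"
  shows "closed (epi_on C (\<lambda>x. \<phi> x + q x))"
proof -
  have "epi_on C (\<lambda>x. \<phi> x + q x) = (D \<times> UNIV) \<inter> (\<lambda>(x, t). (x, t - q x)) -` epi_on C \<phi>"
    using D by (auto simp: epi_on_def algebra_simps)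
  moreover have "continuous_on (D \<times> UNIV) (\<lambda>(x, t). (x, t - q x))"
    unfolding case_prod_beta
    by (intro continuous_intros continuous_on_compose2[OF q]) auto
  ultimately show ?thesis
    using continuous_closed_preimage[OF _ closed_Times[OF D(1) closed_UNIV] cl] by simp
qed

text \<open>\<open>C\<close> may fail to be closed and \<open>\<psi>\<close> is controlled only on
  \<open>C\<close>; a Lipschitz function extends continuously to the closure, where the shear
  argument applies.\<close>

lemma closed_epi_add_lipschitz:
  fixes C :: "'a::metric_space set"
  assumes cl: "closed (epi_on C \<phi>)" and lip: "K-lipschitz_on C \<psi>"
  shows "closed (epi_on C (\<lambda>x. \<phi> x + \<psi> x))"
proof -
  obtain q where q: "continuous_on (closure C) q" "\<And>x. x \<in> C \<Longrightarrow> q x = \<psi> x"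
    using lipschitz_extend_closure[OF lip] lipschitz_on_continuous_on by metis
  have "epi_on C (\<lambda>x. \<phi> x + \<psi> x) = epi_on C (\<lambda>x. \<phi> x + q x)"
    using q by (auto simp: epi_on_def)
  then show ?thesis using closed_epi_add_continuous[OF cl q(1) closed_closure closure_subset] by simp
qed

text \<open>A measurable selection of the minimizer: along a countable sequence \<open>d\<close>, the first point
  that is optimal up to \<open>1 / (k + 1)\<close> depends measurably on the objective, and by strong convexity
  these points converge to the minimizer.\<close>

definition lim_argmin :: "(nat \<Rightarrow> 'a::t2_space) \<Rightarrow> ('a \<Rightarrow> real) \<Rightarrow> 'a" where
  "lim_argmin d F = lim (\<lambda>k. d (LEAST j. \<forall>i. F (d j) \<le> F (d i) + 1 / real (Suc k)))"

lemma borel_measurable_lim_argmin [measurable (raw)]: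
  fixes d :: "nat \<Rightarrow> 'a::{banach, second_countable_topology}"
  assumes [measurable]: "\<And>j. (\<lambda>\<omega>. \<Phi> \<omega> (d j)) \<in> borel_measurable M"
  shows "(\<lambda>\<omega>. lim_argmin d (\<Phi> \<omega>)) \<in> borel_measurable M"
  unfolding lim_argmin_def
proof (rule borel_measurable_lim_metric)
  fix k
  have "(\<lambda>\<omega>. LEAST j. \<forall>i. \<Phi> \<omega> (d j) \<le> \<Phi> \<omega> (d i) + 1 / real (Suc k)) \<in> measurable M (count_space UNIV)"
    by measurable
  then show "(\<lambda>\<omega>. d (LEAST j. \<forall>i. \<Phi> \<omega> (d j) \<le> \<Phi> \<omega> (d i) + 1 / real (Suc k))) \<in> borel_measurable M"
    by (rule measurable_compose) simp
qed

lemma lim_argmin_eq: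
  fixes d :: "nat \<Rightarrow> 'a::euclidean_space"
  assumes mu: "0 < \<mu>" and d: "range d \<subseteq> C"
    and growth: "\<And>x. x \<in> C \<Longrightarrow> F y + \<mu> / 2 * (norm (x - y))\<^sup>2 \<le> F x"
    and dense: "\<And>e. 0 < e \<Longrightarrow> \<exists>j. F (d j) \<le> F y + e"
  shows "lim_argmin d F = y"
  unfolding lim_argmin_def
proof (rule limI)
  define J where "J k = (LEAST j. \<forall>i. F (d j) \<le> F (d i) + 1 / real (Suc k))" for k
  have J: "F (d (J k)) \<le> F (d i) + 1 / real (Suc k)" for k i
  proof -
    obtain j where j: "F (d j) \<le> F y + 1 / real (Suc k)" using dense[of "1 / real (Suc k)"] by auto
    have "F y \<le> F (d i)" for i
    proof -
      have "0 \<le> \<mu> / 2 * (norm (d i - y))\<^sup>2" using mu by simp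
      moreover have "d i \<in> C" using d by auto
      ultimately show ?thesis using growth[of "d i"] by linarith
    qed
    with j have "\<forall>i. F (d j) \<le> F (d i) + 1 / real (Suc k)" by (meson add_mono dual_order.trans order_refl)
    then have "\<forall>i. F (d (J k)) \<le> F (d i) + 1 / real (Suc k)" unfolding J_def by (rule LeastI)
    then show ?thesis ..
  qed
  have bound: "norm (d (J k) - y) \<le> sqrt (2 / \<mu> * (1 / real (Suc k)))" for k
  proof (rule real_le_rsqrt)
    \<comment> \<open>By density the infimum of \<open>F\<close> along \<open>d\<close> is
      \<open>F y\<close>, so near-optimality within the sequence is near-optimality
      outright.\<close>
    have "F (d (J k)) \<le> F y + 1 / real (Suc k)"
    proof (rule field_le_epsilon)
      fix e :: real assume "0 < e"
      then obtain i where "F (d i) \<le> F y + e" using dense by blast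
      with J[of k i] show "F (d (J k)) \<le> F y + 1 / real (Suc k) + e" by linarith
    qed
    with growth[of "d (J k)"] d have "\<mu> / 2 * (norm (d (J k) - y))\<^sup>2 \<le> 1 / real (Suc k)" by force
    then show "(norm (d (J k) - y))\<^sup>2 \<le> 2 / \<mu> * (1 / real (Suc k))"
      using mu by (simp add: pos_le_divide_eq ac_simps)
  qed
  have "(\<lambda>k. sqrt (2 / \<mu> * (1 / real (Suc k)))) \<longlonglongrightarrow> sqrt (2 / \<mu> * 0)"
    by (intro tendsto_intros LIMSEQ_Suc[OF lim_1_over_n])
  then have "(\<lambda>k. sqrt (2 / \<mu> * (1 / real (Suc k)))) \<longlonglongrightarrow> 0" by simp
  then have "(\<lambda>k. d (J k) - y) \<longlonglongrightarrow> 0"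
    by (rule Lim_null_comparison[rotated]) (rule always_eventually, rule allI, rule bound)
  then show "(\<lambda>k. d (LEAST j. \<forall>i. F (d j) \<le> F (d i) + 1 / real (Suc k))) \<longlonglongrightarrow> y"
    unfolding J_def[symmetric] by (rule Lim_null[THEN iffD2])
qed

text \<open>The graph of \<open>\<phi>\<close> is a subset of a separable space; a countable dense
  subset of it is projected to the first factor.\<close>

lemma graph_dense_sequence:
  fixes C :: "'a::euclidean_space set" and \<phi> :: "'a \<Rightarrow> real"
  assumes "C \<noteq> {}"
  shows "\<exists>d::nat \<Rightarrow> 'a. range d \<subseteq> C \<and>
    (\<forall>x\<in>C. \<exists>s. (\<lambda>k. d (s k)) \<longlonglongrightarrow> x \<and> (\<lambda>k. \<phi> (d (s k))) \<longlonglongrightarrow> \<phi> x)"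
proof -
  let ?G = "(\<lambda>x. (x, \<phi> x)) ` C"
  obtain D where D: "countable D" "D \<subseteq> ?G" "?G \<subseteq> closure D" using separable by blast
  then have "D \<noteq> {}" using assms by auto
  define d where "d = fst \<circ> from_nat_into D"
  have gd: "from_nat_into D j = (d j, \<phi> (d j)) \<and> d j \<in> C" for j
  proof -
    have "from_nat_into D j \<in> ?G" using D(2) from_nat_into[OF \<open>D \<noteq> {}\<close>] by blast
    then show ?thesis by (auto simp: d_def)
  qed
  have "\<exists>s. (\<lambda>k. d (s k)) \<longlonglongrightarrow> x \<and> (\<lambda>k. \<phi> (d (s k))) \<longlonglongrightarrow> \<phi> x" if "x \<in> C" for x
  proof -
    have "(x, \<phi> x) \<in> closure D" using D that by auto
    then obtain p where p: "\<And>k. p k \<in> D" "p \<longlonglongrightarrow> (x, \<phi> x)" by (auto simp: closure_sequential)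
    define s where "s k = to_nat_on D (p k)" for k
    have s: "p k = (d (s k), \<phi> (d (s k)))" for k
      using gd[of "s k"] p(1)[of k] D(1) by (simp add: s_def)
    show ?thesis
      using tendsto_fst[OF p(2)] tendsto_snd[OF p(2)] by (intro exI[of _ s]) (simp add: s)
  qed
  moreover have "range d \<subseteq> C" using gd by auto
  ultimately show ?thesis by blast
qed

text \<open>Density in the graph, not just in \<open>C\<close>, is needed since a lower semicontinuous convex \<open>\<phi>\<close>
  need not be continuous relative to its domain.\<close>

lemma graph_dense_approx:
  fixes C :: "'a::euclidean_space set"
  assumes "range d \<subseteq> C" "\<forall>x\<in>C. \<exists>s::nat\<Rightarrow>nat. (\<lambda>k. d (s k)) \<longlonglongrightarrow> x \<and> (\<lambda>k. \<phi> (d (s k))) \<longlonglongrightarrow> \<phi> x"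
    and \<psi>: "continuous_on C \<psi>" and y: "y \<in> C" and e: "0 < (e::real)"
  shows "\<exists>j. \<psi> (d j) + \<phi> (d j) \<le> \<psi> y + \<phi> y + e"
proof -
  obtain s where s: "(\<lambda>k. d (s k)) \<longlonglongrightarrow> y" "(\<lambda>k. \<phi> (d (s k))) \<longlonglongrightarrow> \<phi> y" using assms by metis
  have "(\<lambda>k. \<psi> (d (s k))) \<longlonglongrightarrow> \<psi> y"
    by (rule continuous_on_tendsto_compose[OF \<psi> s(1) y]) (use assms(1) in \<open>auto intro!: always_eventually\<close>)
  then have "(\<lambda>k. \<psi> (d (s k)) + \<phi> (d (s k))) \<longlonglongrightarrow> \<psi> y + \<phi> y" using s(2) by (rule tendsto_add)
  then have "eventually (\<lambda>k. \<psi> (d (s k)) + \<phi> (d (s k)) < \<psi> y + \<phi> y + e) sequentially"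
    by (rule order_tendstoD(2)) (use e in simp)
  then show ?thesis by (auto simp: eventually_sequentially intro: less_imp_le)
qed

section \<open>Robust selection\<close>

text \<open>A \<open>LEAST\<close> over the reals need not be attained. Here it is, because the
  number of covered points changes only at the finitely many values collected in
  \<open>V\<close>.\<close>

lemma majority_radius_least:
  fixes \<rho> :: "'a \<Rightarrow> 'a \<Rightarrow> real"
  assumes m: "0 < m"
  shows "0 \<le> majority_radius \<rho> m y i"
    and "real m / 2 < real (card {k. k < m \<and> \<rho> (y i) (y k) \<le> majority_radius \<rho> m y i})"
    and "\<And>r. 0 \<le> r \<Longrightarrow> real m / 2 < real (card {k. k < m \<and> \<rho> (y i) (y k) \<le> r}) \<Longrightarrow>
      majority_radius \<rho> m y i \<le> r"
proof -
  define N where "N r = card {k. k < m \<and> \<rho> (y i) (y k) \<le> r}" for r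
  define Q where "Q r \<longleftrightarrow> 0 \<le> r \<and> real m / 2 < real (N r)" for r
  define V where "V = (\<lambda>k. max 0 (\<rho> (y i) (y k))) ` {..<m}"
  have fin: "finite V" "V \<noteq> {}" using m by (auto simp: V_def)
  have "max 0 (\<rho> (y i) (y k)) \<le> Max V" if "k < m" for k
    using fin(1) that by (intro Max_ge) (auto simp: V_def)
  then have "{k. k < m \<and> \<rho> (y i) (y k) \<le> Max V} = {..<m}" by fastforce
  then have "N (Max V) = card {..<m}" by (simp add: N_def)
  moreover have "0 \<le> Max V" using fin by (force simp: V_def Max_ge_iff)
  ultimately have QM: "Q (Max V)" using m by (simp add: Q_def)
  define r0 where "r0 = Min {v \<in> V. Q v}"
  have r0: "r0 \<in> {v \<in> V. Q v}"
    unfolding r0_def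
  proof (rule Min_in)
    show "{v \<in> V. Q v} \<noteq> {}" using QM Max_in[OF fin] by blast
  qed (use fin in simp)
  have least: "r0 \<le> r" if "Q r" for r
  proof -
    let ?W = "{v \<in> V. v \<le> r}"
    have "{k. k < m \<and> \<rho> (y i) (y k) \<le> r} \<noteq> {}"
    proof
      assume "{k. k < m \<and> \<rho> (y i) (y k) \<le> r} = {}"
      then have "N r = 0" unfolding N_def by simp
      with that m show False by (simp add: Q_def)
    qed
    then have W: "finite ?W" "?W \<noteq> {}" using fin that by (auto simp: V_def Q_def)
    \<comment> \<open>Shrinking \<open>r\<close> to the largest value of \<open>V\<close> below it
      loses no covered point.\<close>
    have "N r \<le> N (Max ?W)" unfolding N_def
    proof (rule card_mono)
      show "{k. k < m \<and> \<rho> (y i) (y k) \<le> r} \<subseteq> {k. k < m \<and> \<rho> (y i) (y k) \<le> Max ?W}"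
      proof safe
        fix k assume "k < m" "\<rho> (y i) (y k) \<le> r"
        then have "max 0 (\<rho> (y i) (y k)) \<in> ?W" using that by (auto simp: V_def Q_def)
        then have "max 0 (\<rho> (y i) (y k)) \<le> Max ?W" by (rule Max_ge[OF W(1)])
        then show "\<rho> (y i) (y k) \<le> Max ?W" by simp
      qed
    qed simp
    moreover have MW: "Max ?W \<in> ?W" by (rule Max_in[OF W])
    moreover have "0 \<le> Max ?W" using MW by (auto simp: V_def)
    ultimately have "Q (Max ?W)" using that by (simp add: Q_def)
    then have "r0 \<le> Max ?W" unfolding r0_def using MW fin by (intro Min_le) auto
    with MW show ?thesis by simp
  qed
  have eq: "majority_radius \<rho> m y i = r0"
    unfolding majority_radius_def by (rule Least_equality) (use r0 least in \<open>auto simp: Q_def N_def\<close>)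
  show "0 \<le> majority_radius \<rho> m y i"
    and "real m / 2 < real (card {k. k < m \<and> \<rho> (y i) (y k) \<le> majority_radius \<rho> m y i})"
    using r0 by (auto simp: eq Q_def N_def)
  show "majority_radius \<rho> m y i \<le> r"
    if "0 \<le> r" "real m / 2 < real (card {k. k < m \<and> \<rho> (y i) (y k) \<le> r})" for r
    using least[of r] that by (simp add: eq Q_def N_def)
qed

lemma majorities_intersect:
  assumes "real m / 2 < real (card {k. k < m \<and> A k})" "real m / 2 < real (card {k. k < (m::nat) \<and> B k})"
  shows "\<exists>k<m. A k \<and> B k"
proof (rule ccontr)
  let ?A = "{k. k < m \<and> A k}" and ?B = "{k. k < m \<and> B k}"
  assume "\<not> ?thesis"
  then have "card (?A \<union> ?B) = card ?A + card ?B" by (intro card_Un_disjoint) auto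
  moreover have "card (?A \<union> ?B) \<le> card {..<m}" by (intro card_mono) auto
  ultimately show False using assms by simp
qed

locale pseudometric =
  fixes \<rho> :: "'a \<Rightarrow> 'a \<Rightarrow> real"
  assumes sym: "\<rho> x y = \<rho> y x" and triangle: "\<rho> x z \<le> \<rho> x y + \<rho> y z"
begin

lemma majority_radius_near:
  assumes maj: "real m / 2 < real (card {k. k < m \<and> \<rho> (y k) p \<le> r})" and "0 \<le> r" "0 < m"
    and i: "\<rho> (y i) p \<le> r"
  shows "majority_radius \<rho> m y i \<le> 2 * r"
proof (rule majority_radius_least(3)[OF \<open>0 < m\<close>])
  have "card {k. k < m \<and> \<rho> (y k) p \<le> r} \<le> card {k. k < m \<and> \<rho> (y i) (y k) \<le> 2 * r}"
  proof (intro card_mono subsetI)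
    fix k assume "k \<in> {k. k < m \<and> \<rho> (y k) p \<le> r}"
    then show "k \<in> {k. k < m \<and> \<rho> (y i) (y k) \<le> 2 * r}"
      using triangle[of "y i" "y k" p] sym[of p "y k"] i by auto
  qed simp
  then show "real m / 2 < real (card {k. k < m \<and> \<rho> (y i) (y k) \<le> 2 * r})" using maj by linarith
qed (use assms in simp)

text \<open>The majority close to \<open>p\<close> and the majority within the radius of
  \<open>y i\<close> share a point, and the distances add up to \<open>2 * r + r\<close>. This is
  the origin of the factor 3.\<close>

lemma near_if_majority_radius_le:
  assumes maj: "real m / 2 < real (card {k. k < m \<and> \<rho> (y k) p \<le> r})" and "0 < m"
    and R: "majority_radius \<rho> m y i \<le> 2 * r"
  shows "\<rho> (y i) p \<le> 3 * r"
proof -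
  obtain k where "\<rho> (y k) p \<le> r" "\<rho> (y i) (y k) \<le> majority_radius \<rho> m y i"
    using majorities_intersect[OF maj majority_radius_least(2)[OF \<open>0 < m\<close>, of \<rho> y i]] by blast
  then show ?thesis using triangle[of "y i" p "y k"] R by linarith
qed

text \<open>Some point is within \<open>r\<close> of \<open>p\<close> and hence has radius at most
  \<open>2 * r\<close>; the minimal radius is no larger.\<close>

lemma most_central_near:
  assumes maj: "real m / 2 < real (card {k. k < m \<and> \<rho> (y k) p \<le> r})" and "0 \<le> r" "0 < m"
    and c: "most_central \<rho> m y i"
  shows "i < m" "\<rho> (y i) p \<le> 3 * r"
proof -
  obtain k where k: "k < m" "\<rho> (y k) p \<le> r" using majorities_intersect[OF maj maj] by blast
  have "majority_radius \<rho> m y i \<le> majority_radius \<rho> m y k"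
    using c k(1) by (simp add: most_central_def is_arg_min_linorder)
  also have "\<dots> \<le> 2 * r" using majority_radius_near[OF assms(1-3) k(2)] .
  finally show "\<rho> (y i) p \<le> 3 * r" by (rule near_if_majority_radius_le[OF assms(1,3)])
  show "i < m" using c by (simp add: most_central_def is_arg_min_linorder)
qed

text \<open>More than half of the radii are at most \<open>2 * r\<close>, hence so is their median,
  and with it every radius that passes the filter.\<close>

lemma Extract_near:
  assumes maj: "real m / 2 < real (card {k. k < m \<and> \<rho> (y k) p \<le> r})" and "0 \<le> r" "0 < m"
    and i: "i \<in> Extract \<rho> m y"
  shows "i < m" "\<rho> (y i) p \<le> 3 * r"
proof -
  define xs where "xs = sort (map (majority_radius \<rho> m y) [0..<m])"
  define q where "q = nat \<lceil>real m / 2\<rceil> - 1"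
  have "xs ! q \<le> 2 * r"
  proof (rule ccontr)
    assume *: "\<not> xs ! q \<le> 2 * r"
    \<comment> \<open>Positions count from 0: if entry \<open>q\<close> exceeds
      \<open>2 * r\<close>, at most \<open>q\<close>, that is one less than half of \<open>m\<close>
      rounded up, entries can be at most \<open>2 * r\<close>.\<close>
    have sub: "{j. j < length xs \<and> xs ! j \<le> 2 * r} \<subseteq> {..<q}"
    proof
      fix j assume j: "j \<in> {j. j < length xs \<and> xs ! j \<le> 2 * r}"
      show "j \<in> {..<q}"
      proof (rule ccontr)
        assume "j \<notin> {..<q}"
        then have "xs ! q \<le> xs ! j" using j by (intro sorted_nth_mono) (auto simp: xs_def)
        with * j show False by auto
      qed
    qed
    have "card {k. k < m \<and> \<rho> (y k) p \<le> r} \<le> card {k. k < m \<and> majority_radius \<rho> m y k \<le> 2 * r}"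
      using majority_radius_near[OF assms(1-3)] by (intro card_mono) auto
    also have "\<dots> = length (filter (\<lambda>v. v \<le> 2 * r) (map (majority_radius \<rho> m y) [0..<m]))"
      by (simp add: length_filter_conv_card cong: conj_cong)
    also have "\<dots> = length (filter (\<lambda>v. v \<le> 2 * r) xs)"
      unfolding xs_def by (metis mset_filter mset_sort size_mset)
    also have "\<dots> = card {j. j < length xs \<and> xs ! j \<le> 2 * r}" by (rule length_filter_conv_card)
    also have "\<dots> \<le> card {..<q}" by (rule card_mono[OF _ sub]) simp
    finally show False using maj by (simp add: q_def) linarith
  qed
  moreover have "majority_radius \<rho> m y i \<le> xs ! q" "i < m"
    using i by (auto simp: Extract_def xs_def q_def)
  ultimately show "i < m" "\<rho> (y i) p \<le> 3 * r"
    using near_if_majority_radius_le[OF assms(1,3), of i] by auto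
qed

end

lemma pseudometric_norm: "pseudometric (\<lambda>x x'::'a::real_normed_vector. norm (x - x'))"
  by unfold_locales (simp add: norm_minus_commute, metis norm_triangle_ineq diff_add_cancel add_diff_eq)

text \<open>This is the distance between the values of one real function, the finite part of
  \<open>h\<close> plus the linear form given by \<open>v\<close>.\<close>

lemma pseudometric_gap: "pseudometric (gap_pseudometric h v)"
proof
  show "gap_pseudometric h v x y = gap_pseudometric h v y x" for x y
    by (simp add: gap_pseudometric_def abs_minus_commute algebra_simps)
  show "gap_pseudometric h v x z \<le> gap_pseudometric h v x y + gap_pseudometric h v y z" for x y z
    by (simp add: gap_pseudometric_def inner_diff_right)
qed

section \<open>Independent and fresh samples\<close>

definition merge_on :: "'i set \<Rightarrow> ('i \<Rightarrow> 'b) \<Rightarrow> ('i \<Rightarrow> 'b) \<Rightarrow> 'i \<Rightarrow> 'b" where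
  "merge_on J w w' i = (if i \<in> J then w i else w' i)"

lemma merge_on_in_space:
  "w \<in> space (PiM UNIV (\<lambda>_. P)) \<Longrightarrow> w' \<in> space (PiM UNIV (\<lambda>_. P)) \<Longrightarrow>
    merge_on J w w' \<in> space (PiM UNIV (\<lambda>_. P))"
  by (auto simp: space_PiM PiE_iff merge_on_def)

lemma measurable_merge_on [measurable]:
  "(\<lambda>(w, w'). merge_on J w w') \<in> measurable
    (PiM UNIV (\<lambda>_. P) \<Otimes>\<^sub>M PiM UNIV (\<lambda>_. P)) (PiM UNIV (\<lambda>_. P))"
proof (rule measurable_PiM_single')
  fix i
  show "(\<lambda>p. (case p of (w, w') \<Rightarrow> merge_on J w w') i) \<in> measurable
      (PiM UNIV (\<lambda>_. P) \<Otimes>\<^sub>M PiM UNIV (\<lambda>_. P)) P"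
    by (cases "i \<in> J") (auto simp: merge_on_def case_prod_beta)
qed (auto simp: space_pair_measure space_PiM merge_on_def PiE_iff)

lemma (in prob_space) prob_space_iid: "prob_space (PiM UNIV (\<lambda>_. M))"
  by (intro prob_space_PiM prob_space_axioms)

text \<open>A product measure is determined on cylinders, and the preimage of a cylinder is a
  rectangle whose two sides carry the constraints inside and outside \<open>J\<close>.\<close>

lemma (in prob_space) distr_merge_on:
  fixes J :: "'i set"
  defines "Q \<equiv> PiM (UNIV :: 'i set) (\<lambda>_. M)"
  shows "distr (Q \<Otimes>\<^sub>M Q) Q (\<lambda>(w, w'). merge_on J w w') = Q"
proof -
  interpret P: product_prob_space "\<lambda>_::'i. M" UNIV
    by unfold_locales
  interpret Q: prob_space Q unfolding Q_def by (rule prob_space_iid)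
  interpret QQ: pair_prob_space Q Q ..
  have [measurable]: "(\<lambda>(w, w'). merge_on J w w') \<in> measurable (Q \<Otimes>\<^sub>M Q) Q"
    unfolding Q_def by measurable
  show ?thesis
    unfolding Q_def
  proof (rule P.PiM_eq, unfold Q_def[symmetric])
    fix K :: "'i set" and F assume K: "finite K" "K \<subseteq> UNIV" and F: "\<And>j. j \<in> K \<Longrightarrow> F j \<in> sets M"
    let ?E = "\<lambda>K. prod_emb UNIV (\<lambda>_. M) K (\<Pi>\<^sub>E j\<in>K. F j)"
    have E[measurable]: "?E K' \<in> sets Q" if "K' \<subseteq> K" for K'
      unfolding Q_def using K F that by (intro sets_PiM_I) (auto intro: finite_subset)
    have em: "emeasure Q (?E K') = (\<Prod>j\<in>K'. emeasure M (F j))" if "K' \<subseteq> K" for K'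
      unfolding Q_def using K F that by (intro P.emeasure_PiM_emb) (auto intro: finite_subset)
    have "emeasure (distr (Q \<Otimes>\<^sub>M Q) Q (\<lambda>(w, w'). merge_on J w w')) (?E K)
      = emeasure (Q \<Otimes>\<^sub>M Q) ((\<lambda>(w, w'). merge_on J w w') -` ?E K \<inter> space (Q \<Otimes>\<^sub>M Q))"
      by (intro emeasure_distr) (use E in auto)
    also have "(\<lambda>(w, w'). merge_on J w w') -` ?E K \<inter> space (Q \<Otimes>\<^sub>M Q) = ?E (K \<inter> J) \<times> ?E (K - J)"
      unfolding Q_def by (auto simp: prod_emb_def space_pair_measure space_PiM PiE_iff merge_on_def split: if_splits)
    also have "emeasure (Q \<Otimes>\<^sub>M Q) \<dots> = emeasure Q (?E (K \<inter> J)) * emeasure Q (?E (K - J))"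
      using E by (intro Q.emeasure_pair_measure_Times) auto
    also have "\<dots> = (\<Prod>j\<in>K. emeasure M (F j))"
      by (simp add: em prod.Int_Diff[OF K(1), of _ J])
    finally show "emeasure (distr (Q \<Otimes>\<^sub>M Q) Q (\<lambda>(w, w'). merge_on J w w')) (?E K) = (\<Prod>j\<in>K. emeasure M (F j))" .
  qed simp
qed

lemma (in prob_space) distr_iid_reindex:
  assumes "inj f"
  shows "distr (PiM UNIV (\<lambda>_. M)) (PiM UNIV (\<lambda>_. M)) (\<lambda>w i. w (f i)) = PiM UNIV (\<lambda>_. M)"
  using distr_PiM_reindex[of UNIV "\<lambda>_. M" f UNIV] assms prob_space_axioms by (simp add: restrict_UNIV)

lemma measurable_reindex:
  "(\<lambda>w i. w (f i)) \<in> measurable (PiM UNIV (\<lambda>_. M)) (PiM UNIV (\<lambda>_. M))"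
  by (rule measurable_PiM_single') (auto simp: space_PiM)

lemma (in prob_space) indep_vars_iid_reindex:
  fixes f :: "'k \<Rightarrow> 'j \<Rightarrow> 'i"
  assumes disj: "disjoint_family_on (\<lambda>k. range (f k)) L"
  shows "prob_space.indep_vars (PiM UNIV (\<lambda>_. M)) (\<lambda>_. PiM UNIV (\<lambda>_. M)) (\<lambda>k w i. w (f k i)) L"
proof -
  interpret Q: prob_space "PiM (UNIV :: 'i set) (\<lambda>_. M)" by (rule prob_space_iid)
  have "distr (PiM UNIV (\<lambda>_::'i. M)) M (\<lambda>w. w i) = M" for i
    by (rule distr_PiM_component) (auto intro: prob_space_axioms)
  then have "Q.indep_vars (\<lambda>_. M) (\<lambda>i w. w i) UNIV"
    by (subst Q.indep_vars_iff_distr_eq_PiM) (auto simp: restrict_UNIV distr_id2)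
  then have "Q.indep_vars (\<lambda>k. PiM (range (f k)) (\<lambda>_. M)) (\<lambda>k w. restrict (\<lambda>i. w i) (range (f k))) L"
    using disj by (intro Q.indep_vars_restrict) auto
  then have "Q.indep_vars (\<lambda>_. PiM UNIV (\<lambda>_. M)) (\<lambda>k w i. restrict w (range (f k)) (f k i)) L"
  proof (rule Q.indep_vars_compose2)
    fix k
    show "(\<lambda>w i. w (f k i)) \<in> measurable (PiM (range (f k)) (\<lambda>_. M)) (PiM UNIV (\<lambda>_. M))"
      by (rule measurable_PiM_single') (auto simp: space_PiM intro!: measurable_component_singleton)
  qed
  then show ?thesis by simp
qed

text \<open>The coordinates in \<open>J\<close> form the past.  Resampling all others from an independent copy preserves
  the measure, so a bound that holds for every fixed value of \<open>\<Theta>\<close> survives a random \<open>\<Theta>\<close>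
  determined by the past.\<close>

lemma (in prob_space) prob_fresh_le:
  fixes J :: "'i set"
  defines "Q \<equiv> PiM (UNIV :: 'i set) (\<lambda>_. M)"
  assumes \<Theta>[measurable]: "\<Theta> \<in> measurable Q N" and B[measurable]: "B \<in> sets (N \<Otimes>\<^sub>M Q)"
    and past: "\<And>w w'. w \<in> space Q \<Longrightarrow> w' \<in> space Q \<Longrightarrow> \<Theta> (merge_on J w w') = \<Theta> w"
    and future: "\<And>\<theta> w w'. w \<in> space Q \<Longrightarrow> w' \<in> space Q \<Longrightarrow> (\<theta>, merge_on J w w') \<in> B \<longleftrightarrow> (\<theta>, w') \<in> B"
    and le: "AE w in Q. measure Q {w'\<in>space Q. (\<Theta> w, w') \<in> B} \<le> p" and p: "0 \<le> p"
  shows "measure Q {w\<in>space Q. (\<Theta> w, w) \<in> B} \<le> p"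
proof -
  interpret Q: prob_space Q unfolding Q_def by (rule prob_space_iid)
  interpret QQ: pair_prob_space Q Q ..
  have [measurable]: "(\<lambda>(w, w'). merge_on J w w') \<in> measurable (Q \<Otimes>\<^sub>M Q) Q"
    unfolding Q_def by measurable
  let ?A = "{w\<in>space Q. (\<Theta> w, w) \<in> B}"
  have A[measurable]: "?A \<in> sets Q" by measurable
  have "emeasure Q ?A = emeasure (distr (Q \<Otimes>\<^sub>M Q) Q (\<lambda>(w, w'). merge_on J w w')) ?A"
    unfolding Q_def by (subst distr_merge_on) simp
  also have "\<dots> = emeasure (Q \<Otimes>\<^sub>M Q) ((\<lambda>(w, w'). merge_on J w w') -` ?A \<inter> space (Q \<Otimes>\<^sub>M Q))"
    by (rule emeasure_distr) auto
  \<comment> \<open>After resampling, \<open>\<Theta>\<close> sees only the first copy and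
    \<open>B\<close> only the second, so the sections of this set are the events with a fixed
    parameter.\<close>
  also have "(\<lambda>(w, w'). merge_on J w w') -` ?A \<inter> space (Q \<Otimes>\<^sub>M Q)
      = {p \<in> space (Q \<Otimes>\<^sub>M Q). (\<Theta> (fst p), snd p) \<in> B}"
    using past future merge_on_in_space[of _ M] by (auto simp: space_pair_measure Q_def)
  also have "emeasure (Q \<Otimes>\<^sub>M Q) \<dots> = (\<integral>\<^sup>+w. emeasure Q (Pair w -` {p \<in> space (Q \<Otimes>\<^sub>M Q). (\<Theta> (fst p), snd p) \<in> B}) \<partial>Q)"
    by (rule Q.emeasure_pair_measure_alt) measurable
  also have "\<dots> = (\<integral>\<^sup>+w. emeasure Q {w'\<in>space Q. (\<Theta> w, w') \<in> B} \<partial>Q)"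
    by (intro nn_integral_cong arg_cong[of _ _ "emeasure Q"]) (auto simp: space_pair_measure)
  also have "\<dots> \<le> (\<integral>\<^sup>+w. ennreal p \<partial>Q)"
    by (intro nn_integral_mono_AE) (use le in \<open>auto simp: Q.emeasure_eq_measure intro!: ennreal_leI\<close>)
  also have "\<dots> = ennreal p" by (simp add: Q.emeasure_space_1)
  finally show ?thesis using p by (simp add: Q.emeasure_eq_measure)
qed

lemma card_conv_sum_indicator:
  "real (card {k. k < m \<and> x k \<in> B}) = (\<Sum>k<(m::nat). indicator B (x k))"
proof -
  have "(\<Sum>k<m. indicator B (x k) :: real) = (\<Sum>k\<in>{k. k < m \<and> x k \<in> B}. 1)"
    by (intro sum.mono_neutral_cong_right) auto
  then show ?thesis by simp
qed

text \<open>The expected number of bad indices is at most \<open>m / 3\<close>, so reaching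
  \<open>m / 2\<close> is a deviation of \<open>m / 6\<close>; Hoeffding's exponent is then
  \<open>2 * (m / 6)\<^sup>2 / m = m / 18\<close>.\<close>

lemma (in prob_space) prob_minority_bad:
  fixes X :: "nat \<Rightarrow> 'a \<Rightarrow> 'b"
  assumes ind: "indep_vars (\<lambda>_. S) X {..<m}" and B: "B \<in> sets S"
    and le: "\<And>k. k < m \<Longrightarrow> prob {w\<in>space M. X k w \<in> B} \<le> 1 / 3"
  shows "prob {w\<in>space M. real m / 2 \<le> real (card {k. k < m \<and> X k w \<in> B})} \<le> exp (- (real m / 18))"
proof (cases "m = 0")
  case True then show ?thesis by (simp add: prob_space)
next
  case False
  define Z where "Z k w = (indicator B (X k w) :: real)" for k w
  have "indep_vars (\<lambda>_. borel) Z {..<m}"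
    unfolding Z_def by (rule indep_vars_compose2[OF ind]) (use B in simp)
  then interpret H: Hoeffding_ineq M "{..<m}" Z "\<lambda>_. 0" "\<lambda>_. 1" "\<Sum>k<m. expectation (Z k)"
    by unfold_locales (auto simp: Z_def indicator_def)
  have X: "X k \<in> measurable M S" if "k < m" for k
    using ind that by (auto simp: indep_vars_def)
  have "expectation (Z k) \<le> 1 / 3" if "k < m" for k
  proof -
    have "{w\<in>space M. X k w \<in> B} \<in> events" using X[OF that] B by measurable
    then have "expectation (indicator {w\<in>space M. X k w \<in> B}) = prob {w\<in>space M. X k w \<in> B}"
      by simp
    also have "expectation (indicator {w\<in>space M. X k w \<in> B}) = expectation (Z k)"
      by (intro Bochner_Integration.integral_cong) (auto simp: Z_def indicator_def)
    finally show ?thesis using le[OF that] by simp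
  qed
  then have "(\<Sum>k<m. expectation (Z k)) \<le> (\<Sum>k<m. 1 / 3)" by (intro sum_mono) auto
  then have mean: "(\<Sum>k<m. expectation (Z k)) + real m / 6 \<le> real m / 2" by simp
  have "prob {w\<in>space M. real m / 2 \<le> real (card {k. k < m \<and> X k w \<in> B})}
    \<le> prob {w\<in>space M. (\<Sum>k<m. expectation (Z k)) + real m / 6 \<le> (\<Sum>k<m. Z k w)}"
    unfolding card_conv_sum_indicator Z_def[symmetric]
    using mean by (intro finite_measure_mono) (auto intro!: measurable_sets_borel H.random_variable)
  also have "\<dots> \<le> exp (-2 * (real m / 6)\<^sup>2 / (\<Sum>k<m. (1 - 0)\<^sup>2))"
    by (rule H.Hoeffding_ineq_ge) (use False in auto)
  also have "-2 * (real m / 6)\<^sup>2 / (\<Sum>k<m. (1 - 0)\<^sup>2) = - (real m / 18)"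
    using False by (simp add: power2_eq_square)
  finally show ?thesis .
qed

abbreviation stream_of :: "nat \<Rightarrow> nat \<Rightarrow> 'z samples \<Rightarrow> nat \<Rightarrow> 'z" where
  "stream_of s k w \<equiv> \<lambda>i. w (s, k, i)"

text \<open>The stages before \<open>s\<close> are the past that determines \<open>\<Theta>\<close>.
  For a fixed value of \<open>\<Theta>\<close> the repetitions of stage \<open>s\<close> read
  disjoint blocks of samples, so they are independent and \<open>prob_minority_bad\<close>
  applies.\<close>

lemma (in prob_space) prob_minority_bad_stage:
  fixes m s :: nat
  defines "Q \<equiv> sample_space M" and "S \<equiv> PiM (UNIV :: nat set) (\<lambda>_. M)"
  assumes \<Theta>[measurable]: "\<Theta> \<in> measurable Q N" and B[measurable]: "B \<in> sets (N \<Otimes>\<^sub>M S)"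
    and past: "\<And>w w'. w \<in> space Q \<Longrightarrow> w' \<in> space Q \<Longrightarrow>
      (\<forall>j<s. \<forall>k i. w (j, k, i) = w' (j, k, i)) \<Longrightarrow> \<Theta> w = \<Theta> w'"
    and le: "AE w in Q. measure S {z\<in>space S. (\<Theta> w, z) \<in> B} \<le> 1 / 3"
  defines "bad \<equiv> {w\<in>space Q. real m / 2 \<le> real (card {k. k < m \<and> (\<Theta> w, stream_of s k w) \<in> B})}"
  shows "bad \<in> sets Q" "measure Q bad \<le> exp (- (real m / 18))"
proof -
  have Q_eq: "Q = PiM UNIV (\<lambda>_. M)" by (simp add: Q_def sample_space_def)
  interpret Q: prob_space Q unfolding Q_eq by (rule prob_space_iid)
  have str[measurable]: "(\<lambda>w. stream_of s k w) \<in> measurable Q S" for k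
    unfolding Q_eq S_def by (rule measurable_reindex)
  have dstr: "distr Q S (\<lambda>w. stream_of s k w) = S" for k
    unfolding Q_eq S_def by (rule distr_iid_reindex) (auto simp: inj_on_def)
  define C where "C = {p \<in> space (N \<Otimes>\<^sub>M Q). real m / 2 \<le> real (card {k. k < m \<and> (fst p, stream_of s k (snd p)) \<in> B})}"
  have C[measurable]: "C \<in> sets (N \<Otimes>\<^sub>M Q)"
    unfolding C_def card_conv_sum_indicator by measurable
  have bad_eq: "bad = {w\<in>space Q. (\<Theta> w, w) \<in> C}"
    using measurable_space[OF \<Theta>] by (auto simp: bad_def C_def space_pair_measure)
  show "bad \<in> sets Q" unfolding bad_eq by measurable
  show "measure Q bad \<le> exp (- (real m / 18))"
    unfolding bad_eq unfolding Q_eq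
  proof (rule prob_fresh_le[where N = N and J = "{p. fst p < s}"], unfold Q_eq[symmetric])
    fix w w' assume w: "w \<in> space Q" "w' \<in> space Q"
    then have w'': "merge_on {p. fst p < s} w w' \<in> space Q" unfolding Q_eq by (rule merge_on_in_space)
    show "\<Theta> (merge_on {p. fst p < s} w w') = \<Theta> w"
      by (rule past[OF w'' w(1)]) (simp add: merge_on_def)
    show "(\<theta>, merge_on {p. fst p < s} w w') \<in> C \<longleftrightarrow> (\<theta>, w') \<in> C" for \<theta>
      using w w'' by (simp add: C_def space_pair_measure) (simp add: merge_on_def)
  next
    show "AE w in Q. measure Q {w'\<in>space Q. (\<Theta> w, w') \<in> C} \<le> exp (- (real m / 18))"
      using le AE_space
    proof eventually_elim
      case (elim w)
      have \<theta>: "\<Theta> w \<in> space N" using elim measurable_space[OF \<Theta>] by auto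
      define B' where "B' = {z\<in>space S. (\<Theta> w, z) \<in> B}"
      have B'[measurable]: "B' \<in> sets S" using \<theta> unfolding B'_def by measurable
      have "{w'\<in>space Q. (\<Theta> w, w') \<in> C}
          = {w'\<in>space Q. real m / 2 \<le> real (card {k. k < m \<and> stream_of s k w' \<in> B'})}"
        using \<theta> measurable_space[OF str] by (auto simp: C_def B'_def space_pair_measure)
      also have "measure Q \<dots> \<le> exp (- (real m / 18))"
      proof (rule Q.prob_minority_bad)
        show "Q.indep_vars (\<lambda>_. S) (\<lambda>k w. stream_of s k w) {..<m}"
          unfolding Q_eq S_def by (rule indep_vars_iid_reindex) (auto simp: disjoint_family_on_def)
        show "B' \<in> sets S" by fact
        fix k
        have "measure Q {w'\<in>space Q. stream_of s k w' \<in> B'} = measure (distr Q S (\<lambda>w. stream_of s k w)) B'"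
          by (subst measure_distr) (auto intro!: arg_cong[of _ _ "measure Q"])
        also have "\<dots> = measure S B'" by (simp only: dstr)
        finally show "measure Q {w'\<in>space Q. stream_of s k w' \<in> B'} \<le> 1 / 3"
          using elim by (simp add: B'_def)
      qed
      finally show ?case .
    qed
  qed (use \<Theta> C in simp_all)
qed

section \<open>Regularized empirical risk minimization\<close>

locale stochastic_composite = prob_space P for P :: "'z measure" +
  fixes g :: "'a::euclidean_space \<Rightarrow> 'z \<Rightarrow> real" and h :: "'a \<Rightarrow> ereal"
    and U :: "'a set" and ell :: "'z \<Rightarrow> real" and lbar \<mu> L :: real
  assumes g_measurable: "(\<lambda>(x, z). g x z) \<in> borel_measurable (borel \<Otimes>\<^sub>M P)"
    and g_integrable: "\<And>x. integrable P (g x)"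
    and h_not_MInf: "\<And>x. h x \<noteq> -\<infinity>" and dom_nonempty: "edom h \<noteq> {}"
    and closed_objective: "closed_function (composite P g h)"
    and h_convex: "ext_convex h" and mu_pos: "0 < \<mu>"
    and AE_strongly_convex: "AE z in P. strongly_convex \<mu> (\<lambda>x. ereal (g x z) + h x)"
    and open_U: "open U" and dom_subset_U: "edom h \<subseteq> U"
    and ell_measurable [measurable]: "ell \<in> borel_measurable P"
    and ell_square_integrable: "integrable P (\<lambda>z. (ell z)\<^sup>2)"
    and lbar_pos: "0 < lbar" and ell_le_lbar: "sqrt (LINT z|P. (ell z)\<^sup>2) \<le> lbar"
    and g_lipschitz: "\<And>x y z. x \<in> U \<Longrightarrow> y \<in> U \<Longrightarrow> z \<in> space P \<Longrightarrow> \<bar>g x z - g y z\<bar> \<le> ell z * norm (x - y)"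
    and smooth: "L_smooth L (expected_loss P g)" and mu_le_L: "\<mu> \<le> L"
    and AE_differentiable: "AE z in P. \<forall>x\<in>edom h. (\<lambda>x. g x z) differentiable (at x)"
begin

section \<open>Consequences of the assumptions and population minimizers\<close>

abbreviation C :: "'a set" where "C \<equiv> edom h"

abbreviation gbar :: "'a \<Rightarrow> real" where "gbar \<equiv> expected_loss P g"

definition hr :: "'a \<Rightarrow> real" where "hr x = real_of_ereal (h x)"

abbreviation S :: "(nat \<Rightarrow> 'z) measure" where "S \<equiv> PiM UNIV (\<lambda>_. P)"

text \<open>Membership in the space is included because the Lipschitz bound is assumed only
  there.\<close>

definition good :: "'z \<Rightarrow> bool" where
  "good z \<longleftrightarrow> z \<in> space P \<and> strongly_convex \<mu> (\<lambda>x. ereal (g x z) + h x)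
    \<and> (\<forall>x\<in>C. (\<lambda>x. g x z) differentiable (at x))"

lemma AE_good: "AE z in P. good z"
  using AE_strongly_convex AE_differentiable AE_space by eventually_elim (simp add: good_def)

lemma h_eq_hr: "x \<in> C \<Longrightarrow> h x = ereal (hr x)"
  using h_not_MInf[of x] by (cases "h x") (auto simp: edom_def hr_def)

lemma convex_dom: "convex C"
  unfolding convex_alt
proof (intro ballI allI impI)
  fix x y and t :: real assume *: "x \<in> C" "y \<in> C" "0 \<le> t \<and> t \<le> 1"
  then have "h ((1 - t) *\<^sub>R x + t *\<^sub>R y) \<le> ereal (1 - t) * h x + ereal t * h y"
    using h_convex unfolding ext_convex_def by auto
  also have "\<dots> < \<infinity>" using * by (simp add: h_eq_hr)
  finally show "(1 - t) *\<^sub>R x + t *\<^sub>R y \<in> C" by (simp add: edom_def)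
qed

lemma sconv_of_strongly_convex:
  assumes "strongly_convex \<mu> (\<lambda>x. ereal (\<phi> x) + h x)"
  shows "sconv \<mu> C (\<lambda>x. \<phi> x + hr x)"
  unfolding sconv_def
proof (intro ballI)
  fix x y and t :: real assume *: "x \<in> C" "y \<in> C" "t \<in> {0..1}"
  let ?z = "(1 - t) *\<^sub>R x + t *\<^sub>R y"
  have "?z \<in> C" using * by (intro convexD[OF convex_dom]) auto
  moreover have "ereal (\<phi> ?z) + h ?z - ereal (\<mu> / 2 * (norm ?z)\<^sup>2)
    \<le> ereal (1 - t) * (ereal (\<phi> x) + h x - ereal (\<mu> / 2 * (norm x)\<^sup>2))
      + ereal t * (ereal (\<phi> y) + h y - ereal (\<mu> / 2 * (norm y)\<^sup>2))"
    using assms *(3) unfolding strongly_convex_def ext_convex_def by blast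
  ultimately have "\<phi> ?z + hr ?z - \<mu> / 2 * (norm ?z)\<^sup>2
    \<le> (1 - t) * (\<phi> x + hr x - \<mu> / 2 * (norm x)\<^sup>2) + t * (\<phi> y + hr y - \<mu> / 2 * (norm y)\<^sup>2)"
    using * by (simp add: h_eq_hr)
  moreover have "\<mu> / 2 * (norm ?z)\<^sup>2 = (1 - t) * (\<mu> / 2 * (norm x)\<^sup>2) + t * (\<mu> / 2 * (norm y)\<^sup>2)
      - \<mu> / 2 * t * (1 - t) * (norm (x - y))\<^sup>2"
    unfolding norm_sq_convex_combination
    by (simp add: algebra_simps diff_divide_distrib add_divide_distrib)
  ultimately show "\<phi> ?z + hr ?z \<le> (1 - t) * (\<phi> x + hr x) + t * (\<phi> y + hr y)
      - \<mu> / 2 * t * (1 - t) * (norm (x - y))\<^sup>2"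
    unfolding right_diff_distrib by linarith
qed

lemma sconv_good: "good z \<Longrightarrow> sconv \<mu> C (\<lambda>x. g x z + hr x)"
  by (rule sconv_of_strongly_convex) (simp add: good_def)

lemma sconv_expected: "sconv \<mu> C (\<lambda>x. gbar x + hr x)"
  unfolding sconv_def
proof (intro ballI)
  fix x y and t :: real assume *: "x \<in> C" "y \<in> C" "t \<in> {0..1}"
  let ?z = "(1 - t) *\<^sub>R x + t *\<^sub>R y"
  have "(LINT z|P. g ?z z + hr ?z)
    \<le> (LINT z|P. (1 - t) * (g x z + hr x) + t * (g y z + hr y) - \<mu> / 2 * t * (1 - t) * (norm (x - y))\<^sup>2)"
  proof (rule integral_mono_AE)
    show "AE z in P. g ?z z + hr ?z \<le> (1 - t) * (g x z + hr x) + t * (g y z + hr y)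
      - \<mu> / 2 * t * (1 - t) * (norm (x - y))\<^sup>2"
      using AE_good by eventually_elim (use sconv_good * in \<open>auto simp: sconv_def\<close>)
  qed (auto intro!: g_integrable Bochner_Integration.integrable_diff Bochner_Integration.integrable_add
      integrable_mult_right)
  then show "gbar ?z + hr ?z \<le> (1 - t) * (gbar x + hr x) + t * (gbar y + hr y)
      - \<mu> / 2 * t * (1 - t) * (norm (x - y))\<^sup>2"
    by (simp add: expected_loss_def g_integrable prob_space algebra_simps)
qed

lemma continuous_gbar: "continuous_on A gbar"
  using smooth unfolding L_smooth_def
  by (meson continuous_at_imp_continuous_on differentiable_imp_continuous_within)

text \<open>Closedness is assumed for the full objective; subtracting the continuous
  \<open>gbar\<close> transfers it to \<open>hr\<close>, to which the empirical losses can then be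
  added instead.\<close>

lemma closed_epi_hr: "closed (epi_on C hr)"
proof -
  have "{(x, t::real). composite P g h x \<le> ereal t} = epi_on C (\<lambda>x. gbar x + hr x)"
  proof (intro set_eqI, clarsimp simp: epi_on_def composite_def)
    fix x and t :: real
    show "ereal (gbar x) + h x \<le> ereal t \<longleftrightarrow> x \<in> C \<and> gbar x + hr x \<le> t"
    proof (cases "x \<in> C")
      case True then show ?thesis by (simp add: h_eq_hr)
    next
      case False
      then have "h x = \<infinity>" by (simp add: edom_def)
      with False show ?thesis by simp
    qed
  qed
  then have "closed (epi_on C (\<lambda>x. gbar x + hr x))"
    using closed_objective by (simp add: closed_function_def)
  then have "closed (epi_on C (\<lambda>x. (gbar x + hr x) + - gbar x))"
    by (rule closed_epi_add_continuous[where D = UNIV]) (auto intro!: continuous_intros continuous_gbar)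
  then show ?thesis by simp
qed

lemma lipschitz_g: "z \<in> space P \<Longrightarrow> \<bar>ell z\<bar>-lipschitz_on C (\<lambda>x. g x z)"
proof (rule lipschitz_onI)
  fix x y assume *: "z \<in> space P" "x \<in> C" "y \<in> C"
  then have "\<bar>g x z - g y z\<bar> \<le> ell z * norm (x - y)" using dom_subset_U by (intro g_lipschitz) auto
  also have "\<dots> \<le> \<bar>ell z\<bar> * norm (x - y)" by (intro mult_right_mono) auto
  finally show "dist (g x z) (g y z) \<le> \<bar>ell z\<bar> * dist x y" by (simp add: dist_norm)
qed simp

text \<open>One sequence serves all objectives, since each differs from \<open>hr\<close> by a
  function continuous on \<open>C\<close>.\<close>

definition dseq :: "nat \<Rightarrow> 'a" where
  "dseq = (SOME d. range d \<subseteq> C \<and>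
    (\<forall>x\<in>C. \<exists>s::nat \<Rightarrow> nat. (\<lambda>k. d (s k)) \<longlonglongrightarrow> x \<and> (\<lambda>k. hr (d (s k))) \<longlonglongrightarrow> hr x))"

lemma dseq: "range dseq \<subseteq> C"
  "\<forall>x\<in>C. \<exists>s::nat \<Rightarrow> nat. (\<lambda>k. dseq (s k)) \<longlonglongrightarrow> x \<and> (\<lambda>k. hr (dseq (s k))) \<longlonglongrightarrow> hr x"
  using someI_ex[OF graph_dense_sequence[OF dom_nonempty, of hr]] unfolding dseq_def by auto

lemma lim_argmin_minimizes:
  assumes sc: "sconv \<nu> C (\<lambda>y. \<psi> y + hr y)" and nu: "0 < \<nu>" and cont: "continuous_on C \<psi>"
    and cl: "closed (epi_on C (\<lambda>y. \<psi> y + hr y))"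
  defines "y0 \<equiv> lim_argmin dseq (\<lambda>y. \<psi> y + hr y)"
  shows "y0 \<in> C" "\<And>x. x \<in> C \<Longrightarrow> \<psi> y0 + hr y0 + \<nu> / 2 * (norm (x - y0))\<^sup>2 \<le> \<psi> x + hr x"
proof -
  obtain y where y: "y \<in> C" "\<forall>x\<in>C. \<psi> y + hr y \<le> \<psi> x + hr x"
    using sconv_attains_min[OF sc nu convex_dom dom_nonempty cl] by blast
  have growth: "\<psi> y + hr y + \<nu> / 2 * (norm (x - y))\<^sup>2 \<le> \<psi> x + hr x" if "x \<in> C" for x
    using sconv_growth[OF sc convex_dom y(1) that] y(2) by blast
  have "y0 = y"
    unfolding y0_def
  proof (rule lim_argmin_eq[OF nu dseq(1)])
    show "\<exists>j. \<psi> (dseq j) + hr (dseq j) \<le> \<psi> y + hr y + e" if "0 < e" for e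
      by (rule graph_dense_approx[OF dseq cont y(1) that])
  qed (use growth in blast)
  with y growth show "y0 \<in> C" "\<And>x. x \<in> C \<Longrightarrow> \<psi> y0 + hr y0 + \<nu> / 2 * (norm (x - y0))\<^sup>2 \<le> \<psi> x + hr x"
    by auto
qed

definition prox_objective :: "real \<Rightarrow> 'a \<Rightarrow> 'a \<Rightarrow> real" where
  "prox_objective p x y = gbar y + p / 2 * (norm (y - x))\<^sup>2 + hr y"

text \<open>The proximal point of the population objective around \<open>x\<close>; for
  \<open>p = 0\<close> it is the minimizer of that objective, whatever \<open>x\<close> is.\<close>

definition prox :: "real \<Rightarrow> 'a \<Rightarrow> 'a" where
  "prox p x = lim_argmin dseq (prox_objective p x)"

lemma prox_minimizes:
  assumes p: "0 \<le> p"
  shows "prox p x \<in> C"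
    "\<And>y. y \<in> C \<Longrightarrow> prox_objective p x (prox p x) + (\<mu> + p) / 2 * (norm (y - prox p x))\<^sup>2 \<le> prox_objective p x y"
proof -
  let ?\<psi> = "\<lambda>y. gbar y + p / 2 * (norm (y - x))\<^sup>2"
  have "sconv (\<mu> + p) C (\<lambda>y. (gbar y + hr y) + p / 2 * (norm (y - x))\<^sup>2)"
    by (intro sconv_add sconv_expected sconv_quadratic)
  then have "sconv (\<mu> + p) C (\<lambda>y. ?\<psi> y + hr y)" by (simp add: ac_simps)
  moreover have "closed (epi_on C (\<lambda>y. hr y + ?\<psi> y))"
    by (rule closed_epi_add_continuous[OF closed_epi_hr, where D = UNIV])
      (auto intro!: continuous_intros continuous_gbar)
  then have "closed (epi_on C (\<lambda>y. ?\<psi> y + hr y))" by (simp add: ac_simps)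
  moreover have "continuous_on C ?\<psi>" by (intro continuous_intros continuous_gbar)
  moreover have "0 < \<mu> + p" using mu_pos p by simp
  ultimately show "prox p x \<in> C"
    "\<And>y. y \<in> C \<Longrightarrow> prox_objective p x (prox p x) + (\<mu> + p) / 2 * (norm (y - prox p x))\<^sup>2 \<le> prox_objective p x y"
    using lim_argmin_minimizes[of "\<mu> + p" ?\<psi>] unfolding prox_def prox_objective_def by auto
qed

section \<open>The empirical objective and its minimizer\<close>

definition emp :: "nat \<Rightarrow> (nat \<Rightarrow> 'z) \<Rightarrow> 'a \<Rightarrow> real" where
  "emp n z y = (\<Sum>i<n. g y (z i)) / real n"

definition emp_objective :: "nat \<Rightarrow> real \<Rightarrow> 'a \<Rightarrow> (nat \<Rightarrow> 'z) \<Rightarrow> 'a \<Rightarrow> real" where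
  "emp_objective n p x z y = emp n z y + p / 2 * (norm (y - x))\<^sup>2 + hr y"

text \<open>Stands in for \<open>ERM\<close> in all probabilistic arguments, because the limit
  formula makes it jointly measurable in the center and the samples.\<close>

definition yhat :: "nat \<Rightarrow> real \<Rightarrow> 'a \<Rightarrow> (nat \<Rightarrow> 'z) \<Rightarrow> 'a" where
  "yhat n p x z = lim_argmin dseq (emp_objective n p x z)"

lemma sconv_emp:
  assumes "0 < n" "\<And>i. i < n \<Longrightarrow> good (z i)"
  shows "sconv \<mu> C (\<lambda>x. emp n z x + hr x)"
  unfolding sconv_def
proof (intro ballI)
  fix x y and t :: real assume *: "x \<in> C" "y \<in> C" "t \<in> {0..1}"
  let ?z = "(1 - t) *\<^sub>R x + t *\<^sub>R y"
  let ?q = "\<mu> / 2 * t * (1 - t) * (norm (x - y))\<^sup>2"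
  have avg: "emp n z x + hr x = (\<Sum>i<n. g x (z i) + hr x) / real n" for x
    using assms by (simp add: emp_def sum.distrib add_divide_distrib)
  have "(\<Sum>i<n. g ?z (z i) + hr ?z) \<le> (\<Sum>i<n. (1 - t) * (g x (z i) + hr x) + t * (g y (z i) + hr y) - ?q)"
    by (rule sum_mono) (use sconv_good assms * in \<open>auto simp: sconv_def\<close>)
  also have "\<dots> = (1 - t) * (\<Sum>i<n. g x (z i) + hr x) + t * (\<Sum>i<n. g y (z i) + hr y) - real n * ?q"
    by (simp add: sum.distrib sum_subtractf sum_distrib_left[symmetric])
  finally have "(\<Sum>i<n. g ?z (z i) + hr ?z) / real n
    \<le> ((1 - t) * (\<Sum>i<n. g x (z i) + hr x) + t * (\<Sum>i<n. g y (z i) + hr y) - real n * ?q) / real n"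
    by (rule divide_right_mono) simp
  then show "emp n z ?z + hr ?z \<le> (1 - t) * (emp n z x + hr x) + t * (emp n z y + hr y) - ?q"
    unfolding avg using assms by (simp add: add_divide_distrib diff_divide_distrib)
qed

lemma lipschitz_emp:
  assumes "0 < n" "\<And>i. i < n \<Longrightarrow> z i \<in> space P"
  shows "((\<Sum>i<n. \<bar>ell (z i)\<bar>) / real n)-lipschitz_on C (emp n z)"
proof (rule lipschitz_onI)
  fix x y assume *: "x \<in> C" "y \<in> C"
  have "\<bar>emp n z x - emp n z y\<bar> = \<bar>\<Sum>i<n. g x (z i) - g y (z i)\<bar> / real n"
    by (simp add: emp_def sum_subtractf diff_divide_distrib[symmetric])
  also have "\<dots> \<le> (\<Sum>i<n. \<bar>ell (z i)\<bar> * norm (x - y)) / real n"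
    using lipschitz_onD[OF lipschitz_g * ] assms
    by (intro divide_right_mono order_trans[OF sum_abs] sum_mono) (auto simp: dist_norm)
  finally show "dist (emp n z x) (emp n z y) \<le> (\<Sum>i<n. \<bar>ell (z i)\<bar>) / real n * dist x y"
    by (simp add: dist_norm sum_distrib_right)
qed (auto intro!: divide_nonneg_nonneg sum_nonneg)

lemma yhat_minimizes:
  assumes p: "0 \<le> p" and n: "0 < n" and good: "\<And>i. i < n \<Longrightarrow> good (z i)"
  shows "yhat n p x z \<in> C"
    "\<And>y. y \<in> C \<Longrightarrow> emp_objective n p x z (yhat n p x z) + (\<mu> + p) / 2 * (norm (y - yhat n p x z))\<^sup>2
      \<le> emp_objective n p x z y"
proof -
  let ?\<psi> = "\<lambda>y. emp n z y + p / 2 * (norm (y - x))\<^sup>2"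
  have space: "z i \<in> space P" if "i < n" for i using good that by (simp add: good_def)
  have "sconv (\<mu> + p) C (\<lambda>y. (emp n z y + hr y) + p / 2 * (norm (y - x))\<^sup>2)"
    using n good by (intro sconv_add sconv_emp sconv_quadratic)
  then have "sconv (\<mu> + p) C (\<lambda>y. ?\<psi> y + hr y)" by (simp add: ac_simps)
  moreover have "closed (epi_on C (\<lambda>y. (hr y + emp n z y) + p / 2 * (norm (y - x))\<^sup>2))"
    by (rule closed_epi_add_continuous[OF closed_epi_add_lipschitz[OF closed_epi_hr lipschitz_emp[OF n space]], where D = UNIV])
      (auto intro!: continuous_intros)
  then have "closed (epi_on C (\<lambda>y. ?\<psi> y + hr y))" by (simp add: ac_simps)
  moreover have "continuous_on C ?\<psi>"
    by (intro continuous_intros lipschitz_on_continuous_on[OF lipschitz_emp[OF n space]])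
  moreover have "0 < \<mu> + p" using mu_pos p by simp
  ultimately show "yhat n p x z \<in> C"
    "\<And>y. y \<in> C \<Longrightarrow> emp_objective n p x z (yhat n p x z) + (\<mu> + p) / 2 * (norm (y - yhat n p x z))\<^sup>2
      \<le> emp_objective n p x z y"
    using lim_argmin_minimizes[of "\<mu> + p" ?\<psi>] unfolding yhat_def emp_objective_def by auto
qed

text \<open>Quadratic growth makes the minimizer unique, which leaves the arbitrary choice in
  \<open>ERM\<close> no freedom.\<close>

lemma ERM_eq_yhat:
  assumes p: "0 \<le> p" and n: "0 < nat \<lceil>r\<rceil>" and good: "\<And>i. i < nat \<lceil>r\<rceil> \<Longrightarrow> good (z i)"
  shows "ERM g h r p x z = yhat (nat \<lceil>r\<rceil>) p x z"
proof -
  let ?n = "nat \<lceil>r\<rceil>" and ?F = "erm_objective g h (nat \<lceil>r\<rceil>) p x z"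
  define y0 where "y0 = yhat ?n p x z"
  have y0: "y0 \<in> C" "\<And>y. y \<in> C \<Longrightarrow> emp_objective ?n p x z y0 + (\<mu> + p) / 2 * (norm (y - y0))\<^sup>2
      \<le> emp_objective ?n p x z y"
    unfolding y0_def using yhat_minimizes[OF p n, where z = z and x = x] good by auto
  have F: "?F y = (if y \<in> C then ereal (emp_objective ?n p x z y) else \<infinity>)" for y
  proof (cases "y \<in> C")
    case True
    then show ?thesis by (simp add: erm_objective_def emp_objective_def emp_def h_eq_hr)
  next
    case False
    then have "h y = \<infinity>" by (simp add: edom_def)
    with False show ?thesis by (simp add: erm_objective_def)
  qed
  have growth: "emp_objective ?n p x z y0 \<le> emp_objective ?n p x z y"
    "emp_objective ?n p x z y \<le> emp_objective ?n p x z y0 \<Longrightarrow> y = y0" if "y \<in> C" for y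
  proof -
    have pos: "0 < (\<mu> + p) / 2" using mu_pos p by simp
    then have "0 \<le> (\<mu> + p) / 2 * (norm (y - y0))\<^sup>2" by simp
    then show "emp_objective ?n p x z y0 \<le> emp_objective ?n p x z y" using y0(2)[OF that] by linarith
    assume "emp_objective ?n p x z y \<le> emp_objective ?n p x z y0"
    then have "(\<mu> + p) / 2 * (norm (y - y0))\<^sup>2 \<le> 0" using y0(2)[OF that] by linarith
    with pos have "(norm (y - y0))\<^sup>2 \<le> 0" by (simp add: mult_le_0_iff)
    then show "y = y0" by simp
  qed
  have "is_arg_min ?F (\<lambda>_. True) y0"
    using growth(1) y0(1) by (auto simp: is_arg_min_linorder F)
  then have "is_arg_min ?F (\<lambda>_. True) (ERM g h r p x z)"
    unfolding ERM_def arg_min_def by (rule someI)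
  then have "?F (ERM g h r p x z) \<le> ?F y0" by (simp add: is_arg_min_linorder)
  then have "ERM g h r p x z = y0"
    using y0(1) growth(2)[of "ERM g h r p x z"] by (auto simp: F split: if_splits)
  then show ?thesis by (simp add: y0_def)
qed

end

text \<open>The integral form of \<open>distr_merge_on\<close>: by Fubini, the coordinates outside
  \<open>J\<close> are integrated first, with those in \<open>J\<close> held fixed.\<close>

lemma (in prob_space) integral_merge_on:
  fixes J :: "'i set" and F :: "('i \<Rightarrow> 'a) \<Rightarrow> real"
  defines "Q \<equiv> PiM (UNIV :: 'i set) (\<lambda>_. M)"
  assumes F: "integrable Q F"
  shows "(LINT w|Q. F w) = (LINT w|Q. (LINT w'|Q. F (merge_on J w w')))"
proof -
  interpret Q: prob_space Q unfolding Q_def by (rule prob_space_iid)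
  interpret QQ: pair_prob_space Q Q ..
  have [measurable]: "(\<lambda>(w, w'). merge_on J w w') \<in> measurable (Q \<Otimes>\<^sub>M Q) Q"
    unfolding Q_def by measurable
  have d: "distr (Q \<Otimes>\<^sub>M Q) Q (\<lambda>(w, w'). merge_on J w w') = Q"
    unfolding Q_def by (rule distr_merge_on)
  have F'[measurable]: "F \<in> borel_measurable Q" using F by simp
  have "integrable (distr (Q \<Otimes>\<^sub>M Q) Q (\<lambda>(w, w'). merge_on J w w')) F" using F by (simp only: d)
  then have i: "integrable (Q \<Otimes>\<^sub>M Q) (\<lambda>p. F (case p of (w, w') \<Rightarrow> merge_on J w w'))"
    by (subst (asm) integrable_distr_eq) auto
  have "(LINT w|Q. F w) = (LINT w|distr (Q \<Otimes>\<^sub>M Q) Q (\<lambda>(w, w'). merge_on J w w'). F w)"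
    by (simp only: d)
  also have "\<dots> = (LINT p|(Q \<Otimes>\<^sub>M Q). F (case p of (w, w') \<Rightarrow> merge_on J w w'))"
    by (rule integral_distr) auto
  also have "\<dots> = (LINT w|Q. (LINT w'|Q. F (merge_on J w w')))"
    using QQ.integral_fst'[OF i] by simp
  finally show ?thesis .
qed

lemma (in prob_space)
  fixes f :: "'a \<Rightarrow> real"
  assumes f: "integrable M f"
  shows integrable_iid_component: "integrable (PiM UNIV (\<lambda>_. M)) (\<lambda>w. f (w i))"
    and integral_iid_component: "(LINT w|PiM UNIV (\<lambda>_. M). f (w i)) = (LINT x|M. f x)"
proof -
  have d: "distr (PiM UNIV (\<lambda>_. M)) M (\<lambda>w. w i) = M"
    by (rule distr_PiM_component) (auto intro: prob_space_axioms)
  have "integrable (distr (PiM UNIV (\<lambda>_. M)) M (\<lambda>w. w i)) f" using f by (simp only: d)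
  then show "integrable (PiM UNIV (\<lambda>_. M)) (\<lambda>w. f (w i))"
    by (subst (asm) integrable_distr_eq) (use f in auto)
  have "(LINT x|M. f x) = (LINT x|distr (PiM UNIV (\<lambda>_. M)) M (\<lambda>w. w i). f x)" by (simp only: d)
  also have "\<dots> = (LINT w|PiM UNIV (\<lambda>_. M). f (w i))" by (rule integral_distr) (use f in auto)
  finally show "(LINT w|PiM UNIV (\<lambda>_. M). f (w i)) = (LINT x|M. f x)" by simp
qed

lemma abs_mult_le_half_squares: "\<bar>a\<bar> * \<bar>b\<bar> \<le> (a\<^sup>2 + b\<^sup>2) / (2::real)"
  using sum_squares_bound[of "\<bar>a\<bar>" "\<bar>b\<bar>"] by simp

context stochastic_composite
begin

section \<open>Stability and expected excess of one regularized ERM call\<close>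

sublocale S: prob_space S by (rule prob_space_iid)

lemma AE_good_samples: "AE z in S. \<forall>i. good (z i)"
  unfolding AE_all_countable
  using AE_good by (auto intro!: AE_PiM_component[where M = "\<lambda>_. P"] prob_space_axioms)

lemma g_measurable_pair [measurable]:
  assumes "f \<in> borel_measurable N" "k \<in> measurable N P"
  shows "(\<lambda>\<omega>. g (f \<omega>) (k \<omega>)) \<in> borel_measurable N"
  using measurable_compose[OF measurable_Pair[OF assms] g_measurable] by simp

lemma gbar_measurable [measurable]: "gbar \<in> borel_measurable borel"
  by (rule borel_measurable_continuous_onI) (rule continuous_gbar)

lemma yhat_measurable [measurable]: "(\<lambda>(x, z). yhat n p x z) \<in> borel_measurable (borel \<Otimes>\<^sub>M S)"
  unfolding yhat_def case_prod_beta
  by (rule borel_measurable_lim_argmin) (simp add: emp_objective_def emp_def)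

lemma prox_measurable [measurable]: "prox p \<in> borel_measurable borel"
  unfolding prox_def
  by (rule borel_measurable_lim_argmin) (simp add: prox_objective_def)

lemma abs_ell_integrable: "integrable P (\<lambda>z. \<bar>ell z\<bar>)"
proof (rule Bochner_Integration.integrable_bound)
  show "integrable P (\<lambda>z. 1 + (ell z)\<^sup>2)" using ell_square_integrable by simp
  have "\<bar>a\<bar> \<le> 1 + a\<^sup>2" for a :: real
    using sum_squares_bound[of "\<bar>a\<bar>" 1] by (simp add: power2_eq_square)
  then show "AE z in P. norm \<bar>ell z\<bar> \<le> norm (1 + (ell z)\<^sup>2)" by simp
qed simp

text \<open>A Lipschitz constant of \<open>gbar\<close> on \<open>C\<close>; its purpose is to
  dominate integrands.\<close>

definition ell_mean :: real where "ell_mean = (LINT z|P. \<bar>ell z\<bar>)"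

lemma ell_mean_nonneg: "0 \<le> ell_mean"
  unfolding ell_mean_def by (rule Bochner_Integration.integral_nonneg) simp

lemma integral_ell_square: "(LINT z|P. (ell z)\<^sup>2) \<le> lbar\<^sup>2"
  using ell_le_lbar lbar_pos sqrt_le_D by blast

lemma gbar_lipschitz:
  assumes "x \<in> C" "y \<in> C"
  shows "\<bar>gbar x - gbar y\<bar> \<le> ell_mean * norm (x - y)"
proof -
  have "\<bar>gbar x - gbar y\<bar> = \<bar>LINT z|P. g x z - g y z\<bar>"
    by (simp add: expected_loss_def g_integrable)
  also have "\<dots> \<le> (LINT z|P. \<bar>ell z\<bar> * norm (x - y))"
  proof (rule integral_abs_bound[THEN order_trans], rule integral_mono)
    show "\<bar>g x z - g y z\<bar> \<le> \<bar>ell z\<bar> * norm (x - y)" if "z \<in> space P" for z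
      using lipschitz_onD[OF lipschitz_g[OF that] assms] by (simp add: dist_norm)
  qed (auto intro!: g_integrable abs_ell_integrable)
  finally show ?thesis by (simp add: ell_mean_def)
qed

lemma g_lipschitz_good:
  assumes "x \<in> C" "y \<in> C" "good z"
  shows "\<bar>g x z - g y z\<bar> \<le> \<bar>ell z\<bar> * norm (x - y)"
  using lipschitz_onD[OF lipschitz_g assms(1,2)] assms(3) by (simp add: dist_norm good_def)

text \<open>Each minimizer is tested in the other's problem and the two growth inequalities are
  added. The bound does not shrink with \<open>n\<close>; it provides the integrability of products
  of \<open>ell\<close> with this distance.\<close>

lemma yhat_dist_prox:
  assumes p: "0 \<le> p" and n: "0 < n" and good: "\<forall>i. good (z i)"
  shows "norm (yhat n p x z - prox p x) \<le> ((\<Sum>i<n. \<bar>ell (z i)\<bar>) / real n + ell_mean) / (\<mu> + p)"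
proof -
  let ?y = "yhat n p x z" and ?p = "prox p x" and ?e = "(\<Sum>i<n. \<bar>ell (z i)\<bar>) / real n"
  have y: "?y \<in> C" using yhat_minimizes(1)[OF p n] good by blast
  have pC: "?p \<in> C" by (rule prox_minimizes(1)[OF p])
  have 1: "emp_objective n p x z ?y + (\<mu> + p) / 2 * (norm (?p - ?y))\<^sup>2 \<le> emp_objective n p x z ?p"
    using yhat_minimizes(2)[OF p n _ pC, where z = z] good by blast
  have 2: "prox_objective p x ?p + (\<mu> + p) / 2 * (norm (?y - ?p))\<^sup>2 \<le> prox_objective p x ?y"
    by (rule prox_minimizes(2)[OF p y])
  have 3: "\<bar>emp n z ?y - emp n z ?p\<bar> \<le> ?e * norm (?y - ?p)"
    using lipschitz_onD[OF lipschitz_emp[OF n] y pC, of z] good by (auto simp: dist_norm good_def)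
  have 4: "\<bar>gbar ?y - gbar ?p\<bar> \<le> ell_mean * norm (?y - ?p)" by (rule gbar_lipschitz[OF y pC])
  have "(\<mu> + p) * (norm (?y - ?p))\<^sup>2 = (\<mu> + p) / 2 * (norm (?y - ?p))\<^sup>2 + (\<mu> + p) / 2 * (norm (?p - ?y))\<^sup>2"
    by (simp add: norm_minus_commute)
  also have "\<dots> \<le> (emp n z ?p - emp n z ?y) + (gbar ?y - gbar ?p)"
    using 1 2 unfolding emp_objective_def prox_objective_def by linarith
  also have "\<dots> \<le> (?e + ell_mean) * norm (?y - ?p)" using 3 4 by (simp add: distrib_right)
  finally have *: "((\<mu> + p) * norm (?y - ?p)) * norm (?y - ?p) \<le> (?e + ell_mean) * norm (?y - ?p)"
    by (simp add: power2_eq_square)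
  have nn: "0 \<le> ?e + ell_mean" using ell_mean_nonneg by (simp add: sum_nonneg)
  have "(\<mu> + p) * norm (?y - ?p) \<le> ?e + ell_mean"
  proof (cases "norm (?y - ?p) = 0")
    case True then show ?thesis using nn by simp
  next
    case False then show ?thesis by (intro mult_right_le_imp_le[OF *]) simp
  qed
  then show ?thesis using mu_pos p by (simp add: pos_le_divide_eq mult.commute)
qed

text \<open>Adding the growth inequalities of the two problems cancels everything except the one
  differing loss, which carries the weight \<open>1 / n\<close>. The Lipschitz bound then leaves one
  factor of the distance to divide out.\<close>

lemma yhat_stable:
  assumes p: "0 \<le> p" and n: "0 < n" and good: "\<forall>i. good (z i)" "\<forall>i. good (z' i)"
    and i: "i < n" and eq: "\<And>j. j < n \<Longrightarrow> j \<noteq> i \<Longrightarrow> z j = z' j"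
  shows "norm (yhat n p x z - yhat n p x z') \<le> (\<bar>ell (z i)\<bar> + \<bar>ell (z' i)\<bar>) / (real n * (\<mu> + p))"
proof -
  let ?y = "yhat n p x z" and ?y' = "yhat n p x z'"
  have y: "?y \<in> C" "?y' \<in> C" using yhat_minimizes(1)[OF p n] good by blast+
  have 1: "emp_objective n p x z ?y + (\<mu> + p) / 2 * (norm (?y' - ?y))\<^sup>2 \<le> emp_objective n p x z ?y'"
    using yhat_minimizes(2)[OF p n _ y(2), where z = z] good by blast
  have 2: "emp_objective n p x z' ?y' + (\<mu> + p) / 2 * (norm (?y - ?y'))\<^sup>2 \<le> emp_objective n p x z' ?y"
    using yhat_minimizes(2)[OF p n _ y(1), where z = z'] good by blast
  have diff: "emp n z u - emp n z' u = (g u (z i) - g u (z' i)) / real n" for u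
  proof -
    have "emp n z u - emp n z' u = (\<Sum>j<n. g u (z j) - g u (z' j)) / real n"
      by (simp add: emp_def sum_subtractf diff_divide_distrib)
    also have "(\<Sum>j<n. g u (z j) - g u (z' j)) = (\<Sum>j\<in>{i}. g u (z j) - g u (z' j))"
      using i eq by (intro sum.mono_neutral_right) auto
    finally show ?thesis by simp
  qed
  have "(\<mu> + p) * (norm (?y - ?y'))\<^sup>2 = (\<mu> + p) / 2 * (norm (?y - ?y'))\<^sup>2 + (\<mu> + p) / 2 * (norm (?y' - ?y))\<^sup>2"
    by (simp add: norm_minus_commute)
  also have "\<dots> \<le> (emp n z ?y' - emp n z' ?y') - (emp n z ?y - emp n z' ?y)"
    using 1 2 unfolding emp_objective_def by linarith
  also have "\<dots> = ((g ?y' (z i) - g ?y (z i)) + (g ?y (z' i) - g ?y' (z' i))) / real n"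
    unfolding diff by (simp add: diff_divide_distrib add_divide_distrib)
  also have "\<dots> \<le> (\<bar>ell (z i)\<bar> * norm (?y - ?y') + \<bar>ell (z' i)\<bar> * norm (?y - ?y')) / real n"
    using g_lipschitz_good[OF y(2,1), of "z i"] g_lipschitz_good[OF y, of "z' i"] good
    by (intro divide_right_mono add_mono) (auto simp: norm_minus_commute)
  also have "\<dots> = (\<bar>ell (z i)\<bar> + \<bar>ell (z' i)\<bar>) / real n * norm (?y - ?y')" by (simp add: distrib_right)
  finally have *: "((\<mu> + p) * norm (?y - ?y')) * norm (?y - ?y') \<le> (\<bar>ell (z i)\<bar> + \<bar>ell (z' i)\<bar>) / real n * norm (?y - ?y')"
    by (simp add: power2_eq_square)
  have "(\<mu> + p) * norm (?y - ?y') \<le> (\<bar>ell (z i)\<bar> + \<bar>ell (z' i)\<bar>) / real n"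
  proof (cases "norm (?y - ?y') = 0")
    case False then show ?thesis by (intro mult_right_le_imp_le[OF *]) simp
  qed simp
  then have "(\<mu> + p) * norm (?y - ?y') * real n \<le> \<bar>ell (z i)\<bar> + \<bar>ell (z' i)\<bar>"
    using n pos_le_divide_eq[of "real n"] by simp
  moreover have "0 < real n * (\<mu> + p)" using n mu_pos p by simp
  ultimately show ?thesis by (simp only: pos_le_divide_eq ac_simps)
qed

text \<open>Unlike the suboptimality of \<open>yhat\<close>, which it dominates, this does not involve \<open>h\<close>; it is therefore
  measurable and integrable without any further assumption on \<open>h\<close>.\<close>

definition excess :: "nat \<Rightarrow> real \<Rightarrow> 'a \<Rightarrow> (nat \<Rightarrow> 'z) \<Rightarrow> real" where
  "excess n p x z = (gbar (yhat n p x z) - gbar (prox p x)) - (emp n z (yhat n p x z) - emp n z (prox p x))"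

lemma excess_measurable [measurable]: "(\<lambda>(x, z). excess n p x z) \<in> borel_measurable (borel \<Otimes>\<^sub>M S)"
  unfolding excess_def emp_def by measurable

text \<open>The empirical objective at \<open>yhat\<close> is at most that at the proximal point;
  subtracting this inequality cancels the penalty and \<open>hr\<close>.\<close>

lemma suboptimality_le_excess:
  assumes p: "0 \<le> p" and n: "0 < n" and good: "\<forall>i<n. good (z i)"
  shows "prox_objective p x (yhat n p x z) - prox_objective p x (prox p x) \<le> excess n p x z"
proof -
  let ?y = "yhat n p x z" and ?p = "prox p x"
  have pC: "?p \<in> C" by (rule prox_minimizes(1)[OF p])
  have "emp_objective n p x z ?y + (\<mu> + p) / 2 * (norm (?p - ?y))\<^sup>2 \<le> emp_objective n p x z ?p"
    using yhat_minimizes(2)[OF p n _ pC, where z = z] good by blast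
  moreover have "0 \<le> (\<mu> + p) / 2 * (norm (?p - ?y))\<^sup>2" using mu_pos p by simp
  ultimately show ?thesis
    unfolding emp_objective_def prox_objective_def excess_def by linarith
qed

text \<open>Required for Markov's inequality.\<close>

lemma excess_nonneg:
  assumes p: "0 \<le> p" and n: "0 < n" and good: "\<forall>i<n. good (z i)"
  shows "0 \<le> excess n p x z"
proof -
  have "yhat n p x z \<in> C" using yhat_minimizes(1)[OF p n] good by blast
  from prox_minimizes(2)[OF p this, of x]
  have "prox_objective p x (prox p x) + (\<mu> + p) / 2 * (norm (yhat n p x z - prox p x))\<^sup>2
    \<le> prox_objective p x (yhat n p x z)" .
  moreover have "0 \<le> (\<mu> + p) / 2 * (norm (yhat n p x z - prox p x))\<^sup>2" using mu_pos p by simp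
  ultimately show ?thesis using suboptimality_le_excess[OF assms, of x] by linarith
qed

lemma
  shows integrable_ell_square_sample: "integrable S (\<lambda>z. (ell (z i))\<^sup>2)"
    and integral_ell_square_sample: "(LINT z|S. (ell (z i))\<^sup>2) \<le> lbar\<^sup>2"
  using integrable_iid_component[OF ell_square_integrable, of i]
    integral_iid_component[OF ell_square_integrable, of i] integral_ell_square by auto

lemma integrable_ell_mult: "integrable S (\<lambda>z. \<bar>ell (z i)\<bar> * \<bar>ell (z j)\<bar>)"
proof (rule Bochner_Integration.integrable_bound)
  show "integrable S (\<lambda>z. ((ell (z i))\<^sup>2 + (ell (z j))\<^sup>2) / 2)"
    using integrable_ell_square_sample by auto
  show "AE z in S. norm (\<bar>ell (z i)\<bar> * \<bar>ell (z j)\<bar>) \<le> norm (((ell (z i))\<^sup>2 + (ell (z j))\<^sup>2) / 2)"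
    using abs_mult_le_half_squares by (simp add: abs_mult)
qed measurable

lemma integral_ell_mult_le: "(LINT z|S. \<bar>ell (z i)\<bar> * \<bar>ell (z j)\<bar>) \<le> lbar\<^sup>2"
proof -
  have "(LINT z|S. \<bar>ell (z i)\<bar> * \<bar>ell (z j)\<bar>) \<le> (LINT z|S. ((ell (z i))\<^sup>2 + (ell (z j))\<^sup>2) / 2)"
    by (intro integral_mono integrable_ell_mult abs_mult_le_half_squares)
      (use integrable_ell_square_sample in auto)
  also have "\<dots> = ((LINT z|S. (ell (z i))\<^sup>2) + (LINT z|S. (ell (z j))\<^sup>2)) / 2"
    using integrable_ell_square_sample by simp
  also have "\<dots> \<le> (lbar\<^sup>2 + lbar\<^sup>2) / 2"
    by (intro divide_right_mono add_mono integral_ell_square_sample) simp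
  finally show ?thesis by simp
qed

lemma integrable_ell_mult_dist:
  assumes p: "0 \<le> p" and n: "0 < n"
  shows "integrable S (\<lambda>z. \<bar>ell (z i)\<bar> * norm (yhat n p x z - prox p x))"
    and "integrable S (\<lambda>z. norm (yhat n p x z - prox p x))"
proof -
  let ?R = "\<lambda>z. ((\<Sum>i<n. \<bar>ell (z i)\<bar>) / real n + ell_mean) / (\<mu> + p)"
  have ie: "integrable S (\<lambda>z. \<bar>ell (z i)\<bar>)" for i
    by (rule integrable_iid_component[OF abs_ell_integrable])
  have bound: "AE z in S. norm (yhat n p x z - prox p x) \<le> ?R z"
    using AE_good_samples by eventually_elim (rule yhat_dist_prox[OF p n])
  then have bound': "AE z in S. norm (norm (yhat n p x z - prox p x)) \<le> norm (?R z)"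
    by eventually_elim (metis abs_ge_self abs_norm_cancel order_trans real_norm_def)
  have R: "integrable S ?R"
    by (intro integrable_divide_zero Bochner_Integration.integrable_add Bochner_Integration.integrable_sum ie) simp
  have eR: "integrable S (\<lambda>z. \<bar>ell (z i)\<bar> * ?R z)"
    unfolding times_divide_eq_right distrib_left sum_distrib_left
    by (intro integrable_divide_zero Bochner_Integration.integrable_add Bochner_Integration.integrable_sum
        integrable_ell_mult integrable_mult_left ie)
  show "integrable S (\<lambda>z. norm (yhat n p x z - prox p x))"
    by (rule Bochner_Integration.integrable_bound[OF R _ bound']) measurable
  show "integrable S (\<lambda>z. \<bar>ell (z i)\<bar> * norm (yhat n p x z - prox p x))"
  proof (rule Bochner_Integration.integrable_bound[OF eR])
    show "AE z in S. norm (\<bar>ell (z i)\<bar> * norm (yhat n p x z - prox p x)) \<le> norm (\<bar>ell (z i)\<bar> * ?R z)"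
      using bound' by eventually_elim (metis mult_left_mono norm_ge_zero norm_mult)
  qed measurable
qed

lemma excess_integrable:
  assumes p: "0 \<le> p" and n: "0 < n"
  shows "integrable S (excess n p x)"
proof (rule Bochner_Integration.integrable_bound)
  let ?r = "\<lambda>z. norm (yhat n p x z - prox p x)"
  let ?B = "\<lambda>z. ell_mean * ?r z + (\<Sum>i<n. \<bar>ell (z i)\<bar> * ?r z) / real n"
  show "integrable S ?B"
    by (intro integrable_divide_zero Bochner_Integration.integrable_add Bochner_Integration.integrable_sum
        integrable_mult_right integrable_ell_mult_dist[OF p n])
  show "AE z in S. norm (excess n p x z) \<le> norm (?B z)"
    using AE_good_samples
  proof eventually_elim
    case (elim z)
    have C: "yhat n p x z \<in> C" "prox p x \<in> C"
      using yhat_minimizes(1)[OF p n] elim prox_minimizes(1)[OF p] by blast+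
    have "\<bar>emp n z (yhat n p x z) - emp n z (prox p x)\<bar> \<le> (\<Sum>i<n. \<bar>ell (z i)\<bar>) / real n * ?r z"
      using lipschitz_onD[OF lipschitz_emp[OF n] C, of z] elim by (auto simp: dist_norm good_def)
    moreover have "(\<Sum>i<n. \<bar>ell (z i)\<bar>) / real n * ?r z = (\<Sum>i<n. \<bar>ell (z i)\<bar> * ?r z) / real n"
      by (simp add: sum_distrib_right)
    moreover note gbar_lipschitz[OF C]
    ultimately have "\<bar>excess n p x z\<bar> \<le> ?B z" unfolding excess_def by linarith
    then show ?case by simp
  qed
qed measurable

text \<open>Sample \<open>n\<close> is a ghost sample not seen by \<open>y\<close>: evaluating the loss there has the mean of the
  population loss.  Exchanging it with sample \<open>i\<close> preserves the measure, and by stability moves the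
  minimizer by at most \<open>(\<bar>ell (z i)\<bar> + \<bar>ell (z n)\<bar>) / (n (\<mu> + p))\<close>.\<close>

lemma expected_excess_le:
  assumes p: "0 \<le> p" and n: "0 < n"
  shows "(LINT z|S. excess n p x z) \<le> 2 * lbar\<^sup>2 / (real n * (\<mu> + p))"
proof -
  define y where "y = yhat n p x"
  define ps where "ps = prox p x"
  define r where "r z = norm (y z - ps)" for z
  have ps: "ps \<in> C" unfolding ps_def by (rule prox_minimizes(1)[OF p])
  have yC: "y z \<in> C" if "\<forall>i. good (z i)" for z
    unfolding y_def using yhat_minimizes(1)[OF p n] that by blast
  have [measurable]: "y \<in> borel_measurable S" unfolding y_def by measurable
  have ier: "integrable S (\<lambda>z. \<bar>ell (z i)\<bar> * r z)" for i
    unfolding r_def y_def ps_def by (rule integrable_ell_mult_dist[OF p n])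
  define b where "b i z = g (y z) (z i) - g ps (z i)" for i z
  have [measurable]: "b i \<in> borel_measurable S" for i unfolding b_def by measurable
  have bi: "integrable S (b i)" for i
  proof (rule Bochner_Integration.integrable_bound[OF ier[of i]])
    show "AE z in S. norm (b i z) \<le> norm (\<bar>ell (z i)\<bar> * r z)"
      using AE_good_samples
    proof eventually_elim
      case (elim z)
      then show ?case using g_lipschitz_good[OF yC[OF elim] ps, of "z i"] by (simp add: b_def r_def)
    qed
  qed measurable
  have mean_b: "(LINT z|S. b n z) = (LINT z|S. gbar (y z) - gbar ps)"
  proof -
    \<comment> \<open>Only coordinate \<open>n\<close> is resampled; \<open>y\<close> reads the
      coordinates below \<open>n\<close>, so it is constant in the inner integral.\<close>
    have "(LINT z|S. b n z) = (LINT z|S. (LINT z'|S. b n (merge_on (- {n}) z z')))"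
      by (rule integral_merge_on[OF bi])
    also have "\<dots> = (LINT z|S. gbar (y z) - gbar ps)"
    proof (intro Bochner_Integration.integral_cong refl)
      fix z
      have "y (merge_on (- {n}) z z') = y z" for z'
        by (simp add: y_def yhat_def emp_objective_def[abs_def] emp_def merge_on_def)
      then have "(LINT z'|S. b n (merge_on (- {n}) z z')) = (LINT z'|S. g (y z) (z' n) - g ps (z' n))"
        by (simp add: b_def merge_on_def)
      also have "\<dots> = gbar (y z) - gbar ps"
        by (subst integral_iid_component[of "\<lambda>u. g (y z) u - g ps u"])
          (simp_all add: g_integrable expected_loss_def)
      finally show "(LINT z'|S. b n (merge_on (- {n}) z z')) = gbar (y z) - gbar ps" .
    qed
    finally show ?thesis .
  qed
  have swap: "(LINT z|S. b n z) - (LINT z|S. b i z) \<le> 2 * lbar\<^sup>2 / (real n * (\<mu> + p))" if i: "i < n" for i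
  proof -
    define \<tau> where "\<tau> z = (\<lambda>j. z (Transposition.transpose i n j))" for z :: "nat \<Rightarrow> 'z"
    have d: "distr S S \<tau> = S"
      unfolding \<tau>_def by (rule distr_iid_reindex) simp
    have [measurable]: "\<tau> \<in> measurable S S" unfolding \<tau>_def by (rule measurable_reindex)
    have "integrable (distr S S \<tau>) (b n)" using bi by (simp only: d)
    then have bt: "integrable S (\<lambda>z. b n (\<tau> z))" by (subst (asm) integrable_distr_eq) auto
    have "(LINT z|S. b n z) = (LINT z|distr S S \<tau>. b n z)" by (simp only: d)
    also have "\<dots> = (LINT z|S. b n (\<tau> z))" by (rule integral_distr) auto
    finally have "(LINT z|S. b n z) - (LINT z|S. b i z) = (LINT z|S. b n (\<tau> z) - b i z)"
      using bt bi by simp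
    also have "\<dots> \<le> (LINT z|S. (\<bar>ell (z i)\<bar> * \<bar>ell (z i)\<bar> + \<bar>ell (z i)\<bar> * \<bar>ell (z n)\<bar>) / (real n * (\<mu> + p)))"
    proof (rule integral_mono_AE)
      show "AE z in S. b n (\<tau> z) - b i z \<le> (\<bar>ell (z i)\<bar> * \<bar>ell (z i)\<bar> + \<bar>ell (z i)\<bar> * \<bar>ell (z n)\<bar>) / (real n * (\<mu> + p))"
        using AE_good_samples
      proof eventually_elim
        case (elim z)
        have \<tau>: "\<forall>j. good (\<tau> z j)" using elim by (simp add: \<tau>_def)
        have \<tau>i: "\<tau> z n = z i" "\<tau> z i = z n" by (simp_all add: \<tau>_def)
        have "norm (y (\<tau> z) - y z) \<le> (\<bar>ell (\<tau> z i)\<bar> + \<bar>ell (z i)\<bar>) / (real n * (\<mu> + p))"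
          unfolding y_def
        proof (rule yhat_stable[OF p n \<tau> elim i])
          fix j assume "j < n" "j \<noteq> i"
          then show "\<tau> z j = z j" by (simp add: \<tau>_def Transposition.transpose_def)
        qed
        then have st: "norm (y (\<tau> z) - y z) \<le> (\<bar>ell (z i)\<bar> + \<bar>ell (z n)\<bar>) / (real n * (\<mu> + p))"
          by (simp add: \<tau>i add.commute)
        \<comment> \<open>Both losses are now evaluated at the sample \<open>z i\<close>, so the
          reference terms at \<open>ps\<close> cancel and only the displacement of the minimizer
          remains.\<close>
        have "b n (\<tau> z) - b i z = g (y (\<tau> z)) (z i) - g (y z) (z i)"
          by (simp add: b_def \<tau>i)
        also have "\<dots> \<le> \<bar>ell (z i)\<bar> * norm (y (\<tau> z) - y z)"
          using g_lipschitz_good[OF yC[OF \<tau>] yC[OF elim], of "z i"] elim by auto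
        also have "\<dots> \<le> \<bar>ell (z i)\<bar> * ((\<bar>ell (z i)\<bar> + \<bar>ell (z n)\<bar>) / (real n * (\<mu> + p)))"
          by (intro mult_left_mono st) simp
        finally show ?case by (simp add: distrib_left)
      qed
      show "integrable S (\<lambda>z. b n (\<tau> z) - b i z)" using bt bi by simp
      show "integrable S (\<lambda>z. (\<bar>ell (z i)\<bar> * \<bar>ell (z i)\<bar> + \<bar>ell (z i)\<bar> * \<bar>ell (z n)\<bar>) / (real n * (\<mu> + p)))"
        by (intro integrable_divide_zero Bochner_Integration.integrable_add integrable_ell_mult)
    qed
    also have "\<dots> = ((LINT z|S. \<bar>ell (z i)\<bar> * \<bar>ell (z i)\<bar>) + (LINT z|S. \<bar>ell (z i)\<bar> * \<bar>ell (z n)\<bar>)) / (real n * (\<mu> + p))"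
      by (subst integral_divide_zero, subst Bochner_Integration.integral_add) (intro integrable_ell_mult, intro integrable_ell_mult, rule refl)
    also have "\<dots> \<le> (lbar\<^sup>2 + lbar\<^sup>2) / (real n * (\<mu> + p))"
      using mu_pos p by (intro divide_right_mono add_mono integral_ell_mult_le) simp
    finally show ?thesis by simp
  qed
  have ig: "integrable S (\<lambda>z. gbar (y z) - gbar ps)"
  proof (rule Bochner_Integration.integrable_bound)
    show "integrable S (\<lambda>z. ell_mean * r z)"
      unfolding r_def y_def ps_def by (intro integrable_mult_right integrable_ell_mult_dist[OF p n])
    show "AE z in S. norm (gbar (y z) - gbar ps) \<le> norm (ell_mean * r z)"
      using AE_good_samples
      by eventually_elim (use gbar_lipschitz[OF yC ps] ell_mean_nonneg in \<open>auto simp: r_def\<close>)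
  qed measurable
  have "excess n p x z = (gbar (y z) - gbar ps) - (\<Sum>i<n. b i z) / real n" for z
    by (simp add: excess_def y_def ps_def emp_def b_def sum_subtractf diff_divide_distrib)
  then have "(LINT z|S. excess n p x z) = (LINT z|S. b n z) - (\<Sum>i<n. LINT z|S. b i z) / real n"
    using ig bi by (simp add: mean_b)
  also have "\<dots> = (\<Sum>i<n. (LINT z|S. b n z) - (LINT z|S. b i z)) / real n"
    using n by (simp add: sum_subtractf diff_divide_distrib)
  also have "\<dots> \<le> (\<Sum>i<n. 2 * lbar\<^sup>2 / (real n * (\<mu> + p))) / real n"
    by (intro divide_right_mono sum_mono swap) auto
  also have "\<dots> = 2 * lbar\<^sup>2 / (real n * (\<mu> + p))" using n by simp
  finally show ?thesis .
qed

text \<open>The constant 6 makes the expected excess at most \<open>e / 3\<close>, and Markov's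
  inequality turns this into probability 1/3.\<close>

lemma prob_excess_le:
  assumes p: "0 \<le> p" and e: "0 < e"
  shows "0 < nat \<lceil>6 * lbar\<^sup>2 / ((\<mu> + p) * e)\<rceil>"
    "measure S {z\<in>space S. e < excess (nat \<lceil>6 * lbar\<^sup>2 / ((\<mu> + p) * e)\<rceil>) p x z} \<le> 1 / 3"
proof -
  let ?n = "nat \<lceil>6 * lbar\<^sup>2 / ((\<mu> + p) * e)\<rceil>"
  have pos: "0 < 6 * lbar\<^sup>2 / ((\<mu> + p) * e)" using mu_pos p e lbar_pos by simp
  then show n: "0 < ?n" by simp
  have "6 * lbar\<^sup>2 / ((\<mu> + p) * e) \<le> real ?n" by linarith
  moreover have "0 < (\<mu> + p) * e" using mu_pos p e by simp
  ultimately have le6: "6 * lbar\<^sup>2 \<le> real ?n * ((\<mu> + p) * e)" using pos_divide_le_eq by blast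
  then have le: "2 * lbar\<^sup>2 / (real ?n * (\<mu> + p)) \<le> e / 3"
  proof (subst pos_divide_le_eq)
    show "0 < real ?n * (\<mu> + p)" using mu_pos p n by simp
    have "real ?n * ((\<mu> + p) * e) = 3 * (e / 3 * (real ?n * (\<mu> + p)))" by simp
    with le6 show "2 * lbar\<^sup>2 \<le> e / 3 * (real ?n * (\<mu> + p))" by linarith
  qed
  have "measure S {z\<in>space S. e < excess ?n p x z} \<le> measure S {z\<in>space S. e \<le> excess ?n p x z}"
    by (intro S.finite_measure_mono) auto
  also have "\<dots> \<le> (LINT z|S. excess ?n p x z) / e"
    using AE_good_samples e
    by (intro integral_Markov_inequality_measure[where A = "{}"] excess_integrable[OF p n])
      (auto elim!: eventually_mono intro!: excess_nonneg[OF p n])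
  also have "\<dots> \<le> (e / 3) / e"
    using expected_excess_le[OF p n, of x] le e by (intro divide_right_mono) auto
  finally show "measure S {z\<in>space S. e < excess ?n p x z} \<le> 1 / 3" using e by simp
qed

end

section \<open>The gradient estimator\<close>

text \<open>\<open>gradient\<close> is a definite description: existence comes from expanding the
  derivative in the basis, uniqueness from uniqueness of derivatives.\<close>

lemma GDERIV_gradient:
  fixes \<phi> :: "'a::euclidean_space \<Rightarrow> real"
  assumes "\<phi> differentiable (at x)"
  shows "GDERIV \<phi> x :> gradient \<phi> x"
proof -
  obtain D where D: "(\<phi> has_derivative D) (at x)" using assms by (auto simp: differentiable_def)
  then interpret bounded_linear D by (rule has_derivative_bounded_linear)
  have "D = (\<lambda>v. v \<bullet> (\<Sum>b\<in>Basis. D b *\<^sub>R b))"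
  proof
    fix v
    have "D v = D (\<Sum>b\<in>Basis. (v \<bullet> b) *\<^sub>R b)" by (simp add: euclidean_representation)
    also have "\<dots> = v \<bullet> (\<Sum>b\<in>Basis. D b *\<^sub>R b)"
      by (simp add: sum scaleR inner_sum_right mult.commute)
    finally show "D v = v \<bullet> (\<Sum>b\<in>Basis. D b *\<^sub>R b)" .
  qed
  then have "GDERIV \<phi> x :> (\<Sum>b\<in>Basis. D b *\<^sub>R b)"
    using D unfolding gderiv_def by simp
  moreover have "d1 = d2" if "GDERIV \<phi> x :> d1" "GDERIV \<phi> x :> d2" for d1 d2
  proof -
    have "(\<lambda>v. v \<bullet> d1) = (\<lambda>v. v \<bullet> d2)"
      using has_derivative_unique that unfolding gderiv_def by blast
    then show ?thesis by (metis vector_eq_ldot)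
  qed
  ultimately show ?thesis unfolding gradient_def by (metis (no_types, lifting) theI)
qed

lemma GDERIV_has_real_derivative_line:
  fixes \<phi> :: "'a::real_inner \<Rightarrow> real"
  assumes "GDERIV \<phi> (x + t *\<^sub>R u) :> D"
  shows "((\<lambda>t. \<phi> (x + t *\<^sub>R u)) has_real_derivative u \<bullet> D) (at t)"
proof -
  have "((\<lambda>t. x + t *\<^sub>R u) has_derivative (\<lambda>s. s *\<^sub>R u)) (at t)"
    by (auto intro!: derivative_eq_intros)
  from has_derivative_compose[OF this assms[unfolded gderiv_def]]
  have "((\<lambda>t. \<phi> (x + t *\<^sub>R u)) has_derivative (\<lambda>s. s *\<^sub>R u \<bullet> D)) (at t)" by simp
  then show ?thesis by (simp add: has_field_derivative_def mult.commute[of _ "u \<bullet> D"])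
qed

text \<open>A sequence of steps is used so that measurability of limits and dominated convergence
  apply.\<close>

lemma GDERIV_quotient_tendsto:
  fixes \<phi> :: "'a::real_inner \<Rightarrow> real"
  assumes "GDERIV \<phi> x :> D"
  shows "(\<lambda>k. (\<phi> (x + (1 / real (Suc k)) *\<^sub>R u) - \<phi> x) * real (Suc k)) \<longlonglongrightarrow> u \<bullet> D"
proof -
  have "((\<lambda>t. \<phi> (x + t *\<^sub>R u)) has_real_derivative u \<bullet> D) (at 0)"
    by (rule GDERIV_has_real_derivative_line) (use assms in simp)
  then have "((\<lambda>t. (\<phi> (x + t *\<^sub>R u) - \<phi> x) / t) \<longlongrightarrow> u \<bullet> D) (at 0)"
    by (simp add: has_field_derivative_iff)
  moreover have "filterlim (\<lambda>k. 1 / real (Suc k)) (at 0) sequentially"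
    by (rule filterlim_atI[OF LIMSEQ_Suc[OF lim_1_over_n]]) simp
  ultimately have "(\<lambda>k. (\<phi> (x + (1 / real (Suc k)) *\<^sub>R u) - \<phi> x) / (1 / real (Suc k))) \<longlonglongrightarrow> u \<bullet> D"
    by (rule filterlim_compose)
  then show ?thesis by simp
qed

text \<open>The mean value theorem gives the constant \<open>L\<close> instead of the sharp \<open>L / 2\<close>, which the factor
  222 in \<open>gap_eps\<close> leaves room for.\<close>

lemma L_smooth_remainder:
  fixes \<phi> :: "'a::euclidean_space \<Rightarrow> real"
  assumes "L_smooth L \<phi>"
  shows "\<bar>\<phi> y - \<phi> x - gradient \<phi> x \<bullet> (y - x)\<bar> \<le> L * (norm (y - x))\<^sup>2"
proof -
  let ?\<psi> = "\<lambda>t. \<phi> (x + t *\<^sub>R (y - x))"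
  have der: "(?\<psi> has_real_derivative (y - x) \<bullet> gradient \<phi> (x + t *\<^sub>R (y - x))) (at t)" for t
    by (rule GDERIV_has_real_derivative_line[OF GDERIV_gradient]) (use assms in \<open>simp add: L_smooth_def\<close>)
  obtain t where t: "0 < t" "t < 1" "?\<psi> 1 - ?\<psi> 0 = (1 - 0) * ((y - x) \<bullet> gradient \<phi> (x + t *\<^sub>R (y - x)))"
    using MVT2[of 0 1 ?\<psi> "\<lambda>t. (y - x) \<bullet> gradient \<phi> (x + t *\<^sub>R (y - x))"] der by auto
  let ?w = "x + t *\<^sub>R (y - x)"
  have L: "0 \<le> L" and lip: "norm (gradient \<phi> ?w - gradient \<phi> x) \<le> L * norm (?w - x)"
    using assms lipschitz_onD[of L UNIV "gradient \<phi>" ?w x] lipschitz_on_nonneg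
    by (auto simp: L_smooth_def dist_norm)
  have "\<phi> y - \<phi> x - gradient \<phi> x \<bullet> (y - x) = (y - x) \<bullet> (gradient \<phi> ?w - gradient \<phi> x)"
    using t(3) by (simp add: inner_diff_right inner_commute)
  then have "\<bar>\<phi> y - \<phi> x - gradient \<phi> x \<bullet> (y - x)\<bar> \<le> norm (y - x) * norm (gradient \<phi> ?w - gradient \<phi> x)"
    using Cauchy_Schwarz_ineq2 by metis
  also have "\<dots> \<le> norm (y - x) * (L * norm (?w - x))" by (intro mult_left_mono lip) simp
  also have "norm (?w - x) \<le> norm (y - x)" using t by (simp add: mult_left_le_one_le)
  then have "norm (y - x) * (L * norm (?w - x)) \<le> norm (y - x) * (L * norm (y - x))"
    using L by (intro mult_left_mono) auto
  finally show ?thesis by (simp add: power2_eq_square ac_simps)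
qed

context stochastic_composite
begin

text \<open>A jointly measurable version of the gradient of \<open>g\<close> in its first argument.\<close>

definition sgrad :: "'a \<Rightarrow> 'z \<Rightarrow> 'a" where
  "sgrad x z = (\<Sum>b\<in>Basis. lim (\<lambda>k. (g (x + (1 / real (Suc k)) *\<^sub>R b) z - g x z) * real (Suc k)) *\<^sub>R b)"

lemma sgrad_measurable [measurable]:
  assumes [measurable]: "f \<in> borel_measurable N" "k \<in> measurable N P"
  shows "(\<lambda>\<omega>. sgrad (f \<omega>) (k \<omega>)) \<in> borel_measurable N"
  unfolding sgrad_def by measurable

lemma GDERIV_good: "good z \<Longrightarrow> x \<in> C \<Longrightarrow> GDERIV (\<lambda>x. g x z) x :> gradient (\<lambda>x. g x z) x"
  by (rule GDERIV_gradient) (simp add: good_def)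

lemma sgrad_eq_gradient:
  assumes "good z" "x \<in> C"
  shows "sgrad x z = gradient (\<lambda>x. g x z) x"
proof -
  have "lim (\<lambda>k. (g (x + (1 / real (Suc k)) *\<^sub>R b) z - g x z) * real (Suc k)) = gradient (\<lambda>x. g x z) x \<bullet> b" for b
    using limI[OF GDERIV_quotient_tendsto[OF GDERIV_good[OF assms]], of b] by (simp add: inner_commute)
  then show ?thesis by (simp add: sgrad_def euclidean_representation)
qed

lemma quotient_bound:
  assumes "x \<in> C" "z \<in> space P" "x + (1 / real (Suc k)) *\<^sub>R u \<in> U"
  shows "\<bar>(g (x + (1 / real (Suc k)) *\<^sub>R u) z - g x z) * real (Suc k)\<bar> \<le> \<bar>ell z\<bar> * norm u"
proof -
  have "\<bar>g (x + (1 / real (Suc k)) *\<^sub>R u) z - g x z\<bar> \<le> ell z * norm (x + (1 / real (Suc k)) *\<^sub>R u - x)"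
    using assms dom_subset_U by (intro g_lipschitz) auto
  also have "\<dots> = ell z * (norm u / real (Suc k))" by simp
  also have "\<dots> \<le> \<bar>ell z\<bar> * (norm u / real (Suc k))" by (intro mult_right_mono) auto
  finally have "\<bar>g (x + (1 / real (Suc k)) *\<^sub>R u) z - g x z\<bar> * real (Suc k)
      \<le> \<bar>ell z\<bar> * (norm u / real (Suc k)) * real (Suc k)"
    by (rule mult_right_mono) simp
  then show ?thesis by (simp add: abs_mult)
qed

lemma eventually_in_U:
  assumes "x \<in> C"
  shows "eventually (\<lambda>k. x + (1 / real (Suc k)) *\<^sub>R u \<in> U) sequentially"
proof -
  have "(\<lambda>k. x + (1 / real (Suc k)) *\<^sub>R u) \<longlonglongrightarrow> x + 0 *\<^sub>R u"
    by (intro tendsto_intros LIMSEQ_Suc[OF lim_1_over_n])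
  then show ?thesis using open_U assms dom_subset_U by (auto simp: tendsto_def)
qed

text \<open>Difference quotients in the direction of the gradient itself give
  \<open>norm ?D * norm ?D \<le> \<bar>ell z\<bar> * norm ?D\<close>; openness of \<open>U\<close>
  keeps the small steps where the Lipschitz bound holds.\<close>

lemma norm_sgrad_le:
  assumes "good z" "x \<in> C"
  shows "norm (sgrad x z) \<le> \<bar>ell z\<bar>"
proof -
  let ?D = "gradient (\<lambda>x. g x z) x"
  have "(\<lambda>k. \<bar>(g (x + (1 / real (Suc k)) *\<^sub>R ?D) z - g x z) * real (Suc k)\<bar>) \<longlonglongrightarrow> \<bar>?D \<bullet> ?D\<bar>"
    by (intro tendsto_intros GDERIV_quotient_tendsto GDERIV_good assms)
  moreover have "eventually (\<lambda>k. \<bar>(g (x + (1 / real (Suc k)) *\<^sub>R ?D) z - g x z) * real (Suc k)\<bar> \<le> \<bar>ell z\<bar> * norm ?D) sequentially"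
    using eventually_in_U[OF assms(2), of ?D]
    by eventually_elim (rule quotient_bound[OF assms(2)], use assms(1) in \<open>simp_all add: good_def\<close>)
  ultimately have "\<bar>?D \<bullet> ?D\<bar> \<le> \<bar>ell z\<bar> * norm ?D"
    by (rule tendsto_upperbound) simp
  then have *: "norm ?D * norm ?D \<le> \<bar>ell z\<bar> * norm ?D" by (simp add: dot_square_norm power2_eq_square)
  have "norm ?D \<le> \<bar>ell z\<bar>"
  proof (cases "norm ?D = 0")
    case False then show ?thesis by (intro mult_right_le_imp_le[OF *]) simp
  qed simp
  then show ?thesis by (simp add: sgrad_eq_gradient assms)
qed

lemma sgrad_inner_integrable:
  assumes x: "x \<in> C"
  shows "integrable P (\<lambda>z. sgrad x z \<bullet> b)"
proof (rule Bochner_Integration.integrable_bound)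
  show "integrable P (\<lambda>z. \<bar>ell z\<bar> * norm b)" using abs_ell_integrable by simp
  show "AE z in P. norm (sgrad x z \<bullet> b) \<le> norm (\<bar>ell z\<bar> * norm b)"
    using AE_good
  proof eventually_elim
    case (elim z)
    have "\<bar>sgrad x z \<bullet> b\<bar> \<le> norm (sgrad x z) * norm b" by (rule Cauchy_Schwarz_ineq2)
    also have "\<dots> \<le> \<bar>ell z\<bar> * norm b" by (intro mult_right_mono norm_sgrad_le elim x) simp
    finally show ?case by simp
  qed
qed measurable

text \<open>Unbiasedness, by differentiating under the integral: the quotients are dominated by a
  multiple of \<open>ell\<close> once the steps stay in \<open>U\<close>, hence the shift by
  \<open>K\<close>.\<close>

lemma expected_sgrad:
  assumes x: "x \<in> C"
  shows "(LINT z|P. sgrad x z \<bullet> b) = gradient gbar x \<bullet> b"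
proof -
  obtain K where K: "\<And>k. k \<ge> K \<Longrightarrow> x + (1 / real (Suc k)) *\<^sub>R b \<in> U"
    using eventually_in_U[OF x, of b] by (auto simp: eventually_sequentially)
  let ?q = "\<lambda>k z. (g (x + (1 / real (Suc k)) *\<^sub>R b) z - g x z) * real (Suc k)"
  have "(\<lambda>k. LINT z|P. ?q (k + K) z) \<longlonglongrightarrow> (LINT z|P. sgrad x z \<bullet> b)"
  proof (rule integral_dominated_convergence[where w = "\<lambda>z. \<bar>ell z\<bar> * norm b"])
    show "AE z in P. (\<lambda>k. ?q (k + K) z) \<longlonglongrightarrow> sgrad x z \<bullet> b"
      using AE_good
    proof eventually_elim
      case (elim z)
      show ?case
        using LIMSEQ_ignore_initial_segment[OF GDERIV_quotient_tendsto[OF GDERIV_good[OF elim x], of b], of K]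
        by (simp only: sgrad_eq_gradient[OF elim x] inner_commute)
    qed
    show "AE z in P. norm (?q (k + K) z) \<le> \<bar>ell z\<bar> * norm b" for k
      using AE_space unfolding real_norm_def
      by eventually_elim (rule quotient_bound[OF x], assumption, rule K, simp)
  qed (use abs_ell_integrable in auto)
  moreover have "(\<lambda>k. LINT z|P. ?q (k + K) z) \<longlonglongrightarrow> b \<bullet> gradient gbar x"
  proof -
    have eq: "(LINT z|P. ?q k z) = (gbar (x + (1 / real (Suc k)) *\<^sub>R b) - gbar x) * real (Suc k)" for k
      by (simp add: expected_loss_def g_integrable)
    have "GDERIV gbar x :> gradient gbar x"
      by (rule GDERIV_gradient) (use smooth in \<open>simp add: L_smooth_def\<close>)
    from LIMSEQ_ignore_initial_segment[OF GDERIV_quotient_tendsto[OF this, of b], of K]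
    show ?thesis unfolding eq .
  qed
  ultimately have "(LINT z|P. sgrad x z \<bullet> b) = b \<bullet> gradient gbar x" by (rule LIMSEQ_unique)
  then show ?thesis by (simp only: inner_commute)
qed

section \<open>Moments of the averaged gradient error\<close>

definition grad_dev :: "'a \<Rightarrow> 'z \<Rightarrow> 'a" where
  "grad_dev x z = sgrad x z - gradient gbar x"

lemma gradient_gbar_measurable [measurable]: "gradient gbar \<in> borel_measurable borel"
  using smooth unfolding L_smooth_def
  by (intro borel_measurable_continuous_onI lipschitz_on_continuous_on) auto

lemma grad_dev_measurable [measurable]:
  assumes [measurable]: "f \<in> borel_measurable N" "k \<in> measurable N P"
  shows "(\<lambda>\<omega>. grad_dev (f \<omega>) (k \<omega>)) \<in> borel_measurable N"
  unfolding grad_dev_def by measurable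

lemma sgrad_square_integrable:
  assumes x: "x \<in> C"
  shows "integrable P (\<lambda>z. (norm (sgrad x z))\<^sup>2)" "(LINT z|P. (norm (sgrad x z))\<^sup>2) \<le> lbar\<^sup>2"
proof -
  have le: "AE z in P. (norm (sgrad x z))\<^sup>2 \<le> (ell z)\<^sup>2"
    using AE_good by eventually_elim (metis norm_sgrad_le[OF _ x] norm_ge_zero power2_abs power_mono)
  show i: "integrable P (\<lambda>z. (norm (sgrad x z))\<^sup>2)"
    by (rule Bochner_Integration.integrable_bound[OF ell_square_integrable]) (use le in auto)
  show "(LINT z|P. (norm (sgrad x z))\<^sup>2) \<le> lbar\<^sup>2"
    using integral_mono_AE[OF i ell_square_integrable le] integral_ell_square by simp
qed

text \<open>The variance is the second moment minus the squared norm of the mean; unbiasedness in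
  the direction \<open>?D\<close> evaluates the mixed term.\<close>

lemma grad_dev_moments:
  assumes x: "x \<in> C"
  shows "integrable P (\<lambda>z. grad_dev x z \<bullet> b)" "(LINT z|P. grad_dev x z \<bullet> b) = 0"
    "integrable P (\<lambda>z. (norm (grad_dev x z))\<^sup>2)" "(LINT z|P. (norm (grad_dev x z))\<^sup>2) \<le> lbar\<^sup>2"
proof -
  let ?D = "gradient gbar x"
  show "integrable P (\<lambda>z. grad_dev x z \<bullet> b)" "(LINT z|P. grad_dev x z \<bullet> b) = 0"
    using sgrad_inner_integrable[OF x, of b] expected_sgrad[OF x, of b]
    by (auto simp: grad_dev_def inner_diff_left prob_space)
  have eq: "(norm (grad_dev x z))\<^sup>2 = (norm (sgrad x z))\<^sup>2 - 2 * (sgrad x z \<bullet> ?D) + (norm ?D)\<^sup>2" for z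
    unfolding grad_dev_def power2_norm_eq_inner inner_diff_left inner_diff_right
    by (simp add: inner_commute)
  show "integrable P (\<lambda>z. (norm (grad_dev x z))\<^sup>2)"
    unfolding eq using sgrad_inner_integrable[OF x] sgrad_square_integrable(1)[OF x] by auto
  have "(LINT z|P. (norm (grad_dev x z))\<^sup>2) = (LINT z|P. (norm (sgrad x z))\<^sup>2) - 2 * (?D \<bullet> ?D) + (norm ?D)\<^sup>2"
    unfolding eq using sgrad_inner_integrable[OF x] sgrad_square_integrable(1)[OF x]
    by (simp add: expected_sgrad[OF x] prob_space)
  also have "\<dots> = (LINT z|P. (norm (sgrad x z))\<^sup>2) - (norm ?D)\<^sup>2"
    by (simp only: dot_square_norm)
  also have "\<dots> \<le> (LINT z|P. (norm (sgrad x z))\<^sup>2)" by simp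
  also have "\<dots> \<le> lbar\<^sup>2" by (rule sgrad_square_integrable(2)[OF x])
  finally show "(LINT z|P. (norm (grad_dev x z))\<^sup>2) \<le> lbar\<^sup>2" .
qed

text \<open>With coordinate \<open>j\<close> held fixed, the deviation at the resampled coordinate
  \<open>i\<close> has mean zero.\<close>

lemma grad_dev_orthogonal:
  assumes x: "x \<in> C" and ij: "i \<noteq> j"
  shows "integrable S (\<lambda>z. grad_dev x (z i) \<bullet> grad_dev x (z j))"
    "(LINT z|S. grad_dev x (z i) \<bullet> grad_dev x (z j)) = 0"
proof -
  show i: "integrable S (\<lambda>z. grad_dev x (z i) \<bullet> grad_dev x (z j))"
  proof (rule Bochner_Integration.integrable_bound)
    show "integrable S (\<lambda>z. ((norm (grad_dev x (z i)))\<^sup>2 + (norm (grad_dev x (z j)))\<^sup>2) / 2)"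
      using integrable_iid_component[OF grad_dev_moments(3)[OF x], of i]
        integrable_iid_component[OF grad_dev_moments(3)[OF x], of j] by simp
    have "\<bar>a \<bullet> b\<bar> \<le> ((norm a)\<^sup>2 + (norm b)\<^sup>2) / 2" for a b :: 'a
      using Cauchy_Schwarz_ineq2[of a b] abs_mult_le_half_squares[of "norm a" "norm b"] by simp
    then show "AE z in S. norm (grad_dev x (z i) \<bullet> grad_dev x (z j))
        \<le> norm (((norm (grad_dev x (z i)))\<^sup>2 + (norm (grad_dev x (z j)))\<^sup>2) / 2)" by simp
  qed measurable
  have "(LINT z|S. grad_dev x (z i) \<bullet> grad_dev x (z j))
    = (LINT z|S. (LINT z'|S. grad_dev x (merge_on {j} z z' i) \<bullet> grad_dev x (merge_on {j} z z' j)))"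
    by (rule integral_merge_on[OF i])
  also have "\<dots> = (LINT z|S. (LINT z'|S. grad_dev x (z' i) \<bullet> grad_dev x (z j)))"
    using ij by (simp add: merge_on_def)
  also have "\<dots> = 0"
    by (simp add: integral_iid_component[OF grad_dev_moments(1)[OF x]] grad_dev_moments(2)[OF x])
  finally show "(LINT z|S. grad_dev x (z i) \<bullet> grad_dev x (z j)) = 0" .
qed

definition grad_error :: "nat \<Rightarrow> 'a \<Rightarrow> (nat \<Rightarrow> 'z) \<Rightarrow> 'a" where
  "grad_error n x z = (1 / real n) *\<^sub>R (\<Sum>i<n. grad_dev x (z i))"

lemma grad_error_measurable [measurable]:
  "(\<lambda>(x, z). grad_error n x z) \<in> borel_measurable (borel \<Otimes>\<^sub>M S)"
  unfolding grad_error_def by measurable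

lemma expected_grad_error:
  assumes x: "x \<in> C" and n: "0 < n"
  shows "integrable S (\<lambda>z. (norm (grad_error n x z))\<^sup>2)"
    "(LINT z|S. (norm (grad_error n x z))\<^sup>2) \<le> lbar\<^sup>2 / real n"
proof -
  let ?Y = "\<lambda>i z. grad_dev x (z i)"
  have eq: "(norm (grad_error n x z))\<^sup>2 = (\<Sum>i<n. \<Sum>j<n. ?Y i z \<bullet> ?Y j z) / (real n)\<^sup>2" for z
  proof -
    have "(norm (\<Sum>i<n. ?Y i z))\<^sup>2 = (\<Sum>i<n. ?Y i z \<bullet> (\<Sum>j<n. ?Y j z))"
      unfolding power2_norm_eq_inner by (rule inner_sum_left)
    then show ?thesis by (simp add: grad_error_def power_divide inner_sum_right)
  qed
  have sq: "integrable S (\<lambda>z. ?Y i z \<bullet> ?Y i z)" "(LINT z|S. ?Y i z \<bullet> ?Y i z) \<le> lbar\<^sup>2" for i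
    using integrable_iid_component[OF grad_dev_moments(3)[OF x], of i]
      integral_iid_component[OF grad_dev_moments(3)[OF x], of i] grad_dev_moments(4)[OF x]
    by (auto simp: dot_square_norm)
  have int: "integrable S (\<lambda>z. ?Y i z \<bullet> ?Y j z)" for i j
    using sq(1) grad_dev_orthogonal(1)[OF x] by (cases "i = j") auto
  show "integrable S (\<lambda>z. (norm (grad_error n x z))\<^sup>2)"
    unfolding eq by (intro integrable_divide_zero Bochner_Integration.integrable_sum int)
  have "(LINT z|S. (norm (grad_error n x z))\<^sup>2) = (\<Sum>i<n. \<Sum>j<n. LINT z|S. ?Y i z \<bullet> ?Y j z) / (real n)\<^sup>2"
    unfolding eq by (simp add: int)
  also have "(\<Sum>i<n. \<Sum>j<n. LINT z|S. ?Y i z \<bullet> ?Y j z) = (\<Sum>i<n. LINT z|S. ?Y i z \<bullet> ?Y i z)"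
  proof (rule sum.cong)
    fix i assume "i \<in> {..<n}"
    then have "(\<Sum>j<n. LINT z|S. ?Y i z \<bullet> ?Y j z) = (\<Sum>j\<in>{i}. LINT z|S. ?Y i z \<bullet> ?Y j z)"
      by (intro sum.mono_neutral_right) (auto simp: grad_dev_orthogonal(2)[OF x])
    then show "(\<Sum>j<n. LINT z|S. ?Y i z \<bullet> ?Y j z) = (LINT z|S. ?Y i z \<bullet> ?Y i z)" by simp
  qed simp
  also have "\<dots> / (real n)\<^sup>2 \<le> (\<Sum>i<n. lbar\<^sup>2) / (real n)\<^sup>2"
    by (intro divide_right_mono sum_mono sq(2)) simp
  also have "\<dots> = lbar\<^sup>2 / real n" using n by (simp add: power2_eq_square)
  finally show "(LINT z|S. (norm (grad_error n x z))\<^sup>2) \<le> lbar\<^sup>2 / real n" .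
qed

text \<open>The 12 mirrors the sample size of the algorithm: 3 for Markov's inequality times 4 from
  its variance bound \<open>4 * lbar\<^sup>2\<close>.\<close>

lemma prob_grad_error_le:
  assumes x: "x \<in> C" and r: "0 < r" and n: "12 * lbar\<^sup>2 / r \<le> real n"
  shows "measure S {z\<in>space S. r < (norm (grad_error n x z))\<^sup>2} \<le> 1 / 3"
proof -
  have "0 < 12 * lbar\<^sup>2 / r" using r lbar_pos by simp
  with n have n0: "0 < real n" by linarith
  have "12 * lbar\<^sup>2 \<le> real n * r" using n r pos_divide_le_eq by blast
  moreover have "3 * lbar\<^sup>2 \<le> 12 * lbar\<^sup>2" by simp
  ultimately have "3 * lbar\<^sup>2 \<le> real n * r" by linarith
  then have le: "lbar\<^sup>2 / real n \<le> r / 3"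
    using n0 by (subst pos_divide_le_eq) (auto simp: ac_simps)
  have "measure S {z\<in>space S. r < (norm (grad_error n x z))\<^sup>2}
      \<le> measure S {z\<in>space S. r \<le> (norm (grad_error n x z))\<^sup>2}"
    by (intro S.finite_measure_mono) auto
  also have "\<dots> \<le> (LINT z|S. (norm (grad_error n x z))\<^sup>2) / r"
    using r n0 by (intro integral_Markov_inequality_measure[where A = "{}"] expected_grad_error[OF x]) auto
  also have "\<dots> \<le> (r / 3) / r"
    using order_trans[OF expected_grad_error(2)[OF x] le] r n0 by (intro divide_right_mono) auto
  finally show ?thesis using r by simp
qed

text \<open>With \<open>K = L + p\<close>, \<open>r\<^sup>2 = 2 e / (\<mu> + p)\<close> and \<open>E = K r\<^sup>2\<close>: good points lie within \<open>r\<close> of the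
  minimizer \<open>xb\<close>, points of the first index set within \<open>3 r\<close>, and \<open>v\<close> is within \<open>6 K r\<close> of the gradient
  \<open>D\<close> of the smooth part at \<open>xb\<close>.  Hence good points have pseudodistance at most
  \<open>3/2 E + 6 E\<close> from \<open>xb\<close>, points of the second index set at most three times that, and the gap is at most
  \<open>45/2 E + 18 E + 9 E = 99/2 E\<close>.\<close>

lemma gap_estimate:
  assumes p: "0 \<le> p" and e: "0 < e" and m: "0 < m"
    and uC: "\<And>k. k < m \<Longrightarrow> u k \<in> C"
    and maj: "real m / 2 < real (card {k. k < m \<and> prox_objective p x (u k) \<le> prox_objective p x (prox p x) + e})"
    and i0: "i0 \<in> Extract (\<lambda>x x'. norm (x - x')) m u"
    and i1: "i \<in> Extract (\<lambda>x x'. norm (x - x')) m u"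
    and i2: "i \<in> Extract (gap_pseudometric h v) m u"
    and v: "norm (v - (gradient gbar (u i0) + p *\<^sub>R (u i0 - x))) \<le> 3 * ((L + p) * sqrt (2 * e / (\<mu> + p)))"
  shows "u i \<in> C" "prox_objective p x (u i) \<le> prox_objective p x (prox p x) + 99 * ((L + p) / (\<mu> + p)) * e"
proof -
  interpret N: pseudometric "\<lambda>x x'::'a. norm (x - x')" by (rule pseudometric_norm)
  interpret G: pseudometric "gap_pseudometric h v" by (rule pseudometric_gap)
  let ?F = "prox_objective p x"
  define xb where "xb = prox p x"
  define r where "r = sqrt (2 * e / (\<mu> + p))"
  define K where "K = L + p"
  define E where "E = K * r\<^sup>2"
  define D where "D = gradient gbar xb + p *\<^sub>R (xb - x)"
  have nu: "0 < \<mu> + p" using mu_pos p by simp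
  have K: "0 < K" "\<mu> + p \<le> K" using mu_pos mu_le_L p by (auto simp: K_def)
  have r0: "0 < r" using e nu by (simp add: r_def)
  have r2: "r\<^sup>2 = 2 * e / (\<mu> + p)" using e nu by (simp add: r_def)
  have E: "E = 2 * (K / (\<mu> + p) * e)" by (simp add: E_def r2)
  have "1 * e \<le> K / (\<mu> + p) * e" using K nu e by (intro mult_right_mono) (auto simp: pos_le_divide_eq)
  \<comment> \<open>A condition number of at least 1 lets the plain error \<open>e\<close> be
    absorbed into \<open>E\<close>.\<close>
  then have eE: "2 * e \<le> E" by (simp add: E)
  have xbC: "xb \<in> C" unfolding xb_def by (rule prox_minimizes(1)[OF p])
  have growth: "?F xb + (\<mu> + p) / 2 * (norm (y - xb))\<^sup>2 \<le> ?F y" if "y \<in> C" for y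
    unfolding xb_def by (rule prox_minimizes(2)[OF p that])
  have min: "?F xb \<le> ?F y" if "y \<in> C" for y
  proof -
    have "0 \<le> (\<mu> + p) / 2 * (norm (y - xb))\<^sup>2" using nu by simp
    with growth[OF that] show ?thesis by linarith
  qed
  have near: "norm (y - xb) \<le> r" if "y \<in> C" "?F y \<le> ?F xb + e" for y
    unfolding r_def
  proof (rule real_le_rsqrt)
    have "(\<mu> + p) / 2 * (norm (y - xb))\<^sup>2 \<le> e" using growth[OF that(1)] that(2) by linarith
    then show "(norm (y - xb))\<^sup>2 \<le> 2 * e / (\<mu> + p)" using nu by (simp add: pos_le_divide_eq ac_simps)
  qed
  have rem: "\<bar>(?F y - hr y) - (?F xb - hr xb) - D \<bullet> (y - xb)\<bar> \<le> K * (norm (y - xb))\<^sup>2" for y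
  proof -
    have "(norm (y - x))\<^sup>2 = (norm (xb - x))\<^sup>2 + 2 * ((xb - x) \<bullet> (y - xb)) + (norm (y - xb))\<^sup>2"
      unfolding power2_norm_eq_inner by (simp add: inner_diff_left inner_diff_right inner_commute)
    then have "p / 2 * (norm (y - x))\<^sup>2
        = p / 2 * ((norm (xb - x))\<^sup>2 + 2 * ((xb - x) \<bullet> (y - xb)) + (norm (y - xb))\<^sup>2)"
      by (simp only:)
    also have "\<dots> = p / 2 * (norm (xb - x))\<^sup>2 + p * ((xb - x) \<bullet> (y - xb)) + p / 2 * (norm (y - xb))\<^sup>2"
      by (simp add: distrib_left)
    finally have "p / 2 * (norm (y - x))\<^sup>2
        = p / 2 * (norm (xb - x))\<^sup>2 + p * ((xb - x) \<bullet> (y - xb)) + p / 2 * (norm (y - xb))\<^sup>2" .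
    moreover have "D \<bullet> (y - xb) = gradient gbar xb \<bullet> (y - xb) + p * ((xb - x) \<bullet> (y - xb))"
      by (simp only: D_def inner_add_left inner_scaleR_left)
    ultimately have "(?F y - hr y) - (?F xb - hr xb) - D \<bullet> (y - xb)
      = (gbar y - gbar xb - gradient gbar xb \<bullet> (y - xb)) + p / 2 * (norm (y - xb))\<^sup>2"
      unfolding prox_objective_def by linarith
    moreover have "\<bar>gbar y - gbar xb - gradient gbar xb \<bullet> (y - xb)\<bar> \<le> L * (norm (y - xb))\<^sup>2"
      by (rule L_smooth_remainder[OF smooth])
    moreover have "0 \<le> p / 2 * (norm (y - xb))\<^sup>2" "p / 2 * (norm (y - xb))\<^sup>2 \<le> p * (norm (y - xb))\<^sup>2"
      using p by (auto intro!: mult_right_mono)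
    ultimately show ?thesis unfolding K_def distrib_right by linarith
  qed
  have majN: "real m / 2 < real (card {k. k < m \<and> norm (u k - xb) \<le> r})"
  proof -
    have "card {k. k < m \<and> ?F (u k) \<le> ?F (prox p x) + e} \<le> card {k. k < m \<and> norm (u k - xb) \<le> r}"
      using near uC by (intro card_mono) (auto simp: xb_def)
    then show ?thesis using maj by linarith
  qed
  have xh: "i0 < m" "norm (u i0 - xb) \<le> 3 * r"
    using N.Extract_near[OF majN _ m i0] r0 by auto
  have ui: "i < m" "norm (u i - xb) \<le> 3 * r"
    using N.Extract_near[OF majN _ m i1] r0 by auto
  show uiC: "u i \<in> C" by (rule uC[OF ui(1)])
  \<comment> \<open>Half of this is the estimation error at \<open>u i0\<close>, the other half the
    change of the gradient between \<open>u i0\<close> and \<open>xb\<close>.\<close>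
  have vD: "norm (v - D) \<le> 6 * K * r"
  proof -
    have "norm (gradient gbar (u i0) - gradient gbar xb) \<le> L * norm (u i0 - xb)"
      using smooth lipschitz_onD[of L UNIV "gradient gbar" "u i0" xb] by (simp add: L_smooth_def dist_norm)
    moreover have "norm (p *\<^sub>R (u i0 - xb)) = p * norm (u i0 - xb)" using p by simp
    moreover have Deq: "(gradient gbar (u i0) + p *\<^sub>R (u i0 - x)) - D
        = (gradient gbar (u i0) - gradient gbar xb) + p *\<^sub>R (u i0 - xb)"
      by (simp add: D_def algebra_simps)
    ultimately have "norm ((gradient gbar (u i0) + p *\<^sub>R (u i0 - x)) - D) \<le> K * norm (u i0 - xb)"
      using norm_triangle_ineq[of "gradient gbar (u i0) - gradient gbar xb" "p *\<^sub>R (u i0 - xb)"]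
      unfolding Deq K_def distrib_right by linarith
    also have "\<dots> \<le> K * (3 * r)" using xh K by (intro mult_left_mono) auto
    finally have "norm ((gradient gbar (u i0) + p *\<^sub>R (u i0 - x)) - D) \<le> 3 * (K * r)" by simp
    moreover have "norm (v - (gradient gbar (u i0) + p *\<^sub>R (u i0 - x))) \<le> 3 * (K * r)"
      using v by (simp add: K_def r_def)
    ultimately show ?thesis
      using norm_triangle_ineq[of "v - (gradient gbar (u i0) + p *\<^sub>R (u i0 - x))"
          "(gradient gbar (u i0) + p *\<^sub>R (u i0 - x)) - D"]
      unfolding diff_add_cancel add_diff_eq by linarith
  qed
  have inner: "\<bar>(v - D) \<bullet> (y - xb)\<bar> \<le> 6 * K * r * norm (y - xb)" for y
    by (rule order_trans[OF Cauchy_Schwarz_ineq2]) (intro mult_right_mono vD norm_ge_zero)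
  \<comment> \<open>The gap with the smooth part linearized at \<open>xb\<close>: by
    \<open>rem\<close> it differs from the true gap by at most \<open>K\<close> times the squared
    distance, and \<open>gap_pseudometric\<close> sees it up to the error of
    \<open>v\<close>.\<close>
  define \<Delta> where "\<Delta> y = hr y - hr xb + D \<bullet> (y - xb)" for y
  have gap_eq: "gap_pseudometric h v y xb = \<bar>\<Delta> y + (v - D) \<bullet> (y - xb)\<bar>" for y
    by (simp add: gap_pseudometric_def \<Delta>_def hr_def inner_diff_left)
  have majG: "real m / 2 < real (card {k. k < m \<and> gap_pseudometric h v (u k) xb \<le> 15 / 2 * E})"
  proof -
    have "gap_pseudometric h v (u k) xb \<le> 15 / 2 * E" if k: "k < m" "?F (u k) \<le> ?F xb + e" for k
    proof -
      have nk: "norm (u k - xb) \<le> r" by (rule near[OF uC[OF k(1)] k(2)])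
      then have "K * (norm (u k - xb))\<^sup>2 \<le> E" unfolding E_def
        using K by (intro mult_left_mono power_mono) auto
      moreover have "6 * K * r * norm (u k - xb) \<le> 6 * K * r * r" using nk K r0 by (intro mult_left_mono) auto
      moreover have "6 * K * r * r = 6 * E" by (simp add: E_def power2_eq_square)
      ultimately show ?thesis
        unfolding gap_eq using rem[of "u k"] inner[of "u k"] k(2) min[OF uC[OF k(1)]] eE unfolding \<Delta>_def by linarith
    qed
    then have "card {k. k < m \<and> ?F (u k) \<le> ?F (prox p x) + e} \<le> card {k. k < m \<and> gap_pseudometric h v (u k) xb \<le> 15 / 2 * E}"
      by (intro card_mono) (auto simp: xb_def)
    then show ?thesis using maj by linarith
  qed
  have "gap_pseudometric h v (u i) xb \<le> 3 * (15 / 2 * E)"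
    using G.Extract_near(2)[OF majG _ m i2] eE e by auto
  moreover have "K * (norm (u i - xb))\<^sup>2 \<le> K * (3 * r)\<^sup>2"
    using K ui by (intro mult_left_mono power_mono) auto
  moreover have "K * (3 * r)\<^sup>2 = 9 * E" by (simp add: E_def power_mult_distrib)
  moreover have "6 * K * r * norm (u i - xb) \<le> 6 * K * r * (3 * r)" using ui K r0 by (intro mult_left_mono) auto
  moreover have "6 * K * r * (3 * r) = 18 * E" by (simp add: E_def power2_eq_square)
  ultimately have "?F (u i) \<le> ?F xb + 99 / 2 * E"
    using rem[of "u i"] inner[of "u i"] unfolding gap_eq \<Delta>_def by linarith
  moreover have "99 / 2 * E = 99 * (K / (\<mu> + p)) * e" unfolding E by simp
  ultimately show "?F (u i) \<le> ?F (prox p x) + 99 * ((L + p) / (\<mu> + p)) * e"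
    unfolding K_def xb_def by linarith
qed

end

section \<open>The boosting iteration\<close>

text \<open>In this locale \<open>'a\<close> is the type of samples and \<open>'b\<close> the type
  of points.\<close>

locale boost_run = stochastic_composite +
  fixes \<delta> :: real and lam :: "nat \<Rightarrow> real" and T m :: nat and c :: "'a choices"
  assumes delta_pos: "0 < \<delta>" and lam0: "0 \<le> lam 0" and lam_mono: "\<And>i. i < T \<Longrightarrow> lam i \<le> lam (Suc i)"
    and nonanticipating: "nonanticipating P T c"
    and valid: "valid_choices P g h lbar \<mu> L \<delta> lam T m c"
begin

abbreviation Q :: "'a samples measure" where "Q \<equiv> sample_space P"

abbreviation pp :: "nat \<Rightarrow> real" where "pp \<equiv> prev_pen lam"

text \<open>The accuracy asked of a single call. The 9 compensates the majority rule, which triples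
  distances and so multiplies squared distances by 9.\<close>

definition tol :: "nat \<Rightarrow> real" where
  "tol j = (if j \<le> T then \<delta> / 9 else gap_eps \<mu> L \<delta> (lam T))"

definition nsamp :: "nat \<Rightarrow> nat" where
  "nsamp j = nat \<lceil>6 * lbar\<^sup>2 / ((\<mu> + pp j) * tol j)\<rceil>"

text \<open>Measurable versions of the iterates, which agree with \<open>boost_x\<close> almost surely.  The index is
  continued beyond \<open>T + 1\<close>: \<open>X w (T + 2)\<close> is the base point of the gradient estimates.\<close>

primrec X :: "'a samples \<Rightarrow> nat \<Rightarrow> 'b" where
  "X w 0 = 0"
| "X w (Suc j) = yhat (nsamp j) (pp j) (X w j) (stream_of j (c j w) w)"

definition Y :: "'a samples \<Rightarrow> nat \<Rightarrow> nat \<Rightarrow> 'b" where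
  "Y w j k = yhat (nsamp j) (pp j) (X w j) (stream_of j k w)"

lemma X_Suc: "X w (Suc j) = Y w j (c j w)"
  by (simp add: Y_def)

lemma lam_nonneg: "i \<le> T \<Longrightarrow> 0 \<le> lam i"
proof (induction i)
  case (Suc i) then show ?case using lam_mono[of i] by simp
qed (rule lam0)

lemma pp_nonneg: "j \<le> Suc T \<Longrightarrow> 0 \<le> pp j"
  by (cases j) (auto simp: prev_pen_def lam_nonneg)

lemma pp_simps [simp]: "pp 0 = 0" "pp (Suc j) = lam j"
  by (auto simp: prev_pen_def)

lemma tol_pos: "0 < tol j"
  using delta_pos mu_pos mu_le_L lam_nonneg[of T] by (auto simp: tol_def gap_eps_def)

lemma nsamp_pos: "j \<le> Suc T \<Longrightarrow> 0 < nsamp j"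
  unfolding nsamp_def by (rule prob_excess_le(1)[OF pp_nonneg tol_pos])

lemma Q_eq: "Q = PiM UNIV (\<lambda>_. P)"
  by (simp add: sample_space_def)

sublocale Q: prob_space Q unfolding Q_eq by (rule prob_space_iid)

lemma stream_measurable [measurable]: "(\<lambda>w. stream_of s k w) \<in> measurable Q S"
  unfolding Q_eq by (rule measurable_reindex)

lemma c_measurable: "j \<le> T + 2 \<Longrightarrow> c j \<in> measurable Q (count_space UNIV)"
  using nonanticipating by (auto simp: nonanticipating_def)

lemma X_measurable: "j \<le> T + 2 \<Longrightarrow> (\<lambda>w. X w j) \<in> borel_measurable Q"
proof (induction j)
  case (Suc j)
  then have [measurable]: "(\<lambda>w. X w j) \<in> borel_measurable Q" "c j \<in> measurable Q (count_space UNIV)"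
    using c_measurable[of j] by auto
  have "(\<lambda>w. yhat (nsamp j) (pp j) (X w j) (stream_of j k w)) \<in> borel_measurable Q" for k
  proof -
    have "(\<lambda>w. (X w j, stream_of j k w)) \<in> measurable Q (borel \<Otimes>\<^sub>M S)"
      by (intro measurable_Pair stream_measurable) measurable
    from measurable_compose[OF this yhat_measurable[of "nsamp j" "pp j"]] show ?thesis by simp
  qed
  then show ?case
    \<comment> \<open>The selected index takes countably many values, so measurability for each
      fixed repetition suffices.\<close>
    unfolding X.simps by (rule measurable_compose_countable) measurable
qed simp

text \<open>Here \<open>nonanticipating\<close> makes the samples of stage \<open>j\<close> fresh
  relative to the center of that stage.\<close>

lemma X_past:
  "j \<le> T + 2 \<Longrightarrow> w \<in> space Q \<Longrightarrow> w' \<in> space Q \<Longrightarrow>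
    (\<forall>i<j. \<forall>k l. w (i, k, l) = w' (i, k, l)) \<Longrightarrow> X w j = X w' j"
proof (induction j)
  case (Suc j)
  have "c j w = c j w'"
    by (rule nonanticipating[unfolded nonanticipating_def, rule_format, THEN conjunct2, rule_format])
      (use Suc.prems in auto)
  moreover have "X w j = X w' j" using Suc by auto
  moreover have "stream_of j k w = stream_of j k w'" for k using Suc.prems by auto
  ultimately show ?case by simp
qed simp

definition ngrad :: nat where
  "ngrad = nat \<lceil>3 * (4 * lbar\<^sup>2) / (((L + lam T) / (\<mu> + lam T))\<^sup>2 * (\<mu> + lam T) * gap_eps \<mu> L \<delta> (lam T))\<rceil>"

text \<open>The squared accuracy asked of a single gradient estimate; \<open>ngrad\<close> is
  \<open>12 * lbar\<^sup>2 / rgrad\<close> rounded up.\<close>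

definition rgrad :: real where
  "rgrad = ((L + lam T) / (\<mu> + lam T))\<^sup>2 * (\<mu> + lam T) * gap_eps \<mu> L \<delta> (lam T)"

text \<open>Both kinds of failure are phrased for a center and a stream of samples, so that one
  probability estimate covers all stages.\<close>

definition fail :: "nat \<Rightarrow> ('b \<times> (nat \<Rightarrow> 'a)) set" where
  "fail j = (if j \<le> Suc T then {(x, z). z \<in> space S \<and> tol j < excess (nsamp j) (pp j) x z}
     else {(x, z). z \<in> space S \<and> rgrad < (norm (grad_error ngrad x z))\<^sup>2})"

definition bad :: "nat \<Rightarrow> 'a samples set" where
  "bad j = {w \<in> space Q. real m / 2 \<le> real (card {k. k < m \<and> (X w j, stream_of j k w) \<in> fail j})}"

lemma AE_all_good: "AE w in Q. \<forall>p. good (w p)"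
  unfolding Q_eq AE_all_countable
  using AE_good by (auto intro!: AE_PiM_component[where M = "\<lambda>_. P"] prob_space_axioms)

lemma Y_in_dom: "j \<le> Suc T \<Longrightarrow> \<forall>p. good (w p) \<Longrightarrow> Y w j k \<in> C"
  unfolding Y_def by (rule yhat_minimizes(1)[OF pp_nonneg nsamp_pos]) auto

lemma rgrad_pos: "0 < rgrad"
  using mu_pos mu_le_L lam_nonneg[of T] delta_pos by (auto simp: rgrad_def gap_eps_def)

lemma prob_bad:
  assumes j: "j \<le> T + 2"
  shows "bad j \<in> sets Q" "measure Q (bad j) \<le> exp (- (real m / 18))"
proof -
  have meas: "fail j \<in> sets (borel \<Otimes>\<^sub>M S)"
  proof -
    have "{p \<in> space (borel \<Otimes>\<^sub>M S). tol j < (case p of (x, z) \<Rightarrow> excess (nsamp j) (pp j) x z)} \<in> sets (borel \<Otimes>\<^sub>M S)"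
      by measurable
    moreover have "{p \<in> space (borel \<Otimes>\<^sub>M S). rgrad < (norm (case p of (x, z) \<Rightarrow> grad_error ngrad x z))\<^sup>2} \<in> sets (borel \<Otimes>\<^sub>M S)"
      by measurable
    moreover have "fail j = (if j \<le> Suc T
      then {p \<in> space (borel \<Otimes>\<^sub>M S). tol j < (case p of (x, z) \<Rightarrow> excess (nsamp j) (pp j) x z)}
      else {p \<in> space (borel \<Otimes>\<^sub>M S). rgrad < (norm (case p of (x, z) \<Rightarrow> grad_error ngrad x z))\<^sup>2})"
      by (auto simp: fail_def space_pair_measure)
    ultimately show ?thesis by simp
  qed
  have le: "AE w in Q. measure S {z\<in>space S. (X w j, z) \<in> fail j} \<le> 1 / 3"
  proof (cases "j \<le> Suc T")
    case True
    have "{z\<in>space S. (x, z) \<in> fail j} = {z\<in>space S. tol j < excess (nsamp j) (pp j) x z}" for x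
      using True by (auto simp: fail_def)
    then show ?thesis
      using prob_excess_le(2)[OF pp_nonneg[OF True] tol_pos[of j]] by (simp add: nsamp_def)
  next
    case False
    have eq: "{z\<in>space S. (x, z) \<in> fail j} = {z\<in>space S. rgrad < (norm (grad_error ngrad x z))\<^sup>2}" for x
      using False by (auto simp: fail_def)
    have n: "12 * lbar\<^sup>2 / rgrad \<le> real ngrad" unfolding ngrad_def rgrad_def
      using real_nat_ceiling_ge[of "3 * (4 * lbar\<^sup>2) / (((L + lam T) / (\<mu> + lam T))\<^sup>2 * (\<mu> + lam T) * gap_eps \<mu> L \<delta> (lam T))"]
      by simp
    show ?thesis
      using AE_all_good
    proof eventually_elim
      case (elim w)
      \<comment> \<open>The gradient moments are available only at points of \<open>C\<close>, and
        the base point lies in \<open>C\<close> when the samples are good; hence a bound that holds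
        almost everywhere.\<close>
      obtain j' where j': "j = Suc j'" "j' \<le> Suc T" using False j by (cases j) auto
      have "X w j \<in> C" unfolding j'(1) X_Suc by (rule Y_in_dom[OF j'(2) elim])
      then show ?case unfolding eq by (rule prob_grad_error_le[OF _ rgrad_pos n])
    qed
  qed
  show "bad j \<in> sets Q" "measure Q (bad j) \<le> exp (- (real m / 18))"
    unfolding bad_def
    by (rule prob_minority_bad_stage[OF X_measurable[OF j] meas _ le]; rule X_past[OF j]; assumption)+
qed

section \<open>Agreement with the iterates of the algorithm on good samples\<close>

lemma stage_erm_eq_yhat:
  assumes "j \<le> T" "\<forall>i. good (z i)"
  shows "stage_erm g h lbar \<mu> \<delta> lam j x z = yhat (nsamp j) (pp j) x z"
proof -
  have "54 * lbar\<^sup>2 / ((\<mu> + pp j) * \<delta>) = 6 * lbar\<^sup>2 / ((\<mu> + pp j) * tol j)"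
    using assms(1) by (simp add: tol_def)
  then show ?thesis
    unfolding stage_erm_def nsamp_def using assms pp_nonneg[of j] nsamp_pos[of j]
    by (subst ERM_eq_yhat) (auto simp: nsamp_def)
qed

lemma boost_x_eq: "j \<le> Suc T \<Longrightarrow> \<forall>p. good (w p) \<Longrightarrow> boost_x g h lbar \<mu> \<delta> lam c w j = X w j"
  by (induction j) (auto simp: stage_erm_eq_yhat)

lemma boost_y_eq: "j \<le> T \<Longrightarrow> \<forall>p. good (w p) \<Longrightarrow> boost_y g h lbar \<mu> \<delta> lam c w j = Y w j"
  by (rule ext) (auto simp: boost_y_def Y_def boost_x_eq stage_erm_eq_yhat)

lemma boost_u_eq: "\<forall>p. good (w p) \<Longrightarrow> boost_u g h lbar \<mu> L \<delta> lam T c w = Y w (Suc T)"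
proof
  fix k assume good: "\<forall>p. good (w p)"
  have "tol (Suc T) = gap_eps \<mu> L \<delta> (lam T)" by (simp add: tol_def)
  then show "boost_u g h lbar \<mu> L \<delta> lam T c w k = Y w (Suc T) k"
    unfolding boost_u_def Y_def boost_x_eq[OF order_refl good]
    using good lam_nonneg[of T] nsamp_pos[of "Suc T"]
    by (subst ERM_eq_yhat) (auto simp: nsamp_def)
qed

lemma ngrad_pos: "0 < ngrad"
proof -
  have "0 < 3 * (4 * lbar\<^sup>2) / rgrad" using rgrad_pos lbar_pos by simp
  then show ?thesis by (simp add: ngrad_def rgrad_def)
qed

text \<open>The penalty gradient is the same for every sample, so averaging leaves it unchanged and
  the error is that of the gradients of \<open>g\<close> alone.\<close>

lemma boost_v_eq:
  assumes good: "\<forall>p. good (w p)"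
  defines "xh \<equiv> X w (T + 2)"
  shows "boost_v g h lbar \<mu> L \<delta> lam T c w k - (gradient gbar xh + lam T *\<^sub>R (xh - X w (Suc T)))
    = grad_error ngrad xh (stream_of (T + 2) k w)"
proof -
  have xh: "boost_u g h lbar \<mu> L \<delta> lam T c w (c (T + 1) w) = xh"
    unfolding xh_def boost_u_eq[OF good] by (simp add: X_Suc del: X.simps)
  have xhC: "xh \<in> C" unfolding xh_def using Y_in_dom[OF order_refl good] by (simp add: X_Suc del: X.simps)
  have "boost_v g h lbar \<mu> L \<delta> lam T c w k
    = (1 / real ngrad) *\<^sub>R (\<Sum>i<ngrad. gradient (\<lambda>x. g x (w (T + 2, k, i))) xh + lam T *\<^sub>R (xh - X w (Suc T)))"
    unfolding boost_v_def gradient_estimate_def Let_def xh boost_x_eq[OF order_refl good] ngrad_def[symmetric] ..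
  also have "\<dots> = (1 / real ngrad) *\<^sub>R (\<Sum>i<ngrad. grad_dev xh (w (T + 2, k, i))
      + (gradient gbar xh + lam T *\<^sub>R (xh - X w (Suc T))))"
    using good xhC by (simp add: grad_dev_def sgrad_eq_gradient)
  also have "\<dots> = grad_error ngrad xh (stream_of (T + 2) k w) + (gradient gbar xh + lam T *\<^sub>R (xh - X w (Suc T)))"
    using ngrad_pos by (simp add: sum.distrib scaleR_add_right grad_error_def del: sum_constant add: sum_constant_scaleR)
  finally show ?thesis by simp
qed

section \<open>Deterministic analysis outside the failure events\<close>

abbreviation center :: "'a samples \<Rightarrow> nat \<Rightarrow> 'b" where
  "center w j \<equiv> prox (pp j) (X w j)"

lemma not_bad_majority:
  assumes "w \<in> space Q" "w \<notin> bad j"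
  shows "0 < m" "real m / 2 < real (card {k. k < m \<and> (X w j, stream_of j k w) \<notin> fail j})"
proof -
  let ?B = "{k. k < m \<and> (X w j, stream_of j k w) \<in> fail j}" and ?G = "{k. k < m \<and> (X w j, stream_of j k w) \<notin> fail j}"
  have lt: "real (card ?B) < real m / 2" using assms by (simp add: bad_def)
  then show "0 < m" by (cases m) auto
  have "card ?B + card ?G = card (?B \<union> ?G)" by (rule card_Un_disjoint[symmetric]) auto
  also have "?B \<union> ?G = {..<m}" by auto
  finally show "real m / 2 < real (card ?G)" using lt by simp
qed

lemma stage_majority:
  assumes w: "w \<in> space Q" "w \<notin> bad j" and good: "\<forall>p. good (w p)" and j: "j \<le> Suc T"
  shows "real m / 2 < real (card {k. k < m \<and>
    prox_objective (pp j) (X w j) (Y w j k) \<le> prox_objective (pp j) (X w j) (center w j) + tol j})"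
proof -
  have "prox_objective (pp j) (X w j) (Y w j k) \<le> prox_objective (pp j) (X w j) (center w j) + tol j"
    if "(X w j, stream_of j k w) \<notin> fail j" for k
  proof -
    have "prox_objective (pp j) (X w j) (Y w j k) - prox_objective (pp j) (X w j) (center w j)
        \<le> excess (nsamp j) (pp j) (X w j) (stream_of j k w)"
      unfolding Y_def by (rule suboptimality_le_excess[OF pp_nonneg[OF j] nsamp_pos[OF j]]) (use good in auto)
    moreover have "stream_of j k w \<in> space S" by (rule measurable_space[OF stream_measurable w(1)])
    ultimately show ?thesis using that j by (simp add: fail_def)
  qed
  then have "card {k. k < m \<and> (X w j, stream_of j k w) \<notin> fail j} \<le> card {k. k < m \<and>
      prox_objective (pp j) (X w j) (Y w j k) \<le> prox_objective (pp j) (X w j) (center w j) + tol j}"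
    by (intro card_mono) auto
  then show ?thesis using not_bad_majority(2)[OF w] by linarith
qed

text \<open>Growth turns accuracy \<open>tol j\<close> into squared distance
  \<open>2 * tol j / (\<mu> + pp j)\<close> for a majority of the calls, and the selected one is at
  most three times as far away.\<close>

lemma iterate_near_center:
  assumes w: "w \<in> space Q" "w \<notin> bad j" and good: "\<forall>p. good (w p)" and j: "j \<le> T"
    and c: "most_central (\<lambda>x x'. norm (x - x')) m (Y w j) (c j w)"
  shows "(norm (center w j - X w (Suc j)))\<^sup>2 \<le> 2 * \<delta> / (\<mu> + pp j)"
proof -
  interpret N: pseudometric "\<lambda>x x'::'b. norm (x - x')" by (rule pseudometric_norm)
  have j': "j \<le> Suc T" using j by simp
  have nu: "0 < \<mu> + pp j" using mu_pos pp_nonneg[OF j'] by simp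
  define r where "r = sqrt (2 * tol j / (\<mu> + pp j))"
  have near: "norm (y - center w j) \<le> r"
    if "y \<in> C" "prox_objective (pp j) (X w j) y \<le> prox_objective (pp j) (X w j) (center w j) + tol j" for y
    unfolding r_def
  proof (rule real_le_rsqrt)
    have "(\<mu> + pp j) / 2 * (norm (y - center w j))\<^sup>2 \<le> tol j"
      using prox_minimizes(2)[OF pp_nonneg[OF j'] that(1), of "X w j"] that(2) by linarith
    then show "(norm (y - center w j))\<^sup>2 \<le> 2 * tol j / (\<mu> + pp j)"
      using nu by (simp add: pos_le_divide_eq ac_simps)
  qed
  have "card {k. k < m \<and> prox_objective (pp j) (X w j) (Y w j k) \<le> prox_objective (pp j) (X w j) (center w j) + tol j}
      \<le> card {k. k < m \<and> norm (Y w j k - center w j) \<le> r}"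
    using near Y_in_dom[OF j' good] by (intro card_mono) auto
  then have "real m / 2 < real (card {k. k < m \<and> norm (Y w j k - center w j) \<le> r})"
    using stage_majority[OF w good j'] by linarith
  moreover have "0 \<le> r" using tol_pos[of j] nu by (simp add: r_def)
  ultimately have "norm (Y w j (c j w) - center w j) \<le> 3 * r"
    using N.most_central_near(2)[OF _ _ not_bad_majority(1)[OF w] c] by blast
  then have "(norm (center w j - X w (Suc j)))\<^sup>2 \<le> (3 * r)\<^sup>2"
    unfolding X_Suc by (intro power_mono) (simp_all add: norm_minus_commute)
  also have "\<dots> = 9 * (2 * tol j / (\<mu> + pp j))"
    using tol_pos[of j] nu by (simp add: power_mult_distrib r_def)
  also have "\<dots> = 2 * \<delta> / (\<mu> + pp j)"
  proof -
    have "9 * (2 * (\<delta> / 9) / b) = 2 * \<delta> / b" for b by simp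
    then show ?thesis using j by (simp only: tol_def if_True)
  qed
  finally show ?thesis .
qed

lemma prox_objective_min:
  assumes "0 \<le> p" "y \<in> C"
  shows "prox_objective p x (prox p x) \<le> prox_objective p x y"
proof -
  have "0 \<le> (\<mu> + p) / 2 * (norm (y - prox p x))\<^sup>2" using mu_pos assms(1) by simp
  with prox_minimizes(2)[OF assms, of x] show ?thesis by linarith
qed

text \<open>The penalty stays on the left: intermediate stages drop it, but the last stage needs the
  regularized minimum.\<close>

lemma center_step:
  assumes w: "w \<in> space Q" "w \<notin> bad j" and good: "\<forall>p. good (w p)" and j: "j \<le> T"
    and c: "most_central (\<lambda>x x'. norm (x - x')) m (Y w j) (c j w)"
  shows "prox_objective (lam j) (X w (Suc j)) (center w (Suc j))
    \<le> (gbar (center w j) + hr (center w j)) + lam j / (\<mu> + pp j) * \<delta>"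
proof -
  have C: "center w j \<in> C" using prox_minimizes(1)[OF pp_nonneg] j by simp
  have "lam j / 2 * (norm (center w j - X w (Suc j)))\<^sup>2 \<le> lam j / 2 * (2 * \<delta> / (\<mu> + pp j))"
    using lam_nonneg[OF j] by (intro mult_left_mono iterate_near_center[OF assms]) simp
  moreover have "lam j / 2 * (2 * \<delta> / (\<mu> + pp j)) = lam j / (\<mu> + pp j) * \<delta>" by simp
  moreover have "prox_objective (lam j) (X w (Suc j)) (center w (Suc j))
      \<le> prox_objective (lam j) (X w (Suc j)) (center w j)"
    unfolding pp_simps by (rule prox_objective_min[OF lam_nonneg[OF j] C])
  ultimately show ?thesis unfolding prox_objective_def by linarith
qed

lemma boost_suboptimality:
  assumes w: "w \<in> space Q" and nb: "\<And>j. j \<le> T + 2 \<Longrightarrow> w \<notin> bad j" and good: "\<forall>p. good (w p)"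
    and c: "\<And>j. j \<le> T \<Longrightarrow> most_central (\<lambda>x x'. norm (x - x')) m (boost_y g h lbar \<mu> \<delta> lam c w j) (c j w)"
    and cu: "c (T + 1) w \<in> boost_I1 g h lbar \<mu> L \<delta> lam T m c w"
    and cv: "most_central (\<lambda>x x'. norm (x - x')) m (boost_v g h lbar \<mu> L \<delta> lam T c w) (c (T + 2) w)"
    and x: "x \<in> BoostERMC g h lbar \<mu> L \<delta> lam T m c w"
  shows "x \<in> C" "gbar x + hr x
    \<le> gbar (prox 0 0) + hr (prox 0 0) + (1 + (\<Sum>i=0..T. lam i / (\<mu> + pp i))) * \<delta>"
proof -
  interpret N: pseudometric "\<lambda>x x'::'b. norm (x - x')" by (rule pseudometric_norm)
  define xT where "xT = X w (Suc T)"
  define e where "e = gap_eps \<mu> L \<delta> (lam T)"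
  define \<kappa> where "\<kappa> = (L + lam T) / (\<mu> + lam T)"
  define v where "v = boost_v g h lbar \<mu> L \<delta> lam T c w (c (T + 2) w)"
  have lT: "0 \<le> lam T" by (rule lam_nonneg) simp
  have nu: "0 < \<mu> + lam T" and LT: "0 < L + lam T" using mu_pos mu_le_L lT by auto
  have e0: "0 < e" using tol_pos[of "Suc T"] by (simp add: tol_def e_def)
  \<comment> \<open>This makes the loss \<open>99 * \<kappa> * e\<close> of
    \<open>gap_estimate\<close> at most \<open>\<delta>\<close>.\<close>
  have ke: "222 * (\<kappa> * e) = \<delta>"
  proof -
    have "222 * (a / b * (\<delta> * b / (222 * a))) = \<delta>" if "0 < a" "0 < b" for a b using that by simp
    from this[OF LT nu] show ?thesis by (simp only: \<kappa>_def e_def gap_eps_def)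
  qed
  have m: "0 < m" by (rule not_bad_majority(1)[OF w nb[of 0]]) simp
  have cY: "most_central (\<lambda>x x'. norm (x - x')) m (Y w j) (c j w)" if "j \<le> T" for j
    using c[OF that] by (simp add: boost_y_eq[OF that good])
  note step = center_step[OF w nb good _ cY]
  \<comment> \<open>The induction starts at \<open>center w 0 = prox 0 0\<close>, the unregularized
    minimizer, since the first penalty is 0.\<close>
  have upto: "gbar (center w j) + hr (center w j)
      \<le> gbar (prox 0 0) + hr (prox 0 0) + (\<Sum>i<j. lam i / (\<mu> + pp i)) * \<delta>" if "j \<le> T" for j
    using that
  proof (induction j)
    case (Suc j)
    have "gbar (center w (Suc j)) + hr (center w (Suc j)) \<le> prox_objective (lam j) (X w (Suc j)) (center w (Suc j))"
      using lam_nonneg[of j] Suc.prems by (simp add: prox_objective_def)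
    also have "\<dots> \<le> (gbar (center w j) + hr (center w j)) + lam j / (\<mu> + pp j) * \<delta>"
      by (rule step) (use Suc.prems in auto)
    finally show ?case using Suc by (simp add: distrib_right)
  qed simp
  have last: "prox_objective (lam T) xT (prox (lam T) xT)
      \<le> gbar (prox 0 0) + hr (prox 0 0) + (\<Sum>i=0..T. lam i / (\<mu> + pp i)) * \<delta>"
  proof -
    have "prox_objective (lam T) xT (prox (lam T) xT) \<le> (gbar (center w T) + hr (center w T)) + lam T / (\<mu> + pp T) * \<delta>"
      using step[of T] by (simp add: xT_def del: X.simps)
    also have "\<dots> \<le> gbar (prox 0 0) + hr (prox 0 0) + (\<Sum>i<T. lam i / (\<mu> + pp i)) * \<delta> + lam T / (\<mu> + pp T) * \<delta>"
      using upto[of T] by simp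
    also have "\<dots> = gbar (prox 0 0) + hr (prox 0 0) + (\<Sum>i=0..T. lam i / (\<mu> + pp i)) * \<delta>"
      by (simp add: distrib_right atLeast0AtMost flip: lessThan_Suc_atMost)
    finally show ?thesis .
  qed
  have maj: "real m / 2 < real (card {k. k < m \<and>
      prox_objective (lam T) xT (Y w (Suc T) k) \<le> prox_objective (lam T) xT (prox (lam T) xT) + e})"
    using stage_majority[OF w nb good, of "Suc T"] by (simp add: tol_def e_def xT_def del: X.simps)
  have i0: "c (T + 1) w \<in> Extract (\<lambda>x x'. norm (x - x')) m (Y w (Suc T))"
    using cu by (simp add: boost_I1_def boost_u_eq[OF good])
  have xh: "X w (T + 2) = Y w (Suc T) (c (T + 1) w)" by (simp add: X_Suc del: X.simps)
  define G where "G = gradient gbar (X w (T + 2)) + lam T *\<^sub>R (X w (T + 2) - xT)"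
  have vG: "norm (v - G) \<le> 3 * sqrt rgrad"
    unfolding v_def
  proof (rule N.most_central_near(2)[OF _ _ m cv])
    have "norm (boost_v g h lbar \<mu> L \<delta> lam T c w k - G) \<le> sqrt rgrad"
      if "(X w (T + 2), stream_of (T + 2) k w) \<notin> fail (T + 2)" for k
    proof -
      have "stream_of (T + 2) k w \<in> space S" by (rule measurable_space[OF stream_measurable w])
      then have "(norm (grad_error ngrad (X w (T + 2)) (stream_of (T + 2) k w)))\<^sup>2 \<le> rgrad"
        using that by (simp add: fail_def del: X.simps)
      then have "norm (grad_error ngrad (X w (T + 2)) (stream_of (T + 2) k w)) \<le> sqrt rgrad"
        by (rule real_le_rsqrt)
      then show ?thesis unfolding G_def xT_def boost_v_eq[OF good] .
    qed
    then have "card {k. k < m \<and> (X w (T + 2), stream_of (T + 2) k w) \<notin> fail (T + 2)}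
        \<le> card {k. k < m \<and> norm (boost_v g h lbar \<mu> L \<delta> lam T c w k - G) \<le> sqrt rgrad}"
      by (intro card_mono) auto
    then show "real m / 2 < real (card {k. k < m \<and> norm (boost_v g h lbar \<mu> L \<delta> lam T c w k - G) \<le> sqrt rgrad})"
      using not_bad_majority(2)[OF w nb[of "T + 2"]] by linarith
    show "0 \<le> sqrt rgrad" using rgrad_pos by simp
  qed
  have "sqrt rgrad \<le> (L + lam T) * sqrt (2 * e / (\<mu> + lam T))"
  proof (rule real_le_lsqrt)
    \<comment> \<open>\<open>rgrad\<close> simplifies to
      \<open>(L + lam T)\<^sup>2 * e / (\<mu> + lam T)\<close>, half of what
      \<open>gap_estimate\<close> allows.\<close>
    have "((L + lam T) * sqrt (2 * e / (\<mu> + lam T)))\<^sup>2 = 2 * rgrad"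
    proof -
      have "(a * sqrt (2 * e / b))\<^sup>2 = 2 * ((a / b)\<^sup>2 * b * e)" if "0 < b" for a b
      proof -
        have "(a * sqrt (2 * e / b))\<^sup>2 = a\<^sup>2 * (2 * e / b)"
          using that e0 by (simp add: power_mult_distrib)
        then show ?thesis using that by (simp add: power2_eq_square)
      qed
      from this[OF nu] show ?thesis by (simp only: rgrad_def e_def)
    qed
    then show "rgrad \<le> ((L + lam T) * sqrt (2 * e / (\<mu> + lam T)))\<^sup>2" using rgrad_pos by simp
  qed (use nu LT e0 in auto)
  with vG have v: "norm (v - (gradient gbar (Y w (Suc T) (c (T + 1) w)) + lam T *\<^sub>R (Y w (Suc T) (c (T + 1) w) - xT)))
      \<le> 3 * ((L + lam T) * sqrt (2 * e / (\<mu> + lam T)))"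
    unfolding G_def xh by linarith
  obtain i where i: "x = Y w (Suc T) i" "i \<in> Extract (\<lambda>x x'. norm (x - x')) m (Y w (Suc T))"
      "i \<in> Extract (gap_pseudometric h v) m (Y w (Suc T))"
    using x by (auto simp: BoostERMC_def boost_I1_def boost_I2_def boost_u_eq[OF good] v_def)
  note gap = gap_estimate[OF lT e0 m Y_in_dom[OF order_refl good] maj i0 i(2,3) v]
  show "x \<in> C" unfolding i by (rule gap(1))
  \<comment> \<open>Returning to the original objective only drops a nonnegative penalty.\<close>
  have "gbar x + hr x \<le> prox_objective (lam T) xT x" using lT by (simp add: prox_objective_def)
  also have "\<dots> \<le> prox_objective (lam T) xT (prox (lam T) xT) + 99 * \<kappa> * e"
    unfolding i(1) \<kappa>_def by (rule gap(2))
  also have "\<dots> \<le> gbar (prox 0 0) + hr (prox 0 0) + (\<Sum>i=0..T. lam i / (\<mu> + pp i)) * \<delta> + \<delta>"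
    using last ke delta_pos by linarith
  also have "\<dots> = gbar (prox 0 0) + hr (prox 0 0) + (1 + (\<Sum>i=0..T. lam i / (\<mu> + pp i))) * \<delta>"
    by (simp add: distrib_right)
  finally show "gbar x + hr x \<le> \<dots>" .
qed

lemma INF_composite: "(INF y. composite P g h y) = ereal (gbar (prox 0 0) + hr (prox 0 0))"
proof (rule antisym)
  have comp: "composite P g h y = ereal (gbar y + hr y)" if "y \<in> C" for y
    using that by (simp add: composite_def h_eq_hr)
  have C: "prox 0 0 \<in> C" by (rule prox_minimizes(1)) simp
  show "(INF y. composite P g h y) \<le> ereal (gbar (prox 0 0) + hr (prox 0 0))"
    using comp[OF C] by (metis INF_lower UNIV_I)
  show "ereal (gbar (prox 0 0) + hr (prox 0 0)) \<le> (INF y. composite P g h y)"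
  proof (rule INF_greatest)
    fix y
    show "ereal (gbar (prox 0 0) + hr (prox 0 0)) \<le> composite P g h y"
    proof (cases "y \<in> C")
      case True
      then show ?thesis using prox_objective_min[of 0 y 0] by (simp add: comp prox_objective_def)
    next
      case False
      then show ?thesis by (simp add: composite_def edom_def)
    qed
  qed
qed

lemma boost_guarantee:
  "\<exists>A \<in> sets Q. measure Q A \<ge> 1 - (real T + 3) * exp (- (real m / 18)) \<and>
     (\<forall>w\<in>A. \<forall>x \<in> BoostERMC g h lbar \<mu> L \<delta> lam T m c w.
        composite P g h x - (INF y. composite P g h y)
          \<le> ereal ((1 + (\<Sum>i=0..T. lam i / (\<mu> + pp i))) * \<delta>))"
proof -
  define V where "V w \<longleftrightarrow> (\<forall>j\<le>T. most_central (\<lambda>x x'. norm (x - x')) m (boost_y g h lbar \<mu> \<delta> lam c w j) (c j w)) \<and>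
        c (T + 1) w \<in> boost_I1 g h lbar \<mu> L \<delta> lam T m c w \<and>
        most_central (\<lambda>x x'. norm (x - x')) m (boost_v g h lbar \<mu> L \<delta> lam T c w) (c (T + 2) w)" for w
  have "AE w in Q. (\<forall>p. good (w p)) \<and> V w"
    using AE_all_good valid unfolding valid_choices_def V_def[symmetric] by eventually_elim simp
  \<comment> \<open>Validity of the choices is only an almost sure property; a measurable set of
    full measure on which it holds is extracted before removing the failure events.\<close>
  then obtain B where B: "B \<subseteq> {w \<in> space Q. (\<forall>p. good (w p)) \<and> V w}" "B \<in> sets Q" "measure Q B = 1"
    by (rule Q.AE_E_prob)
  \<comment> \<open>The union runs over stages 0 to \<open>T + 2\<close>, which gives the factor
    \<open>T + 3\<close>.\<close>
  define D where "D = (\<Union>j\<in>{..T + 2}. bad j)"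
  have D: "D \<in> sets Q" unfolding D_def using prob_bad(1) by auto
  have "measure Q D \<le> (\<Sum>j\<in>{..T + 2}. measure Q (bad j))"
    unfolding D_def by (rule Q.finite_measure_subadditive_finite) (use prob_bad(1) in auto)
  also have "\<dots> \<le> (\<Sum>j\<in>{..T + 2}. exp (- (real m / 18)))"
    by (rule sum_mono) (use prob_bad(2) in auto)
  finally have PD: "measure Q D \<le> (real T + 3) * exp (- (real m / 18))" by (simp add: ac_simps)
  show ?thesis
  proof (intro bexI[of _ "B - D"] conjI ballI)
    have "measure Q (B - D) = measure Q B - measure Q (B \<inter> D)"
      using B(2) D by (rule Q.finite_measure_Diff')
    moreover have "measure Q (B \<inter> D) \<le> measure Q D" using D by (intro Q.finite_measure_mono) auto
    ultimately show "1 - (real T + 3) * exp (- (real m / 18)) \<le> measure Q (B - D)" using B(3) PD by linarith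
    show "B - D \<in> sets Q" using B(2) D by auto
    fix w x assume w: "w \<in> B - D" and x: "x \<in> BoostERMC g h lbar \<mu> L \<delta> lam T m c w"
    then have "w \<in> space Q" "\<forall>p. good (w p)" "V w" "\<And>j. j \<le> T + 2 \<Longrightarrow> w \<notin> bad j"
      using B(1) by (auto simp: D_def)
    then have "x \<in> C" "gbar x + hr x \<le> gbar (prox 0 0) + hr (prox 0 0) + (1 + (\<Sum>i=0..T. lam i / (\<mu> + pp i))) * \<delta>"
      using boost_suboptimality[of w x] x unfolding V_def by auto
    then show "composite P g h x - (INF y. composite P g h y) \<le> ereal ((1 + (\<Sum>i=0..T. lam i / (\<mu> + pp i))) * \<delta>)"
      unfolding INF_composite by (simp add: composite_def h_eq_hr)
  qed
qed

end

theorem theorem6p8: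
  fixes P :: "'z measure"
    and g :: "'a::euclidean_space \<Rightarrow> 'z \<Rightarrow> real"
    and h :: "'a \<Rightarrow> ereal"
    and U :: "'a set"
    and ell :: "'z \<Rightarrow> real"
    and lbar \<mu> L \<delta> :: real
    and lam :: "nat \<Rightarrow> real"
    and T m :: nat
    and c :: "'z choices"
  assumes "prob_space P"
    \<comment> \<open>the objective: measurability, finite expectations, properness, closedness\<close>
    and "(\<lambda>(x, z). g x z) \<in> borel_measurable (borel \<Otimes>\<^sub>M P)"
    and "\<And>x. integrable P (g x)"
    and "\<And>x. h x \<noteq> -\<infinity>" and "edom h \<noteq> {}"
    and "closed_function (composite P g h)"
    \<comment> \<open>convexity\<close>
    and "ext_convex h" and "0 < \<mu>"
    and "AE z in P. strongly_convex \<mu> (\<lambda>x. ereal (g x z) + h x)"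
    \<comment> \<open>Lipschitz continuity in expectation\<close>
    and "open U" and "edom h \<subseteq> U"
    and "ell \<in> borel_measurable P" and "integrable P (\<lambda>z. (ell z)\<^sup>2)"
    and "0 < lbar" and "sqrt (LINT z|P. (ell z)\<^sup>2) \<le> lbar"
    and "\<And>x y z. x \<in> U \<Longrightarrow> y \<in> U \<Longrightarrow> z \<in> space P \<Longrightarrow> \<bar>g x z - g y z\<bar> \<le> ell z * norm (x - y)"
    \<comment> \<open>smoothness of the expectation (condition number at least 1), existence of the gradient estimator\<close>
    and "L_smooth L (expected_loss P g)" and "\<mu> \<le> L"
    and "AE z in P. \<forall>x\<in>edom h. (\<lambda>x. g x z) differentiable (at x)"
    \<comment> \<open>parameters and choices of the algorithm\<close>
    and "0 < \<delta>"
    and "0 \<le> lam 0" and "\<And>i. i < T \<Longrightarrow> lam i \<le> lam (Suc i)"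
    and "nonanticipating P T c"
    and "valid_choices P g h lbar \<mu> L \<delta> lam T m c"
  shows "\<exists>A \<in> sets (sample_space P).
           measure (sample_space P) A \<ge> 1 - (real T + 3) * exp (- (real m / 18)) \<and>
           (\<forall>w\<in>A. \<forall>x \<in> BoostERMC g h lbar \<mu> L \<delta> lam T m c w.
              composite P g h x - (INF y. composite P g h y)
                \<le> ereal ((1 + (\<Sum>i=0..T. lam i / (\<mu> + prev_pen lam i))) * \<delta>))"
proof -
  interpret boost_run P g h U ell lbar \<mu> L \<delta> lam T m c
    using assms by (intro boost_run.intro stochastic_composite.intro stochastic_composite_axioms.intro boost_run_axioms.intro)
  show ?thesis by (rule boost_guarantee)
qed

end
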